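(* Let $J\vartriangleleft A$ be a closed ideal in a $C^*$-algebra $A$ and let $(\mathcal{J}\vartriangleleft\mathcal{A},\mathcal{H},\mathcal{D})$ be a higher-order relative spectral triple for $J\vartriangleleft A$ with representation $\rho\colon A\to\mathbb{B}(\mathcal{H})$. Let $F\coloneqq\mathcal{D}(1+\mathcal{D}^*\mathcal{D})^{-\frac12}$ be the bounded transform of $\mathcal{D}$. Then \[\rho(j)(F-F^* ),\quad \rho(j)(1-F^2),\quad [F,\rho(a)]\in\mathbb{K}(\mathcal{H})\] for all $j\in J$ and $a\in A$. In particular $(\rho,\mathcal{H},F)$ is a relative $K$-cycle for $J\vartriangleleft A$ and defines a class $[\mathcal{D}]\in K^*(J\vartriangleleft A)$.
   Context: A (even) higher-order relative spectral triple $(\mathcal{J}\vartriangleleft\mathcal{A},\mathcal{H},\mathcal{D})$ of order $m>0$ for $J\vartriangleleft A$ consists of a $\mathbb{Z}/2$-graded separable Hilbert space $\mathcal{H}$, an even $*$-representation $\rho\colon A\to\mathbb{B}(\mathcal{H})$, a dense $*$-subalgebra $\mathcal{A}\subseteq A$, a $*$-subalgebra $\mathcal{J}\subseteq J\cap\mathcal{A}$ dense in $J$, and an odd symmetric closed densely defined operator $\mathcal{D}$ on $\mathcal{H}$ such that: (1) $\rho(a)\operatorname{dom}\mathcal{D}\subseteq\operatorname{dom}\mathcal{D}$ for $a\in\mathcal{A}$; (2) $\rho(j)\operatorname{dom}\mathcal{D}^*\subseteq\operatorname{dom}\mathcal{D}$ for $j\in\mathcal{J}$; (3) $\rho(j)(1+\mathcal{D}^*\mathcal{D})^{-1/2}\in\mathbb{K}(\mathcal{H})$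 for $j\in\mathcal{J}$; (4) $[\mathcal{D},\rho(a)](1+\mathcal{D}^*\mathcal{D})^{-1/2}\in\mathbb{K}(\mathcal{H})$ for $a\in\mathcal{A}$; (5) $[\mathcal{D},\rho(a)](1+\mathcal{D}^*\mathcal{D})^{-\frac12+\frac1{2m}}$ extends to a bounded operator for $a\in\mathcal{A}$. An odd higher-order relative spectral triple is the same with $\mathcal{H}$ trivially graded and $\mathcal{D}$ not required to be odd. A relative $K$-cycle for $J\vartriangleleft A$ is a triple $(\rho,\mathcal{H},F)$ with $\rho$ a (even, in the graded case) $*$-representation of $A$ on a separable Hilbert space and $F\in\mathbb{B}(\mathcal{H})$ (odd, in the graded case) such that $\rho(j)(F-F^* ),\rho(j)(1-F^2),[F,\rho(a)]$ are compact for all $j\in J,a\in A$; $K^0(J\vartriangleleft A)$, resp. $K^1(J\vartriangleleft A)$, is the group of such even, resp. odd, cycles modulo unitary equivalence, operator homotopy and addition of degenerate cycles (relative $K$-homology). *)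

theory Defs
  imports "HOL-Analysis.Analysis"
begin

text \<open>A complex Hilbert space is a real Hilbert space (type class real_inner + complete_space,
  the real inner product being the real part of the complex one) together with an isometric
  real-linear map ci (multiplication by the imaginary unit) with ci (ci x) = - x.
  A real-linear map is complex-linear iff it commutes with ci.\<close>

definition complex_structure :: "('h::real_inner \<Rightarrow> 'h) \<Rightarrow> bool" where
  "complex_structure ci \<longleftrightarrow> linear ci \<and> (\<forall>x. ci (ci x) = - x) \<and>
     (\<forall>x y. inner (ci x) (ci y) = inner x y)"

definition separable_hilbert :: "('h::{real_inner,complete_space} \<Rightarrow> 'h) \<Rightarrow> bool" where
  "separable_hilbert ci \<longleftrightarrow> complex_structure ci \<and>
     (\<exists>S::'h set. countable S \<and> closure S = UNIV)"

definition bounded_op :: "('h::real_inner \<Rightarrow> 'h) \<Rightarrow> ('h \<Rightarrow> 'h) \<Rightarrow> bool" where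
  "bounded_op ci T \<longleftrightarrow> bounded_linear T \<and> (\<forall>x. T (ci x) = ci (T x))"

definition badj :: "('h::real_inner \<Rightarrow> 'h) \<Rightarrow> 'h \<Rightarrow> 'h" where
  "badj T = (\<lambda>y. THE z. \<forall>x. inner (T x) y = inner x z)"

definition compact_op :: "('h::real_normed_vector \<Rightarrow> 'h) \<Rightarrow> bool" where
  "compact_op T \<longleftrightarrow> linear T \<and> compact (closure (T ` cball 0 1))"

definition grading :: "('h::real_inner \<Rightarrow> 'h) \<Rightarrow> ('h \<Rightarrow> 'h) \<Rightarrow> bool" where
  "grading ci g \<longleftrightarrow> bounded_op ci g \<and> (\<forall>x. g (g x) = x) \<and>
     (\<forall>x y. inner (g x) y = inner x (g y))"

definition closed_dd_symmetric ::
  "('h::{real_inner,complete_space} \<Rightarrow> 'h) \<Rightarrow> 'h set \<Rightarrow> ('h \<Rightarrow> 'h) \<Rightarrow> bool" where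
  "closed_dd_symmetric ci dm D \<longleftrightarrow>
     subspace dm \<and> ci ` dm \<subseteq> dm \<and>
     (\<forall>x\<in>dm. \<forall>y\<in>dm. D (x + y) = D x + D y) \<and>
     (\<forall>x\<in>dm. \<forall>r. D (r *\<^sub>R x) = r *\<^sub>R D x) \<and>
     (\<forall>x\<in>dm. D (ci x) = ci (D x)) \<and>
     closure dm = UNIV \<and>
     closed {(x, D x) | x. x \<in> dm} \<and>
     (\<forall>x\<in>dm. \<forall>y\<in>dm. inner (D x) y = inner x (D y))"

definition adj_dom :: "'h set \<Rightarrow> ('h::real_inner \<Rightarrow> 'h) \<Rightarrow> 'h set" where
  "adj_dom dm D = {y. \<exists>z. \<forall>x\<in>dm. inner (D x) y = inner x z}"

definition adj_op :: "'h set \<Rightarrow> ('h::real_inner \<Rightarrow> 'h) \<Rightarrow> 'h \<Rightarrow> 'h" where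
  "adj_op dm D y = (THE z. \<forall>x\<in>dm. inner (D x) y = inner x z)"

definition res_op :: "'h set \<Rightarrow> ('h::real_inner \<Rightarrow> 'h) \<Rightarrow> 'h \<Rightarrow> 'h" where
  "res_op dm D y = (THE x. x \<in> dm \<and> D x \<in> adj_dom dm D \<and> x + adj_op dm D (D x) = y)"

text \<open>Fractional powers of a bounded positive operator T, via the Balakrishnan formula
  T^s x = (sin (pi s) / pi) * integral_0^infty t^(s-1) T (t + T)^{-1} x dt  for 0 < s < 1,
  and T^s = T^(floor s) T^(frac s) in general (s \<ge> 0).\<close>
definition shifted_inv :: "('h::real_vector \<Rightarrow> 'h) \<Rightarrow> real \<Rightarrow> 'h \<Rightarrow> 'h" where
  "shifted_inv T t y = (THE x. t *\<^sub>R x + T x = y)"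

definition fpow01 :: "('h::real_normed_vector \<Rightarrow> 'h) \<Rightarrow> real \<Rightarrow> 'h \<Rightarrow> 'h" where
  "fpow01 T s x = (sin (pi * s) / pi) *\<^sub>R
      integral {0<..} (\<lambda>t. (t powr (s - 1)) *\<^sub>R T (shifted_inv T t x))"

definition fpow :: "('h::real_normed_vector \<Rightarrow> 'h) \<Rightarrow> real \<Rightarrow> 'h \<Rightarrow> 'h" where
  "fpow T s x = (T ^^ nat \<lfloor>s\<rfloor>) (if frac s = 0 then x else fpow01 T (frac s) x)"

text \<open>Graph of R^g for arbitrary real g (for g < 0, R^g is the inverse of R^(-g)):
  pow_rel T g y x means x = T^g y.\<close>
definition pow_rel :: "('h::real_normed_vector \<Rightarrow> 'h) \<Rightarrow> real \<Rightarrow> 'h \<Rightarrow> 'h \<Rightarrow> bool" where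
  "pow_rel T g y x \<longleftrightarrow> (g \<ge> 0 \<and> x = fpow T g y) \<or> (g < 0 \<and> y = fpow T (- g) x)"

definition inv_sqrt_op :: "'h set \<Rightarrow> ('h::real_inner \<Rightarrow> 'h) \<Rightarrow> 'h \<Rightarrow> 'h" where
  "inv_sqrt_op dm D = fpow (res_op dm D) (1/2)"

definition bounded_transform :: "'h set \<Rightarrow> ('h::real_inner \<Rightarrow> 'h) \<Rightarrow> 'h \<Rightarrow> 'h" where
  "bounded_transform dm D = (\<lambda>x. D (inv_sqrt_op dm D x))"

definition cstar_algebra :: "('a::{real_normed_algebra,banach} \<Rightarrow> 'a) \<Rightarrow> ('a \<Rightarrow> 'a) \<Rightarrow> bool" where
  "cstar_algebra ciA st \<longleftrightarrow>
     linear ciA \<and> (\<forall>x. ciA (ciA x) = - x) \<and> (\<forall>x. norm (ciA x) = norm x) \<and>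
     (\<forall>x y. ciA (x * y) = ciA x * y \<and> ciA (x * y) = x * ciA y) \<and>
     (\<forall>x. st (st x) = x) \<and> (\<forall>x y. st (x + y) = st x + st y) \<and>
     (\<forall>r x. st (r *\<^sub>R x) = r *\<^sub>R st x) \<and> (\<forall>x. st (ciA x) = - ciA (st x)) \<and>
     (\<forall>x y. st (x * y) = st y * st x) \<and> (\<forall>x. norm (st x * x) = (norm x)\<^sup>2)"

definition closed_ideal :: "('a::{real_normed_algebra,banach} \<Rightarrow> 'a) \<Rightarrow> 'a set \<Rightarrow> bool" where
  "closed_ideal ciA J \<longleftrightarrow> closed J \<and> subspace J \<and> ciA ` J \<subseteq> J \<and>
     (\<forall>j\<in>J. \<forall>a. a * j \<in> J \<and> j * a \<in> J)"

definition star_subalgebra :: "('a::{real_normed_algebra,banach} \<Rightarrow> 'a) \<Rightarrow> ('a \<Rightarrow> 'a) \<Rightarrow> 'a set \<Rightarrow> bool" where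
  "star_subalgebra ciA st B \<longleftrightarrow> subspace B \<and> ciA ` B \<subseteq> B \<and>
     (\<forall>x\<in>B. \<forall>y\<in>B. x * y \<in> B) \<and> st ` B \<subseteq> B"

definition star_rep ::
  "('a::{real_normed_algebra,banach} \<Rightarrow> 'a) \<Rightarrow> ('a \<Rightarrow> 'a) \<Rightarrow>
   ('h::{real_inner,complete_space} \<Rightarrow> 'h) \<Rightarrow> ('a \<Rightarrow> 'h \<Rightarrow> 'h) \<Rightarrow> bool" where
  "star_rep ciA st ci \<rho> \<longleftrightarrow>
     (\<forall>a. bounded_op ci (\<rho> a)) \<and>
     (\<forall>a b. \<rho> (a + b) = (\<lambda>x. \<rho> a x + \<rho> b x)) \<and>
     (\<forall>r a. \<rho> (r *\<^sub>R a) = (\<lambda>x. r *\<^sub>R \<rho> a x)) \<and>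
     (\<forall>a. \<rho> (ciA a) = ci \<circ> \<rho> a) \<and>
     (\<forall>a b. \<rho> (a * b) = \<rho> a \<circ> \<rho> b) \<and>
     (\<forall>a. \<rho> (st a) = badj (\<rho> a))"

definition commD :: "('h::real_vector \<Rightarrow> 'h) \<Rightarrow> ('h \<Rightarrow> 'h) \<Rightarrow> 'h \<Rightarrow> 'h" where
  "commD D T = (\<lambda>x. D (T x) - T (D x))"

definition hrst_odd ::
  "('a::{real_normed_algebra,banach} \<Rightarrow> 'a) \<Rightarrow> ('a \<Rightarrow> 'a) \<Rightarrow> 'a set \<Rightarrow>
   ('h::{real_inner,complete_space} \<Rightarrow> 'h) \<Rightarrow> ('a \<Rightarrow> 'h \<Rightarrow> 'h) \<Rightarrow>
   'a set \<Rightarrow> 'a set \<Rightarrow> 'h set \<Rightarrow> ('h \<Rightarrow> 'h) \<Rightarrow> real \<Rightarrow> bool" where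
  "hrst_odd ciA st J ci \<rho> A0 J0 dm D m \<longleftrightarrow>
     m > 0 \<and> cstar_algebra ciA st \<and> closed_ideal ciA J \<and>
     separable_hilbert ci \<and> star_rep ciA st ci \<rho> \<and>
     star_subalgebra ciA st A0 \<and> closure A0 = UNIV \<and>
     star_subalgebra ciA st J0 \<and> J0 \<subseteq> J \<inter> A0 \<and> closure J0 = J \<and>
     closed_dd_symmetric ci dm D \<and>
     (\<forall>a\<in>A0. \<rho> a ` dm \<subseteq> dm) \<and>
     (\<forall>j\<in>J0. \<rho> j ` adj_dom dm D \<subseteq> dm) \<and>
     (\<forall>j\<in>J0. compact_op (\<rho> j \<circ> inv_sqrt_op dm D)) \<and>
     (\<forall>a\<in>A0. compact_op (commD D (\<rho> a) \<circ> inv_sqrt_op dm D)) \<and>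
     (\<forall>a\<in>A0. \<exists>C. \<forall>y x. pow_rel (res_op dm D) (1/2 - 1/(2*m)) y x \<and> x \<in> dm \<longrightarrow>
              norm (commD D (\<rho> a) x) \<le> C * norm y)"

definition hrst_even ::
  "('a::{real_normed_algebra,banach} \<Rightarrow> 'a) \<Rightarrow> ('a \<Rightarrow> 'a) \<Rightarrow> 'a set \<Rightarrow>
   ('h::{real_inner,complete_space} \<Rightarrow> 'h) \<Rightarrow> ('h \<Rightarrow> 'h) \<Rightarrow> ('a \<Rightarrow> 'h \<Rightarrow> 'h) \<Rightarrow>
   'a set \<Rightarrow> 'a set \<Rightarrow> 'h set \<Rightarrow> ('h \<Rightarrow> 'h) \<Rightarrow> real \<Rightarrow> bool" where
  "hrst_even ciA st J ci g \<rho> A0 J0 dm D m \<longleftrightarrow>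
     grading ci g \<and> (\<forall>a. \<rho> a \<circ> g = g \<circ> \<rho> a) \<and>
     g ` dm \<subseteq> dm \<and> (\<forall>x\<in>dm. D (g x) = - g (D x)) \<and>
     hrst_odd ciA st J ci \<rho> A0 J0 dm D m"

definition kcycle_odd ::
  "('a::{real_normed_algebra,banach} \<Rightarrow> 'a) \<Rightarrow> ('a \<Rightarrow> 'a) \<Rightarrow> 'a set \<Rightarrow>
   ('h::{real_inner,complete_space} \<Rightarrow> 'h) \<Rightarrow> ('a \<Rightarrow> 'h \<Rightarrow> 'h) \<Rightarrow> ('h \<Rightarrow> 'h) \<Rightarrow> bool" where
  "kcycle_odd ciA st J ci \<rho> F \<longleftrightarrow>
     separable_hilbert ci \<and> star_rep ciA st ci \<rho> \<and> bounded_op ci F \<and>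
     (\<forall>j\<in>J. compact_op (\<lambda>x. \<rho> j (F x - badj F x))) \<and>
     (\<forall>j\<in>J. compact_op (\<lambda>x. \<rho> j (x - F (F x)))) \<and>
     (\<forall>a. compact_op (\<lambda>x. F (\<rho> a x) - \<rho> a (F x)))"

definition kcycle_even ::
  "('a::{real_normed_algebra,banach} \<Rightarrow> 'a) \<Rightarrow> ('a \<Rightarrow> 'a) \<Rightarrow> 'a set \<Rightarrow>
   ('h::{real_inner,complete_space} \<Rightarrow> 'h) \<Rightarrow> ('h \<Rightarrow> 'h) \<Rightarrow> ('a \<Rightarrow> 'h \<Rightarrow> 'h) \<Rightarrow> ('h \<Rightarrow> 'h) \<Rightarrow> bool" where
  "kcycle_even ciA st J ci g \<rho> F \<longleftrightarrow>
     grading ci g \<and> (\<forall>a. \<rho> a \<circ> g = g \<circ> \<rho> a) \<and> (\<forall>x. F (g x) = - g (F x)) \<and>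
     kcycle_odd ciA st J ci \<rho> F"

end

theory Submission
  imports Defs "HOL-Computational_Algebra.Polynomial"
begin

text \<open>
  Write \<open>R = (1 + D\<^sup>*D)\<^sup>-\<^sup>1\<close> and \<open>S = R\<^sup>1\<^sup>/\<^sup>2\<close>, so that \<open>F = D S\<close>, \<open>F\<^sup>*F = 1 - R\<close> and \<open>S\<close> maps the
  Hilbert space onto the domain of \<open>D\<close>. If \<open>a\<close> preserves that domain, then \<open>a S = S Y\<close> with \<open>Y\<close>
  bounded, \<open>[F, a] = K - F (Y - a)\<close> with \<open>K = [D, a] S\<close> compact, and \<open>Z = Y - a\<close> solves the Sylvester
  equation \<open>S Z + Z S = G\<close>, where \<open>G = F\<^sup>*K S - K'\<^sup>*F S\<close> is compact (\<open>K'\<close> belongs to \<open>a\<^sup>*\<close>). With the Cayley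
  transform \<open>C = (1 - S) (1 + S)\<^sup>-\<^sup>1\<close> and \<open>P = (1 + S)\<^sup>-\<^sup>1\<close> the equation reads \<open>Z - C Z C = 2 P G P\<close>, so
  \<open>Z = 2 \<Sum> C\<^sup>n P G P C\<^sup>n\<close>; the higher-order bound on \<open>[D, a]\<close> makes the terms
  \<open>O(n\<^sup>-\<^sup>1\<^sup>-\<^sup>\<delta>)\<close> in norm, hence \<open>Z\<close> is compact.

  The same argument with \<open>Z = D a S - F\<^sup>*a\<close> shows that \<open>F\<^sup>*a - a F\<close> is compact if \<open>a\<close> is a product of
  two elements of the ideal, since these map the domain of \<open>D\<^sup>*\<close> into that of \<open>D\<close>. For
  \<open>a = j\<^sup>*j\<close> this gives that \<open>j\<^sup>*j (F - F\<^sup>*)\<close> is compact, and therefore \<open>j (F - F\<^sup>*)\<close>, because \<open>X\<close> is compact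
  as soon as \<open>X\<^sup>*X\<close> is. Finally \<open>1 - F\<^sup>2 = R - (F - F\<^sup>*) F\<close>.
\<close>

subsection \<open>Orthogonal projections and adjoints\<close>

text \<open>Since \<open>D\<close> is only symmetric, an algebra element preserves the domain of
  \<open>D\<close> but need not preserve that of \<open>D\<^sup>*D\<close>, so a commutator with
  \<open>D\<^sup>*D\<close> is not at hand. The Sylvester equation is therefore derived weakly:
  \<open>inner_R\<close> spreads the two factors \<open>D\<close> over both arguments of the inner
  product. Formally its solution is the integral of \<open>exp (-t S) G exp (-t S)\<close> over t >
  0, and the powers of the Cayley transform are a discrete stand-in for this semigroup. Compactness
  of \<open>G\<close> makes the partial sums compact but does not control the series: were
  \<open>[D, a] S\<close> just bounded, the terms would only be O(1/n). The condition of order m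
  gains a factor n^(-1/m) if m > 1, and 1/n if m <= 1. The powers \<open>C\<^sup>n\<close> tend to 0
  only strongly, which is enough to remove the boundary term of the telescoping sum. Two factors
  from the ideal are used because \<open>D (R x)\<close> lies merely in the domain of the adjoint:
  one factor brings it back into the domain of \<open>D\<close> on the left of the inner product,
  the adjoint of the other does so on the right.\<close>

lemma parallelogram_law:
  fixes x y :: "'a::real_inner"
  shows "(norm (x + y))\<^sup>2 + (norm (x - y))\<^sup>2 = 2 * (norm x)\<^sup>2 + 2 * (norm y)\<^sup>2"
  by (simp add: power2_norm_eq_inner algebra_simps inner_commute)

text \<open>The near-minimisers of the distance form nested closed sets. The parallelogram law makes
  their diameters shrink, and completeness then gives a common point.\<close>

lemma closest_point_in_closed_subspace:
  fixes V :: "'h::{real_inner,complete_space} set"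
  assumes "closed V" "subspace V"
  obtains v where "v \<in> V" "\<And>w. w \<in> V \<Longrightarrow> norm (x - v) \<le> norm (x - w)"
proof -
  define d where "d = (INF w\<in>V. (norm (x - w))\<^sup>2)"
  have ne: "V \<noteq> {}" using assms(2) subspace_0 by blast
  have bdd: "bdd_below ((\<lambda>w. (norm (x - w))\<^sup>2) ` V)" by (rule bdd_belowI[of _ 0]) auto
  have dle: "d \<le> (norm (x - w))\<^sup>2" if "w \<in> V" for w
    unfolding d_def using bdd that by (rule cINF_lower)
  define A where "A n = {w \<in> V. (norm (x - w))\<^sup>2 \<le> d + 1 / real (Suc n)}" for n
  have "\<exists>v. \<forall>n. v \<in> A n"
  proof (rule decreasing_closed_nest[of A])
    show "closed (A n)" for n
    proof -
      have "A n = V \<inter> {w. (norm (x - w))\<^sup>2 \<le> d + 1 / real (Suc n)}" by (auto simp: A_def)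
      moreover have "closed {w. (norm (x - w))\<^sup>2 \<le> d + 1 / real (Suc n)}"
        by (intro closed_Collect_le continuous_intros)
      ultimately show ?thesis using assms(1) by auto
    qed
    show "A n \<noteq> {}" for n
    proof -
      have "d < d + 1 / real (Suc n)" by simp
      then have "\<exists>w\<in>V. (norm (x - w))\<^sup>2 < d + 1 / real (Suc n)"
        using cINF_less_iff[OF ne bdd, of "d + 1 / real (Suc n)"] by (simp add: d_def)
      then show ?thesis by (auto simp: A_def intro: less_imp_le)
    qed
    show "A n \<subseteq> A m" if "m \<le> n" for m n
    proof -
      have "1 / real (Suc n) \<le> 1 / real (Suc m)" using that by (simp add: frac_le)
      then show ?thesis unfolding A_def by (auto intro: order_trans)
    qed
    show "\<exists>n. \<forall>u\<in>A n. \<forall>w\<in>A n. dist u w < e" if "e > 0" for e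
    proof -
      obtain n where n: "1 / real (Suc n) < e\<^sup>2 / 4"
        using nat_approx_posE[of "e\<^sup>2 / 4"] \<open>e > 0\<close> by auto
      have "dist u w < e" if u: "u \<in> A n" and w: "w \<in> A n" for u w
      proof -
        \<comment> \<open>The midpoint lies in the subspace, so its squared distance to
          \<open>x\<close> is at least \<open>d\<close>; this forces near-minimisers
          together.\<close>
        have mid: "(1/2) *\<^sub>R (u + w) \<in> V"
          using u w assms(2) by (auto simp: A_def intro: subspace_scale subspace_add)
        have "(norm ((x - u) + (x - w)))\<^sup>2 + (norm ((x - u) - (x - w)))\<^sup>2
            = 2 * (norm (x - u))\<^sup>2 + 2 * (norm (x - w))\<^sup>2"
          by (rule parallelogram_law)
        moreover have "(norm ((x - u) + (x - w)))\<^sup>2 = 4 * (norm (x - (1/2) *\<^sub>R (u + w)))\<^sup>2"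
        proof -
          have "(x - u) + (x - w) = 2 *\<^sub>R (x - (1/2) *\<^sub>R (u + w))"
            by (simp add: algebra_simps scaleR_2)
          then show ?thesis by (simp only: norm_scaleR) (simp add: power_mult_distrib)
        qed
        moreover have "d \<le> (norm (x - (1/2) *\<^sub>R (u + w)))\<^sup>2" by (rule dle[OF mid])
        moreover have "(norm (x - u))\<^sup>2 \<le> d + 1 / real (Suc n)"
          "(norm (x - w))\<^sup>2 \<le> d + 1 / real (Suc n)" using u w by (auto simp: A_def)
        ultimately have "(norm (w - u))\<^sup>2 \<le> 4 * (1 / real (Suc n))" by (simp add: algebra_simps)
        also have "\<dots> < e\<^sup>2" using n by simp
        finally have "norm (w - u) < e" by (rule power_less_imp_less_base) (use \<open>e > 0\<close> in simp)
        then show ?thesis by (simp add: dist_norm norm_minus_commute)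
      qed
      then show ?thesis by blast
    qed
  qed blast
  then obtain v where v: "\<And>n. v \<in> A n" by blast
  have "(norm (x - v))\<^sup>2 \<le> d"
  proof (rule field_le_epsilon)
    fix e :: real assume "e > 0"
    then obtain n where "1 / real (Suc n) < e" using nat_approx_posE by blast
    then show "(norm (x - v))\<^sup>2 \<le> d + e" using v[of n] by (auto simp: A_def)
  qed
  have "norm (x - v) \<le> norm (x - w)" if "w \<in> V" for w
  proof (rule power2_le_imp_le)
    show "(norm (x - v))\<^sup>2 \<le> (norm (x - w))\<^sup>2"
      using dle[OF that] \<open>(norm (x - v))\<^sup>2 \<le> d\<close> by (rule order_trans[rotated])
  qed simp
  moreover have "v \<in> V" using v[of 0] by (auto simp: A_def)
  ultimately show thesis using that by blast
qed

lemma orthogonal_projection: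
  fixes V :: "'h::{real_inner,complete_space} set"
  assumes "closed V" "subspace V"
  obtains v where "v \<in> V" "\<And>w. w \<in> V \<Longrightarrow> inner (x - v) w = 0"
proof -
  obtain v where v: "v \<in> V" "\<And>w. w \<in> V \<Longrightarrow> norm (x - v) \<le> norm (x - w)"
    using closest_point_in_closed_subspace[OF assms] by metis
  have "inner (x - v) w = 0" if w: "w \<in> V" for w
  proof (cases "w = 0")
    case False
    \<comment> \<open>\<open>t\<close> minimises the quadratic function that sends s to the squared
      norm of (x - v) - s w.\<close>
    define t where "t = inner (x - v) w / inner w w"
    have ww: "inner w w > 0" using False by simp
    have "v + t *\<^sub>R w \<in> V" using v(1) w assms(2) by (intro subspace_add subspace_scale)
    then have "norm (x - v) \<le> norm ((x - v) - t *\<^sub>R w)"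
      using v(2) by (simp add: algebra_simps)
    then have "(norm (x - v))\<^sup>2 \<le> (norm ((x - v) - t *\<^sub>R w))\<^sup>2" by (rule power_mono) simp
    also have "\<dots> = (norm (x - v))\<^sup>2 - 2 * t * inner (x - v) w + t\<^sup>2 * inner w w"
      unfolding power2_norm_eq_inner by (simp add: inner_diff inner_commute power2_eq_square algebra_simps)
    also have "\<dots> = (norm (x - v))\<^sup>2 - (inner (x - v) w)\<^sup>2 / inner w w"
      using ww by (simp add: t_def power2_eq_square field_simps)
    finally have "(inner (x - v) w)\<^sup>2 / inner w w \<le> 0" by simp
    then show ?thesis using ww by (simp add: divide_le_0_iff)
  qed simp
  then show thesis using v(1) that by blast
qed

lemma closed_subspace_eq_UNIV:
  fixes V :: "'h::{real_inner,complete_space} set"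
  assumes "closed V" "subspace V" "\<And>x. (\<And>w. w \<in> V \<Longrightarrow> inner x w = 0) \<Longrightarrow> x = 0"
  shows "V = UNIV"
proof -
  have "x \<in> V" for x
  proof -
    obtain v where "v \<in> V" "\<And>w. w \<in> V \<Longrightarrow> inner (x - v) w = 0"
      using orthogonal_projection[OF assms(1,2)] by metis
    then show ?thesis using assms(3)[of "x - v"] by simp
  qed
  then show ?thesis by blast
qed

lemma subspace_closure:
  fixes V :: "'a::real_normed_vector set"
  assumes "subspace V"
  shows "subspace (closure V)"
  unfolding subspace_def
proof (intro conjI ballI allI)
  show "0 \<in> closure V" using assms subspace_0 closure_subset by blast
next
  fix x y assume "x \<in> closure V" "y \<in> closure V"
  then obtain f g where "\<And>n. f n \<in> V" "f \<longlonglongrightarrow> x" "\<And>n. g n \<in> V" "g \<longlonglongrightarrow> y"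
    by (auto simp: closure_sequential)
  then have "(\<lambda>n. f n + g n) \<longlonglongrightarrow> x + y" "\<And>n. f n + g n \<in> V"
    using assms by (auto intro: tendsto_add subspace_add)
  then have "\<exists>h. (\<forall>n. h n \<in> V) \<and> h \<longlonglongrightarrow> x + y" by (intro exI[of _ "\<lambda>n. f n + g n"]) simp
  then show "x + y \<in> closure V" by (simp add: closure_sequential)
next
  fix c :: real and x assume "x \<in> closure V"
  then obtain f where "\<And>n. f n \<in> V" "f \<longlonglongrightarrow> x"
    by (auto simp: closure_sequential)
  then have "(\<lambda>n. c *\<^sub>R f n) \<longlonglongrightarrow> c *\<^sub>R x" "\<And>n. c *\<^sub>R f n \<in> V"
    using assms by (auto intro: tendsto_scaleR subspace_scale)
  then have "\<exists>h. (\<forall>n. h n \<in> V) \<and> h \<longlonglongrightarrow> c *\<^sub>R x" by (intro exI[of _ "\<lambda>n. c *\<^sub>R f n"]) simp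
  then show "c *\<^sub>R x \<in> closure V" by (simp add: closure_sequential)
qed

lemma dense_subspace_if_orthogonal_trivial:
  fixes V :: "'h::{real_inner,complete_space} set"
  assumes "subspace V" "\<And>x. (\<And>w. w \<in> V \<Longrightarrow> inner x w = 0) \<Longrightarrow> x = 0"
  shows "closure V = UNIV"
proof (rule closed_subspace_eq_UNIV)
  show "subspace (closure V)" using assms(1) by (rule subspace_closure)
  show "x = 0" if "\<And>w. w \<in> closure V \<Longrightarrow> inner x w = 0" for x
    using assms(2) that closure_subset by blast
qed simp

lemma orthogonal_dense_imp_0:
  fixes x :: "'h::real_inner"
  assumes "closure V = UNIV" "\<And>w. w \<in> V \<Longrightarrow> inner x w = 0"
  shows "x = 0"
proof -
  have "closed {w. inner x w = 0}" by (intro closed_Collect_eq continuous_intros)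
  then have "closure V \<subseteq> {w. inner x w = 0}" using assms(2) by (intro closure_minimal) auto
  then have "x \<in> {w. inner x w = 0}" using assms(1) by blast
  then show ?thesis by simp
qed

lemma riesz_representation:
  fixes f :: "'h::{real_inner,complete_space} \<Rightarrow> real"
  assumes "bounded_linear f"
  obtains z where "\<And>x. f x = inner x z"
proof (cases "\<forall>x. f x = 0")
  case True then show thesis using that[of 0] by simp
next
  case False
  then obtain u where u: "f u \<noteq> 0" by blast
  interpret f: bounded_linear f by fact
  define V where "V = {x. f x = 0}"
  have "closed V" unfolding V_def
    by (intro closed_Collect_eq continuous_intros f.continuous_on)
  moreover have "subspace V" unfolding V_def subspace_def by (simp add: f.add f.scaleR f.zero)
  ultimately obtain v where v: "v \<in> V" "\<And>w. w \<in> V \<Longrightarrow> inner (u - v) w = 0"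
    using orthogonal_projection by metis
  \<comment> \<open>\<open>e\<close> is orthogonal to the kernel of \<open>f\<close>, which has
    codimension one, so the representing vector must be a multiple of \<open>e\<close>.\<close>
  define e where "e = u - v"
  have fe: "f e = f u" using v(1) by (simp add: e_def f.diff V_def)
  then have "e \<noteq> 0" using u f.zero by auto
  then have ee: "inner e e > 0" by simp
  have "f x = inner x ((f e / inner e e) *\<^sub>R e)" for x
  proof -
    have "x - (f x / f e) *\<^sub>R e \<in> V" using u fe by (simp add: V_def f.diff f.scaleR)
    then have "inner e (x - (f x / f e) *\<^sub>R e) = 0" using v(2) e_def by blast
    then have "inner x e = (f x / f e) * inner e e" by (simp add: inner_diff_right inner_commute)
    then show ?thesis using ee u fe by (simp add: field_simps)
  qed
  then show thesis by (rule that)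
qed

lemma inner_badj:
  fixes T :: "'h::{real_inner,complete_space} \<Rightarrow> 'h"
  assumes "bounded_linear T"
  shows "inner (T x) y = inner x (badj T y)"
proof -
  have "bounded_linear (\<lambda>x. inner (T x) y)"
    using bounded_linear_compose[OF bounded_linear_inner_left assms] .
  then obtain z where z: "\<And>x. inner (T x) y = inner x z" using riesz_representation by metis
  have "badj T y = z" unfolding badj_def
  proof (rule the_equality)
    fix z' assume "\<forall>x. inner (T x) y = inner x z'"
    then have "inner (z' - z) (z' - z) = 0" using z by (metis inner_diff_right diff_self)
    then show "z' = z" by simp
  qed (use z in blast)
  then show ?thesis using z by simp
qed

lemma inner_badj_left:
  fixes T :: "'h::{real_inner,complete_space} \<Rightarrow> 'h"
  assumes "bounded_linear T"
  shows "inner (badj T y) x = inner y (T x)"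
  using inner_badj[OF assms, of x y] by (simp add: inner_commute)

lemma vector_eq_inner:
  fixes x y :: "'a::real_inner"
  assumes "\<And>z. inner x z = inner y z"
  shows "x = y"
proof -
  have "inner (x - y) (x - y) = 0" using assms[of "x - y"] by (simp add: inner_diff_left)
  then show ?thesis by simp
qed

lemma badj_eqI:
  fixes T :: "'h::{real_inner,complete_space} \<Rightarrow> 'h"
  assumes "bounded_linear T" "\<And>x y. inner (T x) y = inner x (T' y)"
  shows "badj T = T'"
proof (rule ext)
  fix y
  have "inner (badj T y) z = inner (T' y) z" for z
    using inner_badj_left[OF assms(1), of y z] assms(2)[of z y] by (simp add: inner_commute)
  then show "badj T y = T' y" by (rule vector_eq_inner)
qed

lemma bounded_linear_bound:
  assumes "bounded_linear T"
  shows "\<exists>C>0. \<forall>x. norm (T x) \<le> C * norm x"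
  using bounded_linear.pos_bounded[OF assms] by (simp add: mult.commute)

lemma bounded_linear_badj:
  fixes T :: "'h::{real_inner,complete_space} \<Rightarrow> 'h"
  assumes "bounded_linear T"
  shows "bounded_linear (badj T)"
proof -
  obtain C where C: "C > 0" "\<And>x. norm (T x) \<le> C * norm x"
    using bounded_linear_bound[OF assms] by blast
  show ?thesis
  proof (rule bounded_linear_intro[where K = C])
    show "badj T (x + y) = badj T x + badj T y" for x y
      by (rule vector_eq_inner) (simp add: inner_badj_left[OF assms] inner_add_left)
    show "badj T (r *\<^sub>R x) = r *\<^sub>R badj T x" for r x
      by (rule vector_eq_inner) (simp add: inner_badj_left[OF assms])
    show "norm (badj T x) \<le> norm x * C" for x
    proof (cases "norm (badj T x) = 0")
      case False
      have "norm (badj T x) * norm (badj T x) = inner x (T (badj T x))"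
        by (simp add: inner_badj_left[OF assms, symmetric] norm_eq_sqrt_inner)
      also have "\<dots> \<le> norm x * norm (T (badj T x))" by (rule norm_cauchy_schwarz)
      also have "\<dots> \<le> norm x * (C * norm (badj T x))" by (intro mult_left_mono C) simp
      finally show ?thesis using False by simp
    qed (use C in simp)
  qed
qed

lemma badj_badj:
  fixes T :: "'h::{real_inner,complete_space} \<Rightarrow> 'h"
  assumes "bounded_linear T"
  shows "badj (badj T) = T"
  by (rule badj_eqI) (simp_all add: bounded_linear_badj inner_badj_left assms)

text \<open>Cauchy-Schwarz in the form in which compactness later passes from \<open>badj T\<close>
  after \<open>T\<close> to \<open>T\<close>.\<close>

lemma norm_sq_le_inner:
  fixes T :: "'h::{real_inner,complete_space} \<Rightarrow> 'h"
  assumes "bounded_linear T"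
  shows "(norm (T x))\<^sup>2 \<le> norm (badj T (T x)) * norm x"
proof -
  have "(norm (T x))\<^sup>2 = inner (badj T (T x)) x"
    by (simp add: inner_badj_left assms power2_norm_eq_inner)
  then show ?thesis by (simp add: norm_cauchy_schwarz)
qed

text \<open>The adjoint enters as any function \<open>T'\<close> satisfying the pairing identity, so
  the bound can be used before \<open>T\<close> is known to be bounded.\<close>

lemma norm_le_if_badj_le:
  fixes T :: "'h::{real_inner,complete_space} \<Rightarrow> 'h"
  assumes "\<And>x y. inner (T x) y = inner x (T' y)" "\<And>y. norm (T' y) \<le> C * norm y"
  shows "norm (T x) \<le> C * norm x"
proof (cases "norm (T x) = 0")
  case False
  have "norm (T x) * norm (T x) = inner x (T' (T x))"
    by (simp add: assms(1)[symmetric] norm_eq_sqrt_inner)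
  also have "\<dots> \<le> norm x * norm (T' (T x))" by (rule norm_cauchy_schwarz)
  also have "\<dots> \<le> norm x * (C * norm (T x))" by (intro mult_left_mono assms) simp
  finally show ?thesis using False by (simp add: mult.commute)
next
  case True
  have "0 \<le> C * norm x" using order_trans[OF norm_ge_zero assms(2)[of x]] .
  then show ?thesis using True by simp
qed

subsection \<open>Uniform boundedness\<close>

text \<open>A uniform boundedness principle for \<open>factor_through_S\<close>, where only pairings
  with \<open>range S\<close> are under control. The sets \<open>A n\<close> are closed by the weak
  bounds and cover the space by Cauchy-Schwarz, so by Baire one of them contains a ball; density of
  \<open>V\<close> turns the weak estimate into one for \<open>norm (X y)\<close>.\<close>

lemma bounded_linear_if_weakly_bounded:
  fixes X :: "'a::{real_normed_vector,complete_space} \<Rightarrow> 'h::real_inner"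
  assumes lin: "linear X" and dense: "closure V = UNIV"
    and weak: "\<And>v. v \<in> V \<Longrightarrow> bounded_linear (\<lambda>y. inner (X y) v)"
  shows "bounded_linear X"
proof -
  define A where "A n = {y. \<forall>v\<in>V. \<bar>inner (X y) v\<bar> \<le> real n * norm v}" for n :: nat
  have Abound: "norm (X y) \<le> real n" if "y \<in> A n" for y n
  proof -
    have "closed {v. \<bar>inner (X y) v\<bar> \<le> real n * norm v}"
      by (intro closed_Collect_le continuous_intros)
    then have "closure V \<subseteq> {v. \<bar>inner (X y) v\<bar> \<le> real n * norm v}"
      using that by (intro closure_minimal) (auto simp: A_def)
    then have "X y \<in> {v. \<bar>inner (X y) v\<bar> \<le> real n * norm v}" using dense by blast
    then have "inner (X y) (X y) \<le> real n * norm (X y)" by simp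
    then have "norm (X y) * norm (X y) \<le> real n * norm (X y)" by (simp add: norm_eq_sqrt_inner)
    then show ?thesis by (cases "norm (X y) = 0") auto
  qed
  have Aclosed: "closed (A n)" for n
  proof -
    have "A n = (\<Inter>v\<in>V. {y. \<bar>inner (X y) v\<bar> \<le> real n * norm v})" by (auto simp: A_def)
    moreover have "closed {y. \<bar>inner (X y) v\<bar> \<le> real n * norm v}" if "v \<in> V" for v
      by (intro closed_Collect_le continuous_intros
          linear_continuous_on[OF weak[OF that]])
    ultimately show ?thesis by auto
  qed
  have "\<exists>n. interior (A n) \<noteq> {}"
  proof (rule ccontr)
    assume "\<not> ?thesis"
    then have int: "interior (A n) = {}" for n by blast
    have "euclidean interior_of (\<Union>(range A)) = {}"
    proof (rule Baire_category_alt[where \<G> = "range A"])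
      show "completely_metrizable_space (euclidean :: 'a topology) \<or>
          locally_compact_space (euclidean :: 'a topology) \<and> regular_space (euclidean :: 'a topology)"
        using completely_metrizable_space_euclidean by blast
      show "closedin euclidean T \<and> euclidean interior_of T = {}" if "T \<in> range A" for T
        using that Aclosed int by auto
    qed simp
    moreover have "\<Union>(range A) = UNIV"
    proof -
      have "\<exists>n. y \<in> A n" for y
      proof -
        obtain n where n: "norm (X y) \<le> real n" using real_arch_simple by blast
        have "\<bar>inner (X y) v\<bar> \<le> real n * norm v" for v
          using Cauchy_Schwarz_ineq2[of "X y" v] mult_right_mono[OF n, of "norm v"] by simp
        then show ?thesis unfolding A_def by blast
      qed
      then show ?thesis by blast
    qed
    ultimately show False by simp
  qed
  then obtain n y0 where "y0 \<in> interior (A n)" by blast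
  then obtain e where e: "e > 0" "cball y0 e \<subseteq> A n"
    by (metis mem_interior_cball)
  interpret X: linear X by fact
  have "norm (X y) \<le> norm y * (2 * real n / e)" for y
  proof (cases "y = 0")
    case False
    define t where "t = e / norm y"
    have t: "t > 0" using False e by (simp add: t_def)
    have "y0 + t *\<^sub>R y \<in> cball y0 e" using False e by (simp add: dist_norm t_def)
    moreover have "y0 \<in> cball y0 e" using e by simp
    ultimately have "norm (X (y0 + t *\<^sub>R y)) \<le> real n" "norm (X y0) \<le> real n"
      using e(2) Abound by blast+
    then have "norm (X (y0 + t *\<^sub>R y) - X y0) \<le> 2 * real n" 
      using norm_triangle_ineq4[of "X (y0 + t *\<^sub>R y)" "X y0"] by linarith
    then have "t * norm (X y) \<le> 2 * real n" using t by (simp add: X.add X.scale)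
    then show ?thesis using t False e by (simp add: t_def field_simps)
  qed (simp add: X.zero)
  then show ?thesis by (intro bounded_linear_intro[of X "2 * real n / e"]) (simp_all add: X.add X.scale)
qed

subsection \<open>Compact operators\<close>

lemma compact_opI:
  assumes "linear T" "compact K" "T ` cball 0 1 \<subseteq> K"
  shows "compact_op T"
proof -
  have "closure (T ` cball 0 1) \<subseteq> K"
    using assms(2,3) by (intro closure_minimal compact_imp_closed)
  then have "compact (closure (T ` cball 0 1))"
    using compact_Int_closed[OF assms(2) closed_closure[of "T ` cball 0 1"]] by (simp add: inf.absorb2)
  then show ?thesis using assms(1) by (simp add: compact_op_def)
qed

lemma compact_op_finite_net:
  assumes "compact_op T" "e > 0"
  obtains k where "finite k" "k \<subseteq> cball 0 1"
    "\<And>x. x \<in> cball 0 1 \<Longrightarrow> \<exists>y\<in>k. norm (T x - T y) < e"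
proof -
  have cp: "compact (closure (T ` cball 0 1))" using assms by (simp add: compact_op_def)
  have "closure (T ` cball 0 1) \<subseteq> (\<Union>y\<in>cball 0 1. ball (T y) e)"
  proof
    fix z assume "z \<in> closure (T ` cball 0 1)"
    then obtain w where "w \<in> T ` cball 0 1" "dist w z < e"
      using assms(2) closure_approachable by blast
    then show "z \<in> (\<Union>y\<in>cball 0 1. ball (T y) e)" by auto
  qed
  then obtain k where k: "k \<subseteq> cball 0 1" "finite k"
      "closure (T ` cball 0 1) \<subseteq> (\<Union>y\<in>k. ball (T y) e)"
    using compactE_image[OF cp, of "cball 0 1" "\<lambda>y. ball (T y) e"] by auto
  have "\<exists>y\<in>k. norm (T x - T y) < e" if "x \<in> cball 0 1" for x
  proof -
    have "T x \<in> closure (T ` cball 0 1)" using that closure_subset[of "T ` cball 0 1"] by blast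
    then have "T x \<in> (\<Union>y\<in>k. ball (T y) e)" using k(3) by (rule rev_subsetD)
    then obtain y where "y \<in> k" "dist (T y) (T x) < e" unfolding UN_iff mem_ball by blast
    then show ?thesis by (auto simp: dist_norm norm_minus_commute)
  qed
  then show thesis using k that by blast
qed

lemma compact_op_if_finite_nets:
  fixes T :: "'h::{real_normed_vector,complete_space} \<Rightarrow> 'h"
  assumes "linear T"
    and nets: "\<And>e. e > 0 \<Longrightarrow> \<exists>k. finite k \<and> (\<forall>x\<in>cball 0 1. \<exists>y\<in>k. norm (T x - T y) < e)"
  shows "compact_op T"
proof -
  have "\<exists>k. finite k \<and> closure (T ` cball 0 1) \<subseteq> (\<Union>x\<in>k. ball x e)" if e: "e > 0" for e
  proof -
    obtain k where k: "finite k" "\<forall>x\<in>cball 0 1. \<exists>y\<in>k. norm (T x - T y) < e/2"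
      using nets[OF half_gt_zero[OF e]] by blast
    \<comment> \<open>Closed balls of half the radius are used because their finite union is closed
      and hence contains the closure of the image as well.\<close>
    have "T ` cball 0 1 \<subseteq> (\<Union>y\<in>T ` k. cball y (e/2))"
    proof
      fix z assume "z \<in> T ` cball 0 1"
      then obtain x where "x \<in> cball 0 1" "z = T x" by blast
      then obtain y where "y \<in> k" "norm (z - T y) < e/2" using bspec[OF k(2)] by blast
      then show "z \<in> (\<Union>y\<in>T ` k. cball y (e/2))"
        by (auto simp: dist_norm norm_minus_commute intro!: bexI[of _ y])
    qed
    moreover have "closed (\<Union>y\<in>T ` k. cball y (e/2))" using k(1) by (intro closed_UN) auto
    ultimately have "closure (T ` cball 0 1) \<subseteq> (\<Union>y\<in>T ` k. cball y (e/2))"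
      by (rule closure_minimal)
    also have "\<dots> \<subseteq> (\<Union>y\<in>T ` k. ball y e)" using e by (intro UN_mono) auto
    finally show ?thesis using k(1) by blast
  qed
  moreover have "complete (closure (T ` cball 0 1))" by (simp add: complete_eq_closed)
  ultimately show ?thesis using assms(1) by (simp add: compact_op_def compact_eq_totally_bounded)
qed

lemma compact_op_linear: "compact_op T \<Longrightarrow> linear T"
  by (simp add: compact_op_def)

lemma compact_op_bounded_linear:
  assumes "compact_op T"
  shows "bounded_linear T"
proof -
  interpret T: linear T using assms by (rule compact_op_linear)
  have "bounded (T ` cball 0 1)"
    using assms bounded_subset[OF compact_imp_bounded closure_subset] unfolding compact_op_def by blast
  then obtain C where C: "\<And>x. norm x \<le> 1 \<Longrightarrow> norm (T x) \<le> C"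
    unfolding bounded_iff by (metis imageI mem_cball_0)
  have "norm (T x) \<le> norm x * C" for x
  proof (cases "x = 0")
    case False
    have "norm (T ((1 / norm x) *\<^sub>R x)) \<le> C" using False by (intro C) simp
    then show ?thesis using False by (simp add: T.scale field_simps)
  qed (simp add: T.zero)
  then show ?thesis by (intro bounded_linear_intro[of T]) (auto simp: T.add T.scale)
qed

lemma compact_op_add:
  assumes "compact_op T" "compact_op U"
  shows "compact_op (\<lambda>x. T x + U x)"
proof (rule compact_opI)
  show "linear (\<lambda>x. T x + U x)" using assms by (intro linear_compose_add compact_op_linear)
  show "compact {x + y |x y. x \<in> closure (T ` cball 0 1) \<and> y \<in> closure (U ` cball 0 1)}"
    using assms by (intro compact_sums) (auto simp: compact_op_def)
  show "(\<lambda>x. T x + U x) ` cball 0 1 \<subseteq> {x + y |x y. x \<in> closure (T ` cball 0 1) \<and> y \<in> closure (U ` cball 0 1)}"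
    using closure_subset[of "T ` cball 0 1"] closure_subset[of "U ` cball 0 1"] by blast
qed

lemma compact_op_compose_left:
  assumes "compact_op T" "bounded_linear B"
  shows "compact_op (\<lambda>x. B (T x))"
proof (rule compact_opI)
  show "linear (\<lambda>x. B (T x))"
    using linear_compose[OF compact_op_linear[OF assms(1)] bounded_linear.linear[OF assms(2)]]
    by (simp add: o_def)
  show "compact (B ` closure (T ` cball 0 1))"
    using assms by (intro compact_continuous_image linear_continuous_on) (auto simp: compact_op_def)
  show "(\<lambda>x. B (T x)) ` cball 0 1 \<subseteq> B ` closure (T ` cball 0 1)"
    using closure_subset[of "T ` cball 0 1"] by blast
qed

lemma compact_op_compose_right:
  assumes "compact_op T" "bounded_linear B"
  shows "compact_op (\<lambda>x. T (B x))"
proof -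
  obtain C where C: "C > 0" "\<And>x. norm (B x) \<le> C * norm x"
    using bounded_linear_bound[OF assms(2)] by blast
  interpret T: linear T using assms by (intro compact_op_linear)
  show ?thesis
  proof (rule compact_opI)
    show "linear (\<lambda>x. T (B x))"
      using linear_compose[OF bounded_linear.linear[OF assms(2)] compact_op_linear[OF assms(1)]]
      by (simp add: o_def)
    show "compact ((\<lambda>x. C *\<^sub>R x) ` closure (T ` cball 0 1))"
      using assms by (intro compact_scaling) (auto simp: compact_op_def)
    show "(\<lambda>x. T (B x)) ` cball 0 1 \<subseteq> (\<lambda>x. C *\<^sub>R x) ` closure (T ` cball 0 1)"
    proof
      fix z assume "z \<in> (\<lambda>x. T (B x)) ` cball 0 1"
      then obtain x where x: "norm x \<le> 1" "z = T (B x)" by auto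
      have "norm (B x) \<le> C" using order_trans[OF C(2)[of x] mult_left_mono[OF x(1), of C]] C(1) by simp
      then have "(1 / C) *\<^sub>R B x \<in> cball 0 1" using C(1) by simp
      then have "T ((1 / C) *\<^sub>R B x) \<in> closure (T ` cball 0 1)"
        using closure_subset[of "T ` cball 0 1"] by blast
      moreover have "z = C *\<^sub>R T ((1 / C) *\<^sub>R B x)" using x C(1) by (simp add: T.scale)
      ultimately show "z \<in> (\<lambda>x. C *\<^sub>R x) ` closure (T ` cball 0 1)" by blast
    qed
  qed
qed

lemma compact_op_scaleR:
  assumes "compact_op T"
  shows "compact_op (\<lambda>x. c *\<^sub>R T x)"
  using compact_op_compose_left[OF assms bounded_linear_scaleR_right] .

lemma compact_op_diff:
  assumes "compact_op T" "compact_op U"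
  shows "compact_op (\<lambda>x. T x - U x)"
  using compact_op_add[OF assms(1) compact_op_scaleR[OF assms(2), of "-1"]] by simp

lemma compact_op_zero: "compact_op (\<lambda>x. 0)"
  by (rule compact_opI[where K = "{0}"]) (auto simp: linear_iff)

lemma compact_op_sum:
  assumes "\<And>i. i \<in> I \<Longrightarrow> compact_op (T i)"
  shows "compact_op (\<lambda>x. \<Sum>i\<in>I. T i x)"
  using assms by (induction I rule: infinite_finite_induct)
    (auto intro: compact_op_zero compact_op_add)

text \<open>On the unit ball differences have norm at most 2, so a finite net for \<open>B\<close>
  of mesh \<open>e\<^sup>2 / 2\<close> is one for \<open>A\<close> of mesh \<open>e\<close>.\<close>

lemma compact_op_dominated:
  fixes A B :: "'h::{real_normed_vector,complete_space} \<Rightarrow> 'h"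
  assumes "compact_op B" "linear A" "\<And>x. (norm (A x))\<^sup>2 \<le> norm (B x) * norm x"
  shows "compact_op A"
proof (rule compact_op_if_finite_nets)
  interpret A: linear A by fact
  interpret B: linear B using assms by (intro compact_op_linear)
  fix e :: real assume e: "e > 0"
  then obtain k where k: "finite k" "k \<subseteq> cball 0 1"
      "\<And>x. x \<in> cball 0 1 \<Longrightarrow> \<exists>y\<in>k. norm (B x - B y) < e\<^sup>2 / 2"
    using compact_op_finite_net[OF assms(1), of "e\<^sup>2 / 2"] by auto
  have "\<exists>y\<in>k. norm (A x - A y) < e" if x: "x \<in> cball 0 1" for x
  proof -
    obtain y where y: "y \<in> k" "norm (B x - B y) < e\<^sup>2 / 2" using k(3)[OF x] by blast
    have "norm (x - y) \<le> 2" using x y(1) k(2) norm_triangle_ineq4[of x y] by force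
    have "(norm (A x - A y))\<^sup>2 \<le> norm (B x - B y) * norm (x - y)"
      using assms(3)[of "x - y"] by (simp add: A.diff B.diff)
    also have "\<dots> \<le> norm (B x - B y) * 2" using \<open>norm (x - y) \<le> 2\<close> by (intro mult_left_mono) simp_all
    also have "\<dots> < e\<^sup>2" using y by simp
    finally have "norm (A x - A y) < e" using e by (simp add: power_less_imp_less_base)
    then show ?thesis using y(1) by blast
  qed
  then show "\<exists>k. finite k \<and> (\<forall>x\<in>cball 0 1. \<exists>y\<in>k. norm (A x - A y) < e)" using k(1) by blast
qed fact

lemma compact_op_limit:
  fixes A :: "'h::{real_normed_vector,complete_space} \<Rightarrow> 'h"
  assumes "linear A"
    and approx: "\<And>e. e > 0 \<Longrightarrow> \<exists>B. compact_op B \<and> (\<forall>x. norm (A x - B x) \<le> e * norm x)"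
  shows "compact_op A"
proof (rule compact_op_if_finite_nets)
  fix e :: real assume e: "e > 0"
  obtain B where B: "compact_op B" "\<And>x. norm (A x - B x) \<le> e/3 * norm x"
    using approx[of "e/3"] e by auto
  obtain k where k: "finite k" "k \<subseteq> cball 0 1"
      "\<And>x. x \<in> cball 0 1 \<Longrightarrow> \<exists>y\<in>k. norm (B x - B y) < e/3"
    using compact_op_finite_net[OF B(1), of "e/3"] e by auto
  have near: "norm (A x - B x) \<le> e/3" if "x \<in> cball 0 1" for x
  proof -
    have "e/3 * norm x \<le> e/3 * 1" using that e by (intro mult_left_mono) auto
    then show ?thesis using B(2)[of x] by simp
  qed
  have "\<exists>y\<in>k. norm (A x - A y) < e" if x: "x \<in> cball 0 1" for x
  proof -
    obtain y where y: "y \<in> k" "norm (B x - B y) < e/3" using k(3)[OF x] by blast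
    have "norm (A x - B x) \<le> e/3" "norm (A y - B y) \<le> e/3" using near x y k(2) by blast+
    moreover have "norm (A x - A y) \<le> norm (A x - B x) + norm (B x - B y) + norm (A y - B y)"
      using norm_triangle_ineq[of "A x - B x" "B x - B y"]
        norm_triangle_ineq4[of "(A x - B x) + (B x - B y)" "A y - B y"] by simp
    ultimately show ?thesis using y by (intro bexI[of _ y]) auto
  qed
  then show "\<exists>k. finite k \<and> (\<forall>x\<in>cball 0 1. \<exists>y\<in>k. norm (A x - A y) < e)" using k(1) by blast
qed fact

text \<open>Takes the place of the polar decomposition: \<open>T\<close> is dominated by
  \<open>badj T\<close> after \<open>T\<close> in the sense of
  \<open>compact_op_dominated\<close>.\<close>

lemma compact_op_square_root:
  fixes T :: "'h::{real_inner,complete_space} \<Rightarrow> 'h"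
  assumes "bounded_linear T" "compact_op (\<lambda>x. badj T (T x))"
  shows "compact_op T"
  using assms(2) bounded_linear.linear[OF assms(1)] norm_sq_le_inner[OF assms(1)]
  by (rule compact_op_dominated)

text \<open>Schauder's theorem. The square root criterion is applied to the adjoint, for which the
  product in question is \<open>T\<close> after \<open>badj T\<close>.\<close>

lemma compact_op_badj:
  fixes T :: "'h::{real_inner,complete_space} \<Rightarrow> 'h"
  assumes "compact_op T"
  shows "compact_op (badj T)"
proof (rule compact_op_square_root)
  have T: "bounded_linear T" by (rule compact_op_bounded_linear[OF assms])
  then show "bounded_linear (badj T)" by (rule bounded_linear_badj)
  then show "compact_op (\<lambda>x. badj (badj T) (badj T x))"
    by (simp add: badj_badj[OF T] compact_op_compose_right[OF assms])
qed

subsection \<open>Continuous functional calculus of a positive contraction\<close>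

text \<open>Only the form inequalities 0 <= R <= 1 are required; boundedness of \<open>R\<close>
  follows from them (\<open>norm_R_le\<close>). The unit interval takes the place of the spectrum,
  and the functional calculus rests on the positivity of polynomials in \<open>R\<close>
  alone.\<close>

locale pos_contraction =
  fixes R :: "'h::{real_inner,complete_space} \<Rightarrow> 'h"
  assumes lin: "linear R"
    and sym: "inner (R x) y = inner x (R y)"
    and pos: "0 \<le> inner (R x) x"
    and contr: "inner (R x) x \<le> inner x x"
begin

sublocale R: linear R by (rule lin)

text \<open>Horner's scheme for the polynomial \<open>p\<close> in the operator \<open>R\<close>,
  applied to \<open>x\<close>.\<close>

definition pev :: "real poly \<Rightarrow> 'h \<Rightarrow> 'h" where
  "pev p x = fold_coeffs (\<lambda>a y. a *\<^sub>R x + R y) p 0"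

lemma pev_0 [simp]: "pev 0 x = 0"
  by (simp add: pev_def)

lemma pev_pCons [simp]: "pev (pCons a p) x = a *\<^sub>R x + R (pev p x)"
proof -
  consider "a \<noteq> 0" | "p \<noteq> 0" | "a = 0" "p = 0" by blast
  then show ?thesis
    by cases (simp_all add: pev_def fold_coeffs_pCons_coeff_not_0_eq fold_coeffs_pCons_not_0_0_eq R.zero)
qed

lemma pev_add: "pev (p + q) x = pev p x + pev q x"
  by (induction p q rule: poly_induct2) (auto simp: R.add algebra_simps)

lemma pev_smult: "pev (smult c p) x = c *\<^sub>R pev p x"
  by (induction p) (auto simp: R.scale algebra_simps)

lemma pev_diff: "pev (p - q) x = pev p x - pev q x"
  using pev_add[of p "smult (-1) q"] pev_smult[of "-1" q] by simp

lemma pev_sum: "pev (\<Sum>i\<in>I. f i) x = (\<Sum>i\<in>I. pev (f i) x)"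
  by (induction I rule: infinite_finite_induct) (auto simp: pev_add)

lemma pev_mult: "pev (p * q) x = pev p (pev q x)"
  by (induction p) (auto simp: pev_add pev_smult)

lemma pev_linear: "linear (pev p)"
proof (induction p)
  case 0
  then show ?case by (simp add: linear_iff)
next
  case (pCons a p)
  interpret P: linear "pev p" by fact
  show ?case by (rule linearI) (simp_all add: P.add P.scale R.add R.scale algebra_simps)
qed

lemma pev_1 [simp]: "pev 1 x = x"
  by (simp add: one_pCons R.zero)

lemma pev_commute:
  assumes "linear T" "\<And>x. T (R x) = R (T x)"
  shows "T (pev p x) = pev p (T x)"
proof (induction p)
  case 0
  then show ?case using assms(1) by (simp add: linear_0)
next
  case (pCons a p)
  then show ?case using assms by (simp add: linear_add linear_scale)
qed

lemma pev_sym: "inner (pev p x) y = inner x (pev p y)"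
proof (induction p arbitrary: y)
  case (pCons a p)
  have "R (pev p y) = pev p (R y)" by (rule pev_commute) (simp_all add: lin)
  then show ?case using pCons by (simp add: inner_add_left inner_add_right sym)
qed simp

definition pos_poly :: "real poly \<Rightarrow> bool" where
  "pos_poly p \<longleftrightarrow> (\<forall>x. 0 \<le> inner (pev p x) x)"

lemma pos_poly_add: "pos_poly p \<Longrightarrow> pos_poly q \<Longrightarrow> pos_poly (p + q)"
  by (simp add: pos_poly_def pev_add inner_add_left)

lemma pos_poly_smult: "c \<ge> 0 \<Longrightarrow> pos_poly p \<Longrightarrow> pos_poly (smult c p)"
  by (simp add: pos_poly_def pev_smult)

lemma pos_poly_sq_mult:
  assumes "pos_poly p"
  shows "pos_poly (q * q * p)"
proof -
  have "inner (pev (q * q * p) x) x = inner (pev p (pev q x)) (pev q x)" for x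
  proof -
    have "q * q * p = q * (p * q)" by (simp only: ac_simps)
    then have "pev (q * q * p) x = pev q (pev p (pev q x))" by (simp only: pev_mult)
    then show ?thesis by (simp add: pev_sym)
  qed
  then show ?thesis using assms by (simp add: pos_poly_def)
qed

text \<open>Pulling out the square of \<open>q\<close> leaves exponents 0 or 1. The one case that is
  not a hypothesis on \<open>R\<close> is the product X Y with Y = 1 - X, and there X + Y = 1 gives
  X Y = X^2 Y + Y^2 X.\<close>

lemma pos_poly_bernstein: "pos_poly ([:0, 1:] ^ a * [:1, -1:] ^ b)"
proof -
  let ?X = "[:0, 1:] :: real poly" and ?Y = "[:1, -1:] :: real poly"
  have 1: "pos_poly 1" and X: "pos_poly ?X" and Y: "pos_poly ?Y"
    using pos contr by (auto simp: pos_poly_def R.zero R.neg inner_diff_left)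
  have "?X * ?Y = ?X * ?X * ?Y + ?Y * ?Y * ?X" by simp
  then have XY: "pos_poly (?X * ?Y)"
    using pos_poly_add[OF pos_poly_sq_mult[OF Y] pos_poly_sq_mult[OF X]] by metis
  define q where "q = ?X ^ (a div 2) * ?Y ^ (b div 2)"
  have split: "p ^ n = p ^ (n div 2) * p ^ (n div 2) * p ^ (n mod 2)" for p :: "real poly" and n
  proof -
    have "n = n div 2 + n div 2 + n mod 2" by presburger
    then show ?thesis by (metis power_add)
  qed
  have "?X ^ a * ?Y ^ b = q * q * (?X ^ (a mod 2) * ?Y ^ (b mod 2))"
    unfolding q_def split[of ?X a] split[of ?Y b] by (simp only: ac_simps)
  moreover have "pos_poly (?X ^ (a mod 2) * ?Y ^ (b mod 2))"
    using 1 X Y XY by (cases "even a"; cases "even b") (simp_all add: even_iff_mod_2_eq_zero odd_iff_mod_2_eq_one)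
  ultimately show ?thesis using pos_poly_sq_mult by metis
qed

end

section \<open>Bernstein coefficients of a polynomial\<close>

lemma smult_sum_right: "smult c (\<Sum>i\<in>I. f i) = (\<Sum>i\<in>I. smult c (f i))"
  by (induction I rule: infinite_finite_induct) (simp_all add: smult_add_right)

definition bernstein_poly :: "nat \<Rightarrow> nat \<Rightarrow> real poly" where
  "bernstein_poly n k = smult (real (n choose k)) ([:0, 1:] ^ k * [:1, -1:] ^ (n - k))"

text \<open>Multiply X^j by (X + Y)^(n - j) = 1 with Y = 1 - X and expand;
  \<open>choose_mult\<close> rewrites the resulting coefficients as ratios.\<close>

lemma power_eq_bernstein_sum:
  assumes "j \<le> n"
  shows "[:0, 1:] ^ j = (\<Sum>k\<le>n. smult (real (k choose j) / real (n choose j)) (bernstein_poly n k))"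
proof -
  let ?X = "[:0, 1:] :: real poly" and ?Y = "[:1, -1:] :: real poly"
  have nz: "real (n choose j) \<noteq> 0" using assms by simp
  have "?X + ?Y = 1" by (simp add: one_pCons)
  then have "?X ^ j = ?X ^ j * (?X + ?Y) ^ (n - j)" by (simp only: power_one mult_1_right)
  also have "\<dots> = (\<Sum>i\<le>n-j. ?X ^ j * (of_nat (n - j choose i) * ?X ^ i * ?Y ^ (n - j - i)))"
    unfolding binomial_ring sum_distrib_left ..
  also have "\<dots> = (\<Sum>i\<le>n-j. smult (real (n - j choose i)) (?X ^ (i + j) * ?Y ^ (n - (i + j))))"
    by (intro sum.cong refl) (simp add: of_nat_mult_conv_smult power_add ac_simps)
  also have "\<dots> = (\<Sum>k\<in>{j..n}. smult (real (n - j choose (k - j))) (?X ^ k * ?Y ^ (n - k)))"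
    by (rule sum.reindex_bij_witness[where i = "\<lambda>k. k - j" and j = "\<lambda>i. i + j"]) (use assms in auto)
  also have "\<dots> = (\<Sum>k\<in>{j..n}. smult (real (k choose j) / real (n choose j)) (bernstein_poly n k))"
  proof (intro sum.cong refl)
    fix k assume k: "k \<in> {j..n}"
    have "real (n choose k) * real (k choose j) = real (n choose j) * real (n - j choose (k - j))"
      using choose_mult[of j k n] k by (metis atLeastAtMost_iff of_nat_mult)
    then have "real (n - j choose (k - j)) = real (k choose j) / real (n choose j) * real (n choose k)"
      using nz by (simp add: field_simps)
    then show "smult (real (n - j choose (k - j))) (?X ^ k * ?Y ^ (n - k)) =
        smult (real (k choose j) / real (n choose j)) (bernstein_poly n k)"
      by (simp add: bernstein_poly_def)
  qed
  \<comment> \<open>The added terms have \<open>k < j\<close>, where \<open>k choose j\<close> is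
    0.\<close>
  also have "\<dots> = (\<Sum>k\<le>n. smult (real (k choose j) / real (n choose j)) (bernstein_poly n k))"
    by (rule sum.mono_neutral_left) (auto simp: binomial_eq_0)
  finally show ?thesis .
qed

text \<open>The ratio is a product of \<open>j\<close> factors \<open>f i\<close>, each within i /
  (n - i) of k / n. All factors involved have modulus at most 1, so the products differ by at most
  the sum of the differences.\<close>

lemma binomial_ratio_close_power:
  assumes "j \<le> d" "2 * d < n" "k \<le> n"
  shows "\<bar>real (k choose j) / real (n choose j) - (real k / real n) ^ j\<bar> \<le> real d * real d / real (n - d)"
proof -
  define f where "f i = (real k - real i) / (real n - real i)" for i :: nat
  have binom: "real (m choose j) = (\<Prod>i = 0..<j. real m - real i) / fact j" for m
    by (simp add: binomial_gbinomial gbinomial_prod_rev)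
  have "real (k choose j) / real (n choose j) = (\<Prod>i = 0..<j. f i)"
    by (simp add: binom f_def prod_dividef)
  moreover have "(real k / real n) ^ j = (\<Prod>i = 0..<j. real k / real n)" by simp
  ultimately have "\<bar>real (k choose j) / real (n choose j) - (real k / real n) ^ j\<bar>
      = norm ((\<Prod>i = 0..<j. f i) - (\<Prod>i = 0..<j. real k / real n))" by simp
  also have "\<dots> \<le> (\<Sum>i = 0..<j. norm (f i - real k / real n))"
  proof (rule norm_prod_diff)
    fix i assume i: "i \<in> {0..<j}"
    then have "real i < real d" using assms by simp
    moreover have "2 * real d < real n" "real k \<le> real n" using assms by simp_all
    \<comment> \<open>If \<open>k < i\<close> the left side is below \<open>d\<close> and
      \<open>2 * d < n\<close> leaves room for it; otherwise \<open>k \<le> n\<close>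
      suffices.\<close>
    ultimately have "\<bar>real k - real i\<bar> \<le> real n - real i" by linarith
    then show "norm (f i) \<le> 1" using \<open>real i < real d\<close> \<open>2 * real d < real n\<close>
      by (simp add: f_def divide_le_eq)
    show "norm (real k / real n) \<le> 1" using assms by simp
  qed
  also have "\<dots> \<le> (\<Sum>i = 0..<j. real d / real (n - d))"
  proof (rule sum_mono)
    fix i assume "i \<in> {0..<j}"
    then have i: "real i < real d" and n: "2 * real d < real n" and k: "real k \<le> real n"
      and nd: "real (n - d) = real n - real d" using assms by (auto simp: of_nat_diff)
    have "f i - real k / real n = - (real i * (real n - real k) / ((real n - real i) * real n))"
      using i n by (simp add: f_def field_simps)
    then have "norm (f i - real k / real n) = real i * (real n - real k) / ((real n - real i) * real n)"
      using i n k by simp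
    also have "\<dots> = real i / (real n - real i) * ((real n - real k) / real n)" by simp
    also have "\<dots> \<le> real i / (real n - real i) * 1"
      using i n k by (intro mult_left_mono) (simp_all add: divide_le_eq)
    also have "\<dots> \<le> real d / real (n - d)" unfolding nd mult_1_right
      using i n by (intro frac_le) simp_all
    finally show "norm (f i - real k / real n) \<le> real d / real (n - d)" .
  qed
  also have "\<dots> = real j * (real d / real (n - d))" by simp
  also have "\<dots> \<le> real d * (real d / real (n - d))"
    using assms by (intro mult_right_mono) simp_all
  finally show ?thesis by simp
qed

context pos_contraction
begin

text \<open>By \<open>power_eq_bernstein_sum\<close> the polynomial is a combination of Bernstein
  polynomials whose coefficients are nearly its values at \<open>k / n\<close>.\<close>
lemma pos_poly_if_nonneg_approx:
  fixes p :: "real poly" and n :: nat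
  defines "d \<equiv> degree p"
  defines "eta \<equiv> (\<Sum>j\<le>d. \<bar>coeff p j\<bar>) * (real d * real d / real (n - d))"
  assumes nonneg: "\<And>r. 0 \<le> r \<Longrightarrow> r \<le> 1 \<Longrightarrow> 0 \<le> poly p r" and n: "2 * d < n"
  shows "- eta * inner x x \<le> inner (pev p x) x"
proof -
  let ?X = "[:0, 1:] :: real poly"
  define c where "c k = (\<Sum>j\<le>d. coeff p j * (real (k choose j) / real (n choose j)))" for k
  have "p = (\<Sum>j\<le>d. smult (coeff p j) (?X ^ j))"
    using poly_as_sum_of_monoms[of p] by (simp add: d_def monom_altdef)
  also have "\<dots> = (\<Sum>j\<le>d. \<Sum>k\<le>n. smult (coeff p j * (real (k choose j) / real (n choose j))) (bernstein_poly n k))"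
  proof (intro sum.cong refl)
    fix j assume "j \<in> {..d}"
    then have "j \<le> n" using n by simp
    show "smult (coeff p j) (?X ^ j) =
        (\<Sum>k\<le>n. smult (coeff p j * (real (k choose j) / real (n choose j))) (bernstein_poly n k))"
      unfolding power_eq_bernstein_sum[OF \<open>j \<le> n\<close>] smult_sum_right by simp
  qed
  also have "\<dots> = (\<Sum>k\<le>n. smult (c k) (bernstein_poly n k))"
    unfolding c_def smult_sum by (rule sum.swap)
  finally have p_eq: "p = (\<Sum>k\<le>n. smult (c k) (bernstein_poly n k))" .
  have c_ge: "- eta \<le> c k" if "k \<le> n" for k
  proof -
    have "poly p (real k / real n) = (\<Sum>j\<le>d. coeff p j * (real k / real n) ^ j)"
      by (simp add: poly_altdef d_def)
    then have "\<bar>c k - poly p (real k / real n)\<bar> =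
        \<bar>\<Sum>j\<le>d. coeff p j * (real (k choose j) / real (n choose j) - (real k / real n) ^ j)\<bar>"
      by (simp add: c_def sum_subtractf[symmetric] right_diff_distrib)
    also have "\<dots> \<le> (\<Sum>j\<le>d. \<bar>coeff p j\<bar> * \<bar>real (k choose j) / real (n choose j) - (real k / real n) ^ j\<bar>)"
      by (rule order_trans[OF sum_abs]) (simp add: abs_mult)
    also have "\<dots> \<le> (\<Sum>j\<le>d. \<bar>coeff p j\<bar> * (real d * real d / real (n - d)))"
      by (intro sum_mono mult_left_mono binomial_ratio_close_power) (use n that in auto)
    also have "\<dots> = eta" unfolding eta_def sum_distrib_right ..
    finally have "\<bar>c k - poly p (real k / real n)\<bar> \<le> eta" .
    moreover have "0 \<le> poly p (real k / real n)" by (rule nonneg) (use that n in simp_all)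
    ultimately show ?thesis by linarith
  qed
  have bpos: "0 \<le> inner (pev (bernstein_poly n k) x) x" for k
    using pos_poly_smult[OF _ pos_poly_bernstein, of "real (n choose k)" k "n - k"]
    by (simp add: bernstein_poly_def pos_poly_def)
  \<comment> \<open>The case \<open>j = 0\<close>: the Bernstein polynomials sum to 1, so the error
    term can be distributed over them and compared coefficient by coefficient.\<close>
  have "1 = (\<Sum>k\<le>n. bernstein_poly n k)" using power_eq_bernstein_sum[of 0 n] by simp
  then have "(\<Sum>k\<le>n. pev (bernstein_poly n k) x) = x" by (metis pev_sum pev_1)
  then have "- eta * inner x x = - eta * inner (\<Sum>k\<le>n. pev (bernstein_poly n k) x) x"
    by (simp only:)
  also have "\<dots> = (\<Sum>k\<le>n. - eta * inner (pev (bernstein_poly n k) x) x)"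
    unfolding inner_sum_left sum_distrib_left ..
  also have "\<dots> \<le> (\<Sum>k\<le>n. c k * inner (pev (bernstein_poly n k) x) x)"
    by (intro sum_mono mult_right_mono c_ge bpos) simp
  also have "\<dots> = inner (pev p x) x"
  proof -
    have "pev p x = (\<Sum>k\<le>n. c k *\<^sub>R pev (bernstein_poly n k) x)"
      using arg_cong[OF p_eq, of "\<lambda>q. pev q x"] by (simp only: pev_sum pev_smult)
    then show ?thesis by (simp add: inner_sum_left)
  qed
  finally show ?thesis .
qed

text \<open>The error of the approximate version tends to 0 as the Bernstein degree grows. This is
  the spectral mapping statement from which the whole calculus is derived.\<close>

lemma pos_poly_if_nonneg:
  assumes "\<And>r. 0 \<le> r \<Longrightarrow> r \<le> 1 \<Longrightarrow> 0 \<le> poly p r"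
  shows "0 \<le> inner (pev p x) x"
proof -
  define d where "d = degree p"
  define A where "A = (\<Sum>j\<le>d. \<bar>coeff p j\<bar>) * (real d * real d) * inner x x"
  have "(\<lambda>n. - A / real n) \<longlonglongrightarrow> 0" by (rule lim_const_over_n)
  \<comment> \<open>The Bernstein degree is \<open>m + d\<close>, so the denominator
    \<open>n - d\<close> of the error becomes \<open>m\<close>, and \<open>m \<ge> d + 1\<close>
    ensures \<open>2 * d < n\<close>.\<close>
  moreover have "- A / real m \<le> inner (pev p x) x" if "m \<ge> d + 1" for m
    using pos_poly_if_nonneg_approx[of p "m + d" x, OF assms] that
    by (simp add: A_def d_def mult.assoc)
  ultimately show ?thesis by (intro LIMSEQ_le_const2) blast+
qed

text \<open>Positivity is applied to M^2 - p^2. This estimate by the supremum on the unit interval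
  lets evaluation extend to continuous functions.\<close>

lemma norm_pev_le:
  assumes "\<And>r. 0 \<le> r \<Longrightarrow> r \<le> 1 \<Longrightarrow> \<bar>poly p r\<bar> \<le> M"
  shows "norm (pev p x) \<le> M * norm x"
proof -
  have M: "M \<ge> 0" using assms[of 0] by simp
  have "0 \<le> inner (pev ([:M\<^sup>2:] - p * p) x) x"
  proof (rule pos_poly_if_nonneg)
    fix r :: real assume "0 \<le> r" "r \<le> 1"
    then have "(poly p r)\<^sup>2 \<le> M\<^sup>2" using assms power_mono[of "\<bar>poly p r\<bar>" M 2] by simp
    then show "0 \<le> poly ([:M\<^sup>2:] - p * p) r" by (simp add: power2_eq_square)
  qed
  then have "(norm (pev p x))\<^sup>2 \<le> (M * norm x)\<^sup>2"
    by (simp add: pev_diff pev_mult R.zero inner_diff_left pev_sym power2_norm_eq_inner power_mult_distrib)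
  then show ?thesis using M by (intro power2_le_imp_le[of "norm (pev p x)"]) simp_all
qed

end

section \<open>Extension of the calculus from polynomials to continuous functions\<close>

definition poly_approx :: "(real \<Rightarrow> real) \<Rightarrow> real poly \<Rightarrow> real \<Rightarrow> bool" where
  "poly_approx f p e \<longleftrightarrow> (\<forall>r\<in>{0..1}. \<bar>poly p r - f r\<bar> \<le> e)"

lemma poly_approx_exists:
  assumes "continuous_on {0..1} f" "e > 0"
  shows "\<exists>p. poly_approx f p e"
proof -
  obtain g where g: "real_polynomial_function g" "\<And>r. r \<in> {0..1} \<Longrightarrow> \<bar>f r - g r\<bar> < e"
    using Stone_Weierstrass_real_polynomial_function[OF compact_Icc assms] by metis
  obtain a n where "g = (\<lambda>x. \<Sum>i\<le>n. a i * x ^ i)"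
    using g(1) unfolding real_polynomial_function_iff_sum by blast
  then have "poly (\<Sum>i\<le>n. monom (a i) i) r = g r" for r
    by (simp add: poly_sum poly_monom)
  then have "poly_approx f (\<Sum>i\<le>n. monom (a i) i) e"
    unfolding poly_approx_def using g(2) by (simp add: abs_minus_commute less_imp_le)
  then show ?thesis by blast
qed

lemma continuous_on_01_bounded:
  assumes "continuous_on {0..1} (f :: real \<Rightarrow> real)"
  shows "\<exists>M\<ge>0. \<forall>r\<in>{0..1}. \<bar>f r\<bar> \<le> M"
proof -
  have "bounded (f ` {0..1})"
    by (intro compact_imp_bounded compact_continuous_image assms compact_Icc)
  then obtain M where "\<And>y. y \<in> f ` {0..1} \<Longrightarrow> norm y \<le> M" unfolding bounded_iff by blast
  then have "\<bar>f r\<bar> \<le> \<bar>M\<bar>" if "r \<in> {0..1}" for r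
    using that by (metis abs_ge_self imageI order_trans real_norm_def)
  then show ?thesis by (intro exI[of _ "\<bar>M\<bar>"]) simp
qed

context pos_contraction
begin

text \<open>The approximating polynomials are arbitrary choices, made independently of
  \<open>x\<close>. By \<open>norm_pev_diff_le\<close> the sequence is Cauchy for continuous
  \<open>f\<close>, and its limit does not depend on the choices.\<close>

definition fc :: "(real \<Rightarrow> real) \<Rightarrow> 'h \<Rightarrow> 'h" where
  "fc f x = lim (\<lambda>n. pev (SOME p. poly_approx f p (1 / real (Suc n))) x)"

lemma norm_pev_diff_le:
  assumes "poly_approx f p e" "poly_approx f q d"
  shows "norm (pev p x - pev q x) \<le> (e + d) * norm x"
proof -
  have "norm (pev (p - q) x) \<le> (e + d) * norm x"
  proof (rule norm_pev_le)
    fix r :: real assume "0 \<le> r" "r \<le> 1"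
    then have "\<bar>poly p r - f r\<bar> \<le> e" "\<bar>poly q r - f r\<bar> \<le> d"
      using assms by (simp_all add: poly_approx_def)
    then show "\<bar>poly (p - q) r\<bar> \<le> e + d" by simp
  qed
  then show ?thesis by (simp add: pev_diff)
qed

lemma fc_approx:
  assumes cont: "continuous_on {0..1} f" and p: "poly_approx f p e"
  shows "norm (fc f x - pev p x) \<le> e * norm x"
proof -
  define P where "P n = (SOME p. poly_approx f p (1 / real (Suc n)))" for n
  have P: "poly_approx f (P n) (1 / real (Suc n))" for n
    unfolding P_def by (rule someI_ex) (rule poly_approx_exists[OF cont], simp)
  have lim0: "(\<lambda>n. 1 / real (Suc n)) \<longlonglongrightarrow> 0" by (rule LIMSEQ_Suc[OF lim_const_over_n])
  have "Cauchy (\<lambda>n. pev (P n) x)"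
  proof (rule metric_CauchyI)
    fix e :: real assume e: "e > 0"
    have "\<forall>\<^sub>F n in sequentially. 1 / real (Suc n) * norm x < e / 2"
      by (rule order_tendstoD(2)[OF tendsto_mult_left_zero[OF lim0]]) (use e in simp)
    then obtain N where N: "\<And>n. n \<ge> N \<Longrightarrow> 1 / real (Suc n) * norm x < e / 2"
      unfolding eventually_sequentially by blast
    have "dist (pev (P m) x) (pev (P n) x) < e" if "m \<ge> N" "n \<ge> N" for m n
    proof -
      have "dist (pev (P m) x) (pev (P n) x) \<le> (1 / real (Suc m) + 1 / real (Suc n)) * norm x"
        unfolding dist_norm using P P by (rule norm_pev_diff_le)
      then show ?thesis using N[OF that(1)] N[OF that(2)] by (simp only: distrib_right)
    qed
    then show "\<exists>N. \<forall>m\<ge>N. \<forall>n\<ge>N. dist (pev (P m) x) (pev (P n) x) < e" by blast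
  qed
  then have "(\<lambda>n. pev (P n) x) \<longlonglongrightarrow> fc f x"
    unfolding fc_def P_def by (simp add: Cauchy_convergent_iff convergent_LIMSEQ_iff)
  then have "(\<lambda>n. norm (pev (P n) x - pev p x)) \<longlonglongrightarrow> norm (fc f x - pev p x)"
    by (intro tendsto_norm tendsto_diff tendsto_const)
  moreover have "(\<lambda>n. (1 / real (Suc n) + e) * norm x) \<longlonglongrightarrow> (0 + e) * norm x"
    by (intro tendsto_mult tendsto_add lim0 tendsto_const)
  moreover have "\<exists>N. \<forall>n\<ge>N. norm (pev (P n) x - pev p x) \<le> (1 / real (Suc n) + e) * norm x"
    using norm_pev_diff_le[OF P p] by blast
  ultimately have "norm (fc f x - pev p x) \<le> (0 + e) * norm x" by (rule LIMSEQ_le)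
  then show ?thesis by simp
qed

text \<open>The working characterisation of \<open>fc f x\<close>. The constant \<open>c\<close> may
  depend on \<open>x\<close> but not on \<open>e\<close>; sums, products, linearity and commutation
  are all checked through it.\<close>

lemma fc_eqI:
  assumes cont: "continuous_on {0..1} f"
    and v: "\<And>e. e > 0 \<Longrightarrow> \<exists>p. poly_approx f p e \<and> norm (v - pev p x) \<le> e * c"
  shows "fc f x = v"
proof -
  have "norm (fc f x - v) \<le> 0"
  proof (rule field_le_epsilon)
    fix d :: real assume d: "d > 0"
    define e where "e = d / (norm x + \<bar>c\<bar> + 1)"
    have s: "norm x + \<bar>c\<bar> + 1 > 0" by (simp add: add_nonneg_pos)
    then have e: "e > 0" using d by (simp add: e_def)
    then obtain p where p: "poly_approx f p e" "norm (v - pev p x) \<le> e * c" using v by blast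
    have "norm (fc f x - v) \<le> norm (fc f x - pev p x) + norm (v - pev p x)"
      using norm_triangle_ineq4[of "fc f x - pev p x" "v - pev p x"] by simp
    also have "\<dots> \<le> e * norm x + e * c" using fc_approx[OF cont p(1), of x] p(2) by simp
    also have "\<dots> \<le> e * (norm x + \<bar>c\<bar> + 1)"
      using e by (simp add: distrib_left[symmetric])
    also have "\<dots> = d" using s by (simp add: e_def)
    finally show "norm (fc f x - v) \<le> 0 + d" by simp
  qed
  then show ?thesis by simp
qed

lemma fc_poly: "fc (poly p) x = pev p x"
  by (rule fc_eqI[where c = 0])
    (auto intro!: continuous_intros exI[of _ p] simp: poly_approx_def)

lemma fc_cong:
  assumes "\<And>r. 0 \<le> r \<Longrightarrow> r \<le> 1 \<Longrightarrow> f r = g r"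
  shows "fc f x = fc g x"
proof -
  have "poly_approx f = poly_approx g" unfolding poly_approx_def using assms by (intro ext) simp
  then show ?thesis by (simp add: fc_def)
qed

lemma fc_const: "fc (\<lambda>r. c) x = c *\<^sub>R x"
  using fc_poly[of "[:c:]" x] fc_cong[of "poly [:c:]" "\<lambda>r. c" x] by (simp add: R.zero)

lemma fc_ident: "fc (\<lambda>r. r) x = R x"
  using fc_poly[of "[:0, 1:]" x] fc_cong[of "poly [:0, 1:]" "\<lambda>r. r" x] by (simp add: R.zero)

lemma norm_fc_le:
  assumes cont: "continuous_on {0..1} f" and M: "\<And>r. 0 \<le> r \<Longrightarrow> r \<le> 1 \<Longrightarrow> \<bar>f r\<bar> \<le> M"
  shows "norm (fc f x) \<le> M * norm x"
proof (rule field_le_epsilon)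
  fix d :: real assume d: "d > 0"
  define s where "s = norm x + 1"
  define e where "e = d / (2 * s)"
  have s: "s > 0" by (simp add: s_def add_nonneg_pos)
  then have e: "e > 0" using d by (simp add: e_def)
  then obtain p where p: "poly_approx f p e" using poly_approx_exists[OF cont] by blast
  have "norm (pev p x) \<le> (M + e) * norm x"
  proof (rule norm_pev_le)
    fix r :: real assume r: "0 \<le> r" "r \<le> 1"
    then have "\<bar>poly p r - f r\<bar> \<le> e" using p by (simp add: poly_approx_def)
    then show "\<bar>poly p r\<bar> \<le> M + e" using M[OF r] by linarith
  qed
  then have "norm (fc f x) \<le> e * norm x + (M + e) * norm x"
    using fc_approx[OF cont p, of x] norm_triangle_sub[of "fc f x" "pev p x"] by linarith
  also have "\<dots> \<le> M * norm x + 2 * e * s" using e by (simp add: s_def algebra_simps)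
  also have "2 * e * s = d" using s by (simp add: e_def)
  finally show "norm (fc f x) \<le> M * norm x + d" .
qed

lemma fc_add:
  assumes "continuous_on {0..1} f" "continuous_on {0..1} g"
  shows "fc (\<lambda>r. f r + g r) x = fc f x + fc g x"
proof (rule fc_eqI[where c = "norm x"])
  show "continuous_on {0..1} (\<lambda>r. f r + g r)" by (intro continuous_intros assms)
  fix e :: real assume "e > 0"
  then obtain p q where p: "poly_approx f p (e/2)" and q: "poly_approx g q (e/2)"
    using poly_approx_exists[OF assms(1), of "e/2"] poly_approx_exists[OF assms(2), of "e/2"] by auto
  have "poly_approx (\<lambda>r. f r + g r) (p + q) e" unfolding poly_approx_def
  proof
    fix r :: real assume "r \<in> {0..1}"
    then have "\<bar>poly p r - f r\<bar> \<le> e/2" "\<bar>poly q r - g r\<bar> \<le> e/2"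
      using p q by (simp_all add: poly_approx_def)
    then show "\<bar>poly (p + q) r - (f r + g r)\<bar> \<le> e" by (simp only: poly_add)
  qed
  moreover have "norm (fc f x + fc g x - pev (p + q) x) \<le> e * norm x"
  proof -
    have "norm ((fc f x - pev p x) + (fc g x - pev q x)) \<le> e/2 * norm x + e/2 * norm x"
      by (intro norm_triangle_mono fc_approx assms p q)
    then show ?thesis by (simp add: pev_add algebra_simps)
  qed
  ultimately show "\<exists>p. poly_approx (\<lambda>r. f r + g r) p e \<and> norm (fc f x + fc g x - pev p x) \<le> e * norm x"
    by blast
qed

lemma fc_mult:
  assumes f: "continuous_on {0..1} f" and g: "continuous_on {0..1} g"
  shows "fc (\<lambda>r. f r * g r) x = fc f (fc g x)"
proof -
  obtain Mf where Mf: "Mf \<ge> 0" "\<And>r. r \<in> {0..1} \<Longrightarrow> \<bar>f r\<bar> \<le> Mf"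
    using continuous_on_01_bounded[OF f] by blast
  obtain Mg where Mg: "Mg \<ge> 0" "\<And>r. r \<in> {0..1} \<Longrightarrow> \<bar>g r\<bar> \<le> Mg"
    using continuous_on_01_bounded[OF g] by blast
  show ?thesis
  proof (rule fc_eqI[where c = "norm x"])
    show "continuous_on {0..1} (\<lambda>r. f r * g r)" by (intro continuous_intros f g)
    fix e :: real assume e: "e > 0"
    \<comment> \<open>The bound 1 keeps the approximant of \<open>f\<close> below
      \<open>Mf + 1\<close>; the quotient makes the total error \<open>(Mf + 1) * d + Mg * d\<close>
      at most \<open>e\<close>.\<close>
    define d where "d = min 1 (e / (Mf + 1 + Mg))"
    have d: "d > 0" "d \<le> 1" using e Mf Mg by (simp_all add: d_def)
    have "d * (Mf + 1 + Mg) \<le> e / (Mf + 1 + Mg) * (Mf + 1 + Mg)"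
      using Mf Mg by (intro mult_right_mono) (simp_all add: d_def)
    also have "\<dots> = e" using Mf(1) Mg(1) by simp
    finally have de: "(Mf + 1) * d + Mg * d \<le> e" by (simp add: algebra_simps)
    obtain p q where p: "poly_approx f p d" and q: "poly_approx g q d"
      using poly_approx_exists f g d by metis
    have pM: "\<bar>poly p r\<bar> \<le> Mf + 1" if "r \<in> {0..1}" for r
    proof -
      have "\<bar>poly p r - f r\<bar> \<le> d" using p that by (simp add: poly_approx_def)
      then show ?thesis using Mf(2)[OF that] d by linarith
    qed
    have "poly_approx (\<lambda>r. f r * g r) (p * q) e" unfolding poly_approx_def
    proof
      fix r :: real assume r: "r \<in> {0..1}"
      then have a: "\<bar>poly p r - f r\<bar> \<le> d" "\<bar>poly q r - g r\<bar> \<le> d"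
        using p q by (simp_all add: poly_approx_def)
      have "poly (p * q) r - f r * g r = poly p r * (poly q r - g r) + g r * (poly p r - f r)"
        by (simp add: algebra_simps)
      also have "\<bar>\<dots>\<bar> \<le> \<bar>poly p r\<bar> * \<bar>poly q r - g r\<bar> + \<bar>g r\<bar> * \<bar>poly p r - f r\<bar>"
        by (rule order_trans[OF abs_triangle_ineq]) (simp add: abs_mult)
      also have "\<dots> \<le> (Mf + 1) * d + Mg * d"
        using a pM[OF r] Mg Mf r by (intro add_mono mult_mono) auto
      finally show "\<bar>poly (p * q) r - f r * g r\<bar> \<le> e" using de by linarith
    qed
    moreover have "norm (fc f (fc g x) - pev (p * q) x) \<le> e * norm x"
    proof -
      interpret p: linear "pev p" by (rule pev_linear)
      have "fc f (fc g x) - pev (p * q) x = (fc f (fc g x) - pev p (fc g x)) + pev p (fc g x - pev q x)"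
        by (simp add: pev_mult p.diff)
      also have "norm \<dots> \<le> d * norm (fc g x) + (Mf + 1) * norm (fc g x - pev q x)"
        using pM by (intro norm_triangle_mono fc_approx[OF f p] norm_pev_le) auto
      also have "\<dots> \<le> d * (Mg * norm x) + (Mf + 1) * (d * norm x)"
        using d Mf Mg by (intro add_mono mult_left_mono norm_fc_le[OF g] fc_approx[OF g q]) auto
      also have "\<dots> = ((Mf + 1) * d + Mg * d) * norm x" by (simp add: algebra_simps)
      also have "\<dots> \<le> e * norm x" using de by (intro mult_right_mono) simp_all
      finally show ?thesis .
    qed
    ultimately show "\<exists>p. poly_approx (\<lambda>r. f r * g r) p e \<and> norm (fc f (fc g x) - pev p x) \<le> e * norm x"
      by blast
  qed
qed

lemma fc_scale:
  assumes "continuous_on {0..1} f"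
  shows "fc (\<lambda>r. c * f r) x = c *\<^sub>R fc f x"
  using fc_mult[OF continuous_on_const assms, of c x] by (simp add: fc_const)

lemma fc_diff:
  assumes "continuous_on {0..1} f" "continuous_on {0..1} g"
  shows "fc (\<lambda>r. f r - g r) x = fc f x - fc g x"
  using fc_add[OF assms(1) continuous_on_minus[OF assms(2)], of x] fc_scale[OF assms(2), of "-1" x]
  by simp

lemma fc_linear:
  assumes f: "continuous_on {0..1} f"
  shows "linear (fc f)"
proof (rule linearI)
  show "fc f (x + y) = fc f x + fc f y" for x y
  proof (rule fc_eqI[OF f, where c = "norm x + norm y"])
    fix e :: real assume "e > 0"
    then obtain p where p: "poly_approx f p e" using poly_approx_exists[OF f] by blast
    interpret p: linear "pev p" by (rule pev_linear)
    have "norm ((fc f x - pev p x) + (fc f y - pev p y)) \<le> e * norm x + e * norm y"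
      by (intro norm_triangle_mono fc_approx f p)
    then have "norm (fc f x + fc f y - pev p (x + y)) \<le> e * (norm x + norm y)"
      by (simp add: p.add algebra_simps)
    then show "\<exists>p. poly_approx f p e \<and> norm (fc f x + fc f y - pev p (x + y)) \<le> e * (norm x + norm y)"
      using p by blast
  qed
  show "fc f (c *\<^sub>R x) = c *\<^sub>R fc f x" for c x
    using fc_mult[OF f continuous_on_const, of c x] fc_scale[OF f, of c x]
    by (simp add: fc_const mult.commute)
qed

lemma fc_bounded_linear:
  assumes f: "continuous_on {0..1} f"
  shows "bounded_linear (fc f)"
proof -
  obtain M where M: "\<And>r. r \<in> {0..1} \<Longrightarrow> \<bar>f r\<bar> \<le> M" using continuous_on_01_bounded[OF f] by blast
  interpret f: linear "fc f" by (rule fc_linear[OF f])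
  have "norm (fc f x) \<le> norm x * M" for x
    using norm_fc_le[OF f, of M x] M by (simp add: mult.commute)
  then show ?thesis by (intro bounded_linear_intro[of _ M]) (simp_all add: f.add f.scale)
qed

lemma fc_commute:
  assumes f: "continuous_on {0..1} f" and T: "bounded_linear T" "\<And>x. T (R x) = R (T x)"
  shows "T (fc f x) = fc f (T x)"
proof -
  interpret T: bounded_linear T by fact
  obtain C where C: "C > 0" "\<And>x. norm (T x) \<le> C * norm x" using bounded_linear_bound[OF T(1)] by blast
  have "fc f (T x) = T (fc f x)"
  proof (rule fc_eqI[OF f])
  fix e :: real assume "e > 0"
  then obtain p where p: "poly_approx f p e" using poly_approx_exists[OF f] by blast
  have "norm (T (fc f x) - pev p (T x)) = norm (T (fc f x - pev p x))"
    using pev_commute[OF T.linear T(2), of p x] by (simp add: T.diff)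
  also have "\<dots> \<le> C * (e * norm x)"
    by (rule order_trans[OF C(2)]) (intro mult_left_mono fc_approx[OF f p] less_imp_le C(1))
  finally have "norm (T (fc f x) - pev p (T x)) \<le> e * (C * norm x)" by (simp add: ac_simps)
  then show "\<exists>p. poly_approx f p e \<and> norm (T (fc f x) - pev p (T x)) \<le> e * (C * norm x)"
    using p by blast
  qed
  then show ?thesis ..
qed

lemma fc_sym:
  assumes f: "continuous_on {0..1} f"
  shows "inner (fc f x) y = inner x (fc f y)"
proof -
  have "\<bar>inner (fc f x) y - inner x (fc f y)\<bar> \<le> 0"
  proof (rule field_le_epsilon)
    fix d :: real assume d: "d > 0"
    define s where "s = norm x * norm y + 1"
    define e where "e = d / (2 * s)"
    have s: "s > 0" by (simp add: s_def add_nonneg_pos)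
    then have e: "e > 0" using d by (simp add: e_def)
    then obtain p where p: "poly_approx f p e" using poly_approx_exists[OF f] by blast
    have "inner (fc f x) y - inner x (fc f y) = inner (fc f x - pev p x) y - inner x (fc f y - pev p y)"
      by (simp add: inner_diff pev_sym)
    also have "\<bar>\<dots>\<bar> \<le> norm (fc f x - pev p x) * norm y + norm x * norm (fc f y - pev p y)"
      by (rule order_trans[OF abs_triangle_ineq4]) (intro add_mono Cauchy_Schwarz_ineq2)
    also have "\<dots> \<le> (e * norm x) * norm y + norm x * (e * norm y)"
      by (intro add_mono mult_left_mono mult_right_mono fc_approx[OF f p]) simp_all
    also have "\<dots> \<le> 2 * e * s" using e by (simp add: s_def algebra_simps)
    also have "\<dots> = d" using s by (simp add: e_def)
    finally show "\<bar>inner (fc f x) y - inner x (fc f y)\<bar> \<le> 0 + d" by simp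
  qed
  then show ?thesis by simp
qed

lemma fc_nonneg:
  assumes f: "continuous_on {0..1} f" and nn: "\<And>r. 0 \<le> r \<Longrightarrow> r \<le> 1 \<Longrightarrow> 0 \<le> f r"
  shows "0 \<le> inner (fc f x) x"
proof -
  have g: "continuous_on {0..1} (\<lambda>r. sqrt (f r))" by (intro continuous_intros f)
  have "fc f x = fc (\<lambda>r. sqrt (f r) * sqrt (f r)) x" by (rule fc_cong) (simp add: nn)
  then have "inner (fc f x) x = inner (fc (\<lambda>r. sqrt (f r)) x) (fc (\<lambda>r. sqrt (f r)) x)"
    by (simp only: fc_mult[OF g g] fc_sym[OF g])
  then show ?thesis by simp
qed

end

subsection \<open>Fractional powers\<close>

text \<open>A linear isometry commutes with Riemann sums and preserves their distance to the value,
  so the same gauges work before and after applying \<open>J\<close>.\<close>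

lemma has_integral_of_isometric_image:
  fixes f :: "'a::euclidean_space \<Rightarrow> 'b::real_normed_vector"
    and J :: "'b \<Rightarrow> 'c::real_normed_vector"
  assumes J: "linear J" "\<And>x. norm (J x) = norm x"
    and int: "((\<lambda>t. J (f t)) has_integral J y) (cbox a b)"
  shows "(f has_integral y) (cbox a b)"
proof -
  interpret J: linear J by fact
  have "norm ((\<Sum>(x, k)\<in>D. Henstock_Kurzweil_Integration.content k *\<^sub>R J (f x)) - J y)
      = norm ((\<Sum>(x, k)\<in>D. Henstock_Kurzweil_Integration.content k *\<^sub>R f x) - y)"
    for D :: "('a \<times> 'a set) set"
  proof -
    have "(\<Sum>(x, k)\<in>D. Henstock_Kurzweil_Integration.content k *\<^sub>R J (f x))
        = J (\<Sum>(x, k)\<in>D. Henstock_Kurzweil_Integration.content k *\<^sub>R f x)"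
      by (simp add: J.sum J.scale split_def)
    then show ?thesis by (simp only: J.diff[symmetric] J(2))
  qed
  then show ?thesis using int unfolding has_integral by simp
qed

text \<open>The library's \<open>has_integral_combine\<close> requires the class \<open>banach\<close>, of which a type of sort
  \<open>{real_inner, complete_space}\<close> need not be an instance; hence the detour through the dual space.\<close>
lemma has_integral_combine_hilbert:
  fixes f :: "real \<Rightarrow> 'h::real_inner"
  assumes "a \<le> c" "c \<le> b" and "(f has_integral i) {a..c}" and "(f has_integral j) {c..b}"
  shows "(f has_integral (i + j)) {a..b}"
proof -
  define J :: "'h \<Rightarrow> ('h \<Rightarrow>\<^sub>L real)" where "J = blinfun_inner_left"
  have bl: "bounded_linear J" unfolding J_def by (rule bounded_linear_blinfun_inner_left)
  have J: "linear J" using bl by (rule bounded_linear.linear)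
  have "norm (J x) = norm x" for x
  proof (rule antisym)
    show "norm (J x) \<le> norm x"
      by (rule norm_blinfun_bound) (simp_all add: J_def Cauchy_Schwarz_ineq2 mult.commute)
    show "norm x \<le> norm (J x)"
    proof (cases "x = 0")
      case False
      have "norm (blinfun_apply (J x) x) \<le> norm (J x) * norm x" by (rule norm_blinfun)
      then have "norm x * norm x \<le> norm (J x) * norm x" by (simp add: J_def norm_eq_sqrt_inner)
      then show ?thesis using False by simp
    qed simp
  qed
  moreover have "((\<lambda>t. J (f t)) has_integral J i + J j) {a..b}"
    using has_integral_combine[OF assms(1,2)] has_integral_linear[OF assms(3) bl]
      has_integral_linear[OF assms(4) bl] by (simp add: o_def)
  then have "((\<lambda>t. J (f t)) has_integral J (i + j)) (cbox a b)" by (simp add: linear_add[OF J])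
  ultimately have "(f has_integral (i + j)) (cbox a b)"
    by (rule has_integral_of_isometric_image[OF J])
  then show ?thesis by simp
qed

text \<open>\<open>k\<close> is the integral of \<open>1 / (1 + u powr p)\<close> from 0 to
  \<open>w\<close> and \<open>K\<close> is its supremum. The upper bound on \<open>K\<close>
  compares the tail with the integral of \<open>u powr (- p)\<close> from \<open>w\<close> on. For
  \<open>p = 2\<close> the function is the arctangent.\<close>

lemma antiderivative_inverse_one_plus_powr:
  fixes p :: real
  assumes p: "p > 1"
  obtains k K where "k 0 = 0"
    "\<And>w. w > 0 \<Longrightarrow> (k has_real_derivative 1 / (1 + w powr p)) (at w)"
    "continuous_on {0..} k"
    "\<And>w. w \<ge> 0 \<Longrightarrow> 0 \<le> k w" "\<And>w. w \<ge> 0 \<Longrightarrow> k w \<le> w"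
    "\<And>w. w \<ge> 0 \<Longrightarrow> k w \<le> K" "\<And>w. w > 0 \<Longrightarrow> K \<le> k w + w powr (1 - p) / (p - 1)"
    "K > 0" "p = 2 \<longrightarrow> K = pi / 2"
proof -
  define f where "f u = 1 / (1 + u powr p)" for u :: real
  define k where "k w = integral {0..w} f" for w
  have den: "1 + u powr p > 0" for u by (simp add: add_pos_nonneg)
  have contf: "continuous_on {0..b} f" for b unfolding f_def
    by (intro continuous_intros continuous_on_powr') (use p den in \<open>auto simp: less_imp_neq[OF den, symmetric]\<close>)
  have f_pos: "f u > 0" for u using den by (simp add: f_def)
  have f_le: "f u \<le> 1" for u using den by (simp add: f_def divide_le_eq)
  have intf: "f integrable_on {0..b}" for b by (rule integrable_continuous_real[OF contf])
  have deriv_within: "(k has_real_derivative f w) (at w within {0..b})" if "w \<in> {0..b}" for w b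
    unfolding k_def by (rule integral_has_real_derivative[OF contf that])
  have k0: "k 0 = 0" by (simp add: k_def)
  have deriv: "(k has_real_derivative f w) (at w)" if "w > 0" for w
    using deriv_within[of w "w + 1"] that by (simp add: at_within_Icc_at)
  have contk: "continuous_on {0..b} k" for b
    using deriv_within DERIV_continuous unfolding continuous_on_eq_continuous_within by blast
  have contk': "continuous_on {0..} k"
    unfolding continuous_on_eq_continuous_within
  proof
    fix w :: real assume w: "w \<in> {0..}"
    have "continuous (at w within {0..w+1}) k"
      using contk[of "w + 1"] w unfolding continuous_on_eq_continuous_within by simp
    moreover have "at w within {0..} = at w within {0..w+1}"
      by (rule at_within_nhd[of _ "{..<w+1}"]) (use w in auto)
    ultimately show "continuous (at w within {0..}) k" by simp
  qed
  have k_nonneg: "0 \<le> k w" if "w \<ge> 0" for w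
    unfolding k_def by (rule integral_nonneg[OF intf]) (simp add: f_pos less_imp_le)
  have k_le: "k w \<le> w" if "w \<ge> 0" for w
  proof -
    have "k w \<le> integral {0..w} (\<lambda>u. 1)" unfolding k_def
      by (rule integral_le[OF intf]) (use f_le in auto)
    then show ?thesis using that by simp
  qed
  have k_mono: "k v \<le> k w" if "0 \<le> v" "v \<le> w" for v w
    unfolding k_def using that f_pos
    by (intro integral_subset_le intf) (auto simp: less_imp_le)
  have k1: "k 1 > 0"
  proof -
    have "integral {0..1} (\<lambda>u::real. 1/2) \<le> k 1" unfolding k_def
    proof (rule integral_le)
      show "f integrable_on {0..1}" by (rule intf)
      fix u :: real assume "u \<in> {0..1}"
      then have "u powr p \<le> 1" using p by (simp add: powr_le1)
      then show "1/2 \<le> f u" using den[of u] by (simp add: f_def field_simps)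
    qed (rule integrable_const_ivl)
    then show ?thesis by simp
  qed
  \<comment> \<open>\<open>g\<close> adds to \<open>k\<close> the tail integral of the majorant
    \<open>u powr (- p)\<close>; it is therefore nonincreasing and stays above every value of
    \<open>k\<close>.\<close>
  define g where "g w = k w + w powr (1 - p) / (p - 1)" for w
  have g_anti: "g w \<le> g v" if "0 < v" "v \<le> w" for v w
  proof (rule DERIV_nonpos_imp_nonincreasing[OF that(2)])
    fix u assume "v \<le> u" "u \<le> w"
    then have u: "u > 0" using that by simp
    have "(g has_real_derivative f u + ((1 - p) * u powr (1 - p - 1)) / (p - 1)) (at u)"
      unfolding g_def using u by (intro DERIV_add deriv DERIV_cdivide has_real_derivative_powr)
    moreover have "f u + ((1 - p) * u powr (1 - p - 1)) / (p - 1) \<le> 0"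
    proof -
      have "f u \<le> 1 / u powr p" unfolding f_def using u by (intro frac_le) auto
      also have "\<dots> = u powr (1 - p - 1)" by (simp add: powr_minus_divide)
      also have "\<dots> = - (((1 - p) * u powr (1 - p - 1)) / (p - 1))" 
      proof -
        have "(1 - p) * u powr (1 - p - 1) = (p - 1) * - (u powr (1 - p - 1))" by (simp add: algebra_simps)
        then show ?thesis using p by simp
      qed
      finally show ?thesis by simp
    qed
    ultimately show "\<exists>y. (g has_real_derivative y) (at u) \<and> y \<le> 0" by blast
  qed
  have kg: "k v \<le> g w" if "0 \<le> v" "0 < w" for v w
  proof (cases "v \<le> w")
    case True
    then have "k v \<le> k w" using that k_mono by simp
    then show ?thesis using p by (simp add: g_def add_increasing2)
  next
    case False
    then have "g v \<le> g w" using that g_anti by simp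
    moreover have "k v \<le> g v" using p by (simp add: g_def)
    ultimately show ?thesis by simp
  qed
  define K where "K = (SUP v\<in>{0..}. k v)"
  have bdd: "bdd_above (k ` {0..})" by (rule bdd_aboveI[of _ "g 1"]) (auto intro: kg)
  have K_ge: "k v \<le> K" if "v \<ge> 0" for v unfolding K_def using bdd that by (intro cSUP_upper) auto
  have K_le: "K \<le> g w" if "w > 0" for w unfolding K_def using kg that by (intro cSUP_least) auto
  have K_half: "K = pi / 2" if "p = 2"
  proof -
    have arctan_eq: "k w = arctan w" if "w \<ge> 0" for w
    proof -
      have "(f has_integral (arctan w - arctan 0)) {0..w}"
      proof (rule fundamental_theorem_of_calculus[OF that])
        fix u assume "u \<in> {0..w}"
        then have "f u = inverse (1 + u\<^sup>2)" using \<open>p = 2\<close> by (simp add: f_def inverse_eq_divide powr_numeral)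
        then show "(arctan has_vector_derivative f u) (at u within {0..w})"
          using DERIV_arctan[of u] has_field_derivative_at_within has_real_derivative_iff_has_vector_derivative
          by metis
      qed
      then show ?thesis by (simp add: k_def integral_unique)
    qed
    have lim1: "(\<lambda>n. arctan (real n)) \<longlonglongrightarrow> pi / 2"
      using filterlim_compose[OF tendsto_arctan_at_top filterlim_real_sequentially] .
    then have lim2: "(\<lambda>n. arctan (real n) + 1 / real n) \<longlonglongrightarrow> pi / 2 + 0"
      by (intro tendsto_add lim_const_over_n)
    have "arctan (real n) \<le> K" for n using K_ge[of "real n"] arctan_eq[of "real n"] by simp
    then have "pi / 2 \<le> K" by (intro LIMSEQ_le_const2[OF lim1]) blast
    have "\<exists>N. \<forall>n\<ge>N. K \<le> arctan (real n) + 1 / real n"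
    proof (intro exI[of _ 1] allI impI)
      fix n :: nat assume "n \<ge> 1"
      then show "K \<le> arctan (real n) + 1 / real n"
        using K_le[of "real n"] arctan_eq[of "real n"] \<open>p = 2\<close> by (simp add: g_def powr_minus_divide)
    qed
    then have "K \<le> pi / 2 + 0" by (rule LIMSEQ_le_const[OF lim2])
    then show ?thesis using \<open>pi / 2 \<le> K\<close> by simp
  qed
  have "K > 0" using k1 K_ge[of 1] by linarith
  then show thesis
    by (rule that[of k K, rotated 7]) (use k0 deriv contk' k_nonneg k_le K_ge K_le K_half in \<open>auto simp: f_def g_def\<close>)
qed

context pos_contraction
begin

text \<open>Differentiation under the functional calculus. For each \<open>r\<close> the mean value
  inequality is applied to the function \<open>g u r - u * k t0 r\<close> of \<open>u\<close>; the
  bound is independent of \<open>r\<close>, so \<open>norm_fc_le\<close> turns it into a norm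
  estimate.\<close>

lemma fc_has_vector_derivative:
  assumes S: "t0 \<in> S" "open S"
    and contg: "\<And>t. t \<in> S \<Longrightarrow> continuous_on {0..1} (g t)"
    and contk: "continuous_on {0..1} (k t0)"
    and deriv: "\<And>t r. t \<in> S \<Longrightarrow> 0 \<le> r \<Longrightarrow> r \<le> 1 \<Longrightarrow> ((\<lambda>t. g t r) has_real_derivative k t r) (at t)"
    and unif: "\<And>e. e > 0 \<Longrightarrow> \<exists>d>0. \<forall>t. \<bar>t - t0\<bar> < d \<longrightarrow> (\<forall>r\<in>{0..1}. \<bar>k t r - k t0 r\<bar> \<le> e)"
  shows "((\<lambda>t. fc (g t) x) has_vector_derivative fc (k t0) x) (at t0)"
  unfolding has_vector_derivative_def has_derivative_at_alt
proof (intro conjI allI impI)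
  show "bounded_linear (\<lambda>h. h *\<^sub>R fc (k t0) x)" by (rule bounded_linear_scaleR_left)
  fix e :: real assume e: "e > 0"
  define e' where "e' = e / (norm x + 1)"
  have n1: "norm x + 1 > 0" by (simp add: add_nonneg_pos)
  then have "e' > 0" using e by (simp add: e'_def)
  then obtain d where d: "d > 0" "\<And>t r. \<bar>t - t0\<bar> < d \<Longrightarrow> r \<in> {0..1} \<Longrightarrow> \<bar>k t r - k t0 r\<bar> \<le> e'"
    using unif by metis
  obtain d' where d': "d' > 0" "\<And>t. dist t t0 < d' \<Longrightarrow> t \<in> S"
    using S by (metis open_dist)
  show "\<exists>d>0. \<forall>t. norm (t - t0) < d \<longrightarrow>
      norm (fc (g t) x - fc (g t0) x - (t - t0) *\<^sub>R fc (k t0) x) \<le> e * norm (t - t0)"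
  proof (intro exI[of _ "min d d'"] conjI allI impI)
    show "min d d' > 0" using d d' by simp
    fix t assume t: "norm (t - t0) < min d d'"
    have inS: "u \<in> S" if "min t0 t \<le> u" "u \<le> max t0 t" for u
      using d'(2)[of u] t that by (auto simp: dist_real_def min_def max_def split: if_splits)
    have bound: "\<bar>g t r - g t0 r - (t - t0) * k t0 r\<bar> \<le> e' * \<bar>t - t0\<bar>" if r: "0 \<le> r" "r \<le> 1" for r
    proof -
      have "\<bar>(g t r - t * k t0 r) - (g t0 r - t0 * k t0 r)\<bar> \<le> e' * \<bar>t - t0\<bar>"
        unfolding real_norm_def[symmetric]
      proof (rule field_differentiable_bound[where S = "{min t0 t..max t0 t}"])
        fix u assume u: "u \<in> {min t0 t..max t0 t}"
        then have "u \<in> S" using inS by simp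
        then show "((\<lambda>u. g u r - u * k t0 r) has_field_derivative k u r - 1 * k t0 r)
            (at u within {min t0 t..max t0 t})"
          by (intro has_field_derivative_at_within[OF DERIV_diff] deriv r DERIV_cmult_right DERIV_ident)
        have "\<bar>u - t0\<bar> < d" using u t by (auto simp: min_def max_def split: if_splits)
        then show "norm (k u r - 1 * k t0 r) \<le> e'" using d(2) r by simp
      qed auto
      then show ?thesis by (simp add: algebra_simps)
    qed
    have cg: "continuous_on {0..1} (g t)" "continuous_on {0..1} (g t0)"
      using contg inS by auto
    have "fc (g t) x - fc (g t0) x - (t - t0) *\<^sub>R fc (k t0) x
        = fc (\<lambda>r. g t r - g t0 r - (t - t0) * k t0 r) x"
      by (simp add: fc_diff fc_scale continuous_intros cg contk)
    also have "norm \<dots> \<le> (e' * \<bar>t - t0\<bar>) * norm x"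
      by (rule norm_fc_le[OF _ bound]) (intro continuous_intros cg contk)
    also have "\<dots> \<le> (e' * \<bar>t - t0\<bar>) * (norm x + 1)"
      using \<open>e' > 0\<close> by (intro mult_left_mono) simp_all
    also have "\<dots> = e * norm (t - t0)" using n1 by (simp add: e'_def)
    finally show "norm (fc (g t) x - fc (g t0) x - (t - t0) *\<^sub>R fc (k t0) x) \<le> e * norm (t - t0)" .
  qed
qed

lemma continuous_on_resolvent: "t > 0 \<Longrightarrow> continuous_on {0..1} (\<lambda>r. r / (t + r) :: real)"
  by (intro continuous_intros) auto

lemma shifted_inv_eq:
  assumes t: "t > 0"
  shows "shifted_inv R t x = fc (\<lambda>r. 1 / (t + r)) x"
  unfolding shifted_inv_def
proof (rule the_equality)
  have c: "continuous_on {0..1} (\<lambda>r. 1 / (t + r))" "continuous_on {0..1} (\<lambda>r. t + r)"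
    using t by (auto intro!: continuous_intros)
  have "t *\<^sub>R y + R y = fc (\<lambda>r. t + r) y" for y
    by (simp add: fc_add fc_const fc_ident)
  then have "t *\<^sub>R fc (\<lambda>r. 1 / (t + r)) x + R (fc (\<lambda>r. 1 / (t + r)) x)
      = fc (\<lambda>r. (t + r) * (1 / (t + r))) x"
    by (simp only: fc_mult[OF c(2,1)])
  also have "\<dots> = fc (\<lambda>r. 1) x" by (rule fc_cong) (use t in auto)
  finally show *: "t *\<^sub>R fc (\<lambda>r. 1 / (t + r)) x + R (fc (\<lambda>r. 1 / (t + r)) x) = x"
    by (simp add: fc_const)
  fix y assume "t *\<^sub>R y + R y = x"
  define z where "z = y - fc (\<lambda>r. 1 / (t + r)) x"
  have "t *\<^sub>R z + R z = 0"
    using * \<open>t *\<^sub>R y + R y = x\<close> by (simp add: z_def R.diff algebra_simps)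
  then have "t * inner z z + inner (R z) z = 0" by (metis inner_add_left inner_scaleR_left inner_zero_left)
  then have "t * inner z z \<le> 0" using pos[of z] by linarith
  then have "inner z z \<le> 0" using t by (simp add: mult_le_0_iff)
  then have "inner z z = 0" using inner_ge_zero[of z] by linarith
  then show "y = fc (\<lambda>r. 1 / (t + r)) x" by (simp add: z_def)
qed

text \<open>The integrand is the derivative in \<open>t\<close> of \<open>r\<^sup>s / s * k ((t / r)\<^sup>s)\<close>, uniformly in the spectral
  parameter \<open>r\<close>, where \<open>k' w = 1 / (1 + w\<^sup>1\<^sup>/\<^sup>s)\<close>: the substitution removes the singularity at \<open>0\<close>.
  The constant is \<open>\<pi> / sin (\<pi> s)\<close>, but its value matters only for \<open>s = 1/2\<close>.\<close>
lemma has_integral_fractional_power: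
  fixes s :: real
  assumes s: "0 < s" "s < 1"
  shows "\<exists>c>0. (s = 1/2 \<longrightarrow> c = pi) \<and>
    (\<forall>x. ((\<lambda>t. t powr (s - 1) *\<^sub>R R (shifted_inv R t x)) has_integral c *\<^sub>R fc (\<lambda>r. r powr s) x) {0<..})"
proof -
  define p where "p = 1 / s"
  have p: "p > 1" using s by (simp add: p_def)
  have ps: "(v powr s) powr p = v" if "v \<ge> 0" for v using that s by (simp add: powr_powr p_def)
  obtain k K where k0: "k 0 = 0"
    and kd: "\<And>w. w > 0 \<Longrightarrow> (k has_real_derivative 1 / (1 + w powr p)) (at w)"
    and kcont: "continuous_on {0..} k"
    and kpos: "\<And>w. w \<ge> 0 \<Longrightarrow> 0 \<le> k w" and kle: "\<And>w. w \<ge> 0 \<Longrightarrow> k w \<le> w"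
    and kK: "\<And>w. w \<ge> 0 \<Longrightarrow> k w \<le> K"
    and Kk: "\<And>w. w > 0 \<Longrightarrow> K \<le> k w + w powr (1 - p) / (p - 1)"
    and K: "K > 0" "p = 2 \<longrightarrow> K = pi / 2"
    using antiderivative_inverse_one_plus_powr[OF p] by blast
  define g where "g t r = r powr s / s * k ((t / r) powr s)" for t r
  define h where "h t r = t powr (s - 1) * (r / (t + r))" for t r
  have g_bounds: "0 \<le> g t r" "g t r \<le> r powr s / s * K" if "t \<ge> 0" "r \<ge> 0" for t r
  proof -
    have "0 \<le> r powr s / s" using s by simp
    then show "0 \<le> g t r" "g t r \<le> r powr s / s * K" unfolding g_def
      by (rule mult_nonneg_nonneg[OF _ kpos[OF powr_ge_zero]], rule mult_left_mono[OF kK[OF powr_ge_zero]])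
  qed
  have g_le: "g t r \<le> t powr s / s" if "t \<ge> 0" "r \<ge> 0" for t r
  proof (cases "r = 0")
    case False
    have "g t r \<le> r powr s / s * (t / r) powr s"
      unfolding g_def using s by (intro mult_left_mono kle) auto
    also have "\<dots> = t powr s / s" using False that by (simp add: powr_divide)
    finally show ?thesis .
  qed (use s in \<open>simp add: g_def\<close>)
  have contg_pos: "continuous_on {0..1} (g t)" if t: "t > 0" for t
    unfolding continuous_on_eq_continuous_within
  proof
    fix r :: real assume r: "r \<in> {0..1}"
    show "continuous (at r within {0..1}) (g t)"
    proof (cases "r = 0")
      case False
      have "continuous_on {0<..} (g t)" unfolding g_def
        by (intro continuous_intros continuous_on_compose2[OF kcont])
          (use t s in \<open>auto intro!: continuous_intros\<close>)
      then have "isCont (g t) r" using False r by (auto simp: continuous_on_eq_continuous_at)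
      then show ?thesis by (rule continuous_at_imp_continuous_at_within)
    next
      case True
      \<comment> \<open>At \<open>r = 0\<close> the quotient \<open>t / r\<close> degenerates, so
        continuity comes from the bound \<open>r powr s / s * K\<close>, which tends to 0.\<close>
      have "((\<lambda>r. r powr s / s * K) \<longlongrightarrow> 0 powr s / s * K) (at 0 within {0..1})"
        by (intro tendsto_intros tendsto_powr') (use s in \<open>auto simp: eventually_at_filter\<close>)
      then have "((\<lambda>r. r powr s / s * K) \<longlongrightarrow> 0) (at 0 within {0..1})" by simp
      moreover have "\<forall>\<^sub>F r in at 0 within {0..1}. norm (g t r) \<le> r powr s / s * K"
        using g_bounds t by (auto simp: eventually_at_filter)
      ultimately have "(g t \<longlongrightarrow> 0) (at 0 within {0..1})" by (rule Lim_null_comparison[rotated])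
      then show ?thesis using True by (simp add: continuous_within g_def)
    qed
  qed
  have contg: "continuous_on {0..1} (g t)" if "t \<ge> 0" for t
  proof (cases "t = 0")
    case True
    then have "g t = (\<lambda>r. 0)" by (simp add: g_def[abs_def] k0)
    then show ?thesis by simp
  qed (use that contg_pos in simp)
  have conth: "continuous_on {0..1} (h t)" if "t > 0" for t
    unfolding h_def using that by (intro continuous_intros) auto
  have deriv: "((\<lambda>t. g t r) has_real_derivative h t r) (at t)" if t: "t \<in> {0<..}" and r: "0 \<le> r" for t r
  proof (cases "r = 0")
    case False
    then have r: "r > 0" using that by simp
    have t: "t > 0" using that by simp
    have inner_deriv: "((\<lambda>t. (t / r) powr s) has_real_derivative s * (t / r) powr (s - 1) * (1 / r)) (at t)"
      using DERIV_fun_powr[OF DERIV_cdivide[OF DERIV_ident], of t r s] r t by simp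
    have "((\<lambda>t. g t r) has_real_derivative
        r powr s / s * (1 / (1 + ((t / r) powr s) powr p) * (s * (t / r) powr (s - 1) * (1 / r)))) (at t)"
      unfolding g_def using r t
      by (intro DERIV_cmult DERIV_chain2[OF kd inner_deriv]) simp
    moreover have "r powr s / s * (1 / (1 + ((t / r) powr s) powr p) * (s * (t / r) powr (s - 1) * (1 / r))) = h t r"
    proof -
      have "((t / r) powr s) powr p = t / r" using r t by (intro ps) simp
      moreover have "r powr s * (t / r) powr (s - 1) * (1 / r) = t powr (s - 1)"
        using r t by (simp add: powr_divide powr_diff)
      moreover have "r powr s / s * (q * (s * (t / r) powr (s - 1) * (1 / r)))
          = r powr s * (t / r) powr (s - 1) * (1 / r) * q" for q using s by simp
      ultimately have "r powr s / s * (1 / (1 + ((t / r) powr s) powr p) * (s * (t / r) powr (s - 1) * (1 / r)))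
          = t powr (s - 1) * (1 / (1 + t / r))" by metis
      also have "1 / (1 + t / r) = r / (t + r)" using r t by (simp add: divide_simps)
      finally show ?thesis by (simp add: h_def)
    qed
    ultimately show ?thesis by simp
  qed (simp add: g_def h_def)
  have unif: "\<exists>d>0. \<forall>t. \<bar>t - t0\<bar> < d \<longrightarrow> (\<forall>r\<in>{0..1}. \<bar>h t r - h t0 r\<bar> \<le> e)"
    if t0: "t0 > 0" and e: "e > 0" for t0 e
  proof -
    \<comment> \<open>This function vanishes at \<open>t0\<close> and, as shown below, dominates the
      difference of \<open>h t r\<close> and \<open>h t0 r\<close> for all \<open>r\<close> at
      once.\<close>
    have "((\<lambda>t. \<bar>t powr (s - 1) - t0 powr (s - 1)\<bar> + t0 powr (s - 1) * (\<bar>t - t0\<bar> / t0))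
        \<longlongrightarrow> \<bar>t0 powr (s - 1) - t0 powr (s - 1)\<bar> + t0 powr (s - 1) * (\<bar>t0 - t0\<bar> / t0)) (at t0)"
      using t0 by (intro tendsto_intros) auto
    then have "\<forall>\<^sub>F t in at t0. \<bar>t powr (s - 1) - t0 powr (s - 1)\<bar> + t0 powr (s - 1) * (\<bar>t - t0\<bar> / t0) < e"
      using e by (intro order_tendstoD(2)) auto
    then obtain d where d: "d > 0" "\<And>t. t \<noteq> t0 \<Longrightarrow> dist t t0 < d \<Longrightarrow>
        \<bar>t powr (s - 1) - t0 powr (s - 1)\<bar> + t0 powr (s - 1) * (\<bar>t - t0\<bar> / t0) < e"
      unfolding eventually_at by auto
    have "\<bar>h t r - h t0 r\<bar> \<le> e" if t: "\<bar>t - t0\<bar> < min d t0" and r: "r \<in> {0..1}" for t r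
    proof (cases "t = t0")
      case False
      have tp: "t > 0" using t by linarith
      have "h t r - h t0 r = (t powr (s - 1) - t0 powr (s - 1)) * (r / (t + r))
          + t0 powr (s - 1) * (r / (t + r) - r / (t0 + r))"
        by (simp add: h_def algebra_simps)
      also have "\<bar>\<dots>\<bar> \<le> \<bar>t powr (s - 1) - t0 powr (s - 1)\<bar> * (r / (t + r))
          + t0 powr (s - 1) * \<bar>r / (t + r) - r / (t0 + r)\<bar>"
        using r tp by (intro order_trans[OF abs_triangle_ineq]) (simp add: abs_mult)
      also have "\<dots> \<le> \<bar>t powr (s - 1) - t0 powr (s - 1)\<bar> * 1 + t0 powr (s - 1) * (\<bar>t - t0\<bar> / t0)"
      proof (intro add_mono mult_left_mono)
        show "r / (t + r) \<le> 1" using r tp by (simp add: divide_le_eq)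
        have "r / (t + r) - r / (t0 + r) = r / (t + r) * ((t0 - t) / (t0 + r))"
          using r tp t0 by (simp add: divide_simps) (simp add: algebra_simps)
        then have "\<bar>r / (t + r) - r / (t0 + r)\<bar> = r / (t + r) * (\<bar>t - t0\<bar> / (t0 + r))"
          using r tp t0 by (simp add: abs_mult abs_minus_commute)
        also have "\<dots> \<le> 1 * (\<bar>t - t0\<bar> / t0)"
          using r tp t0 by (intro mult_mono frac_le) (auto simp: divide_le_eq)
        finally show "\<bar>r / (t + r) - r / (t0 + r)\<bar> \<le> \<bar>t - t0\<bar> / t0" by simp
      qed simp_all
      also have "\<dots> < e" using d(2)[OF False] t by (simp add: dist_real_def)
      finally show ?thesis by simp
    qed (use e in simp)
    then show ?thesis using d(1) t0 by (intro exI[of _ "min d t0"]) auto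
  qed
  \<comment> \<open>\<open>K / s * r powr s\<close> is the limit of \<open>g t r\<close> as
    \<open>t\<close> tends to infinity. For \<open>s = 1/2\<close> this makes \<open>c\<close> equal
    to pi/2 divided by 1/2.\<close>
  define c where "c = K / s"
  have "((\<lambda>t. t powr (s - 1) *\<^sub>R R (shifted_inv R t x)) has_integral c *\<^sub>R fc (\<lambda>r. r powr s) x) {0<..}" for x
  proof -
    define f where "f t = t powr (s - 1) *\<^sub>R R (shifted_inv R t x)" for t
    define G where "G t = fc (g t) x" for t
    have f_eq: "f t = fc (h t) x" if t: "t > 0" for t
    proof -
      have c: "continuous_on {0..1} (\<lambda>r. 1 / (t + r))" using t by (auto intro!: continuous_intros)
      have "R (shifted_inv R t x) = fc (\<lambda>r. r * (1 / (t + r))) x"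
        using fc_mult[OF continuous_on_id c, of x] t by (simp add: shifted_inv_eq fc_ident)
      then have "f t = fc (\<lambda>r. t powr (s - 1) * (r / (t + r))) x"
        using fc_scale[OF continuous_on_resolvent[OF t], of "t powr (s - 1)" x] by (simp add: f_def)
      then show ?thesis by (simp add: h_def[abs_def])
    qed
    have Gderiv: "(G has_vector_derivative f t) (at t)" if t: "t > 0" for t
      unfolding G_def f_eq[OF t]
    proof (rule fc_has_vector_derivative[of t "{0<..}"])
      show "t \<in> {0<..}" using t by simp
      show "continuous_on {0..1} (g u)" if "u \<in> {0<..}" for u using contg that by simp
    qed (use conth[OF t] deriv unif[OF t] in auto)
    have Gle: "norm (G t) \<le> t powr s / s * norm x" if "t \<ge> 0" for t
      unfolding G_def
    proof (rule norm_fc_le[OF contg[OF that]])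
      fix r :: real assume "0 \<le> r"
      then show "\<bar>g t r\<bar> \<le> t powr s / s" using g_bounds(1)[OF that] g_le[OF that] by simp
    qed
    have G0: "G 0 = 0" using Gle[of 0] by simp
    have Gcont: "continuous_on {0..b} G" for b
      unfolding continuous_on_eq_continuous_within
    proof
      fix t assume t: "t \<in> {0..b}"
      show "continuous (at t within {0..b}) G"
      proof (cases "t = 0")
        case False
        then have "isCont G t" using Gderiv[of t] t has_vector_derivative_continuous by auto
        then show ?thesis by (rule continuous_at_imp_continuous_at_within)
      next
        case True
        have "((\<lambda>t. t powr s / s * norm x) \<longlongrightarrow> 0 powr s / s * norm x) (at 0 within {0..b})"
          by (intro tendsto_intros tendsto_powr') (use s in \<open>auto simp: eventually_at_filter\<close>)
        then have "((\<lambda>t. t powr s / s * norm x) \<longlongrightarrow> 0) (at 0 within {0..b})" by simp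
        moreover have "\<forall>\<^sub>F t in at 0 within {0..b}. norm (G t) \<le> t powr s / s * norm x"
          using Gle by (auto simp: eventually_at_filter)
        ultimately have "(G \<longlongrightarrow> 0) (at 0 within {0..b})" by (rule Lim_null_comparison[rotated])
        then show ?thesis using True G0 by (simp add: continuous_within)
      qed
    qed
    have Gint: "(f has_integral G b) {0..b}" if "b \<ge> 0" for b
      using fundamental_theorem_of_calculus_interior[OF that Gcont Gderiv] G0 by simp
    \<comment> \<open>The integral over the half line is tested on boxes that may begin to the left
      of 0, where the integrand is extended by 0.\<close>
    have Gint': "((\<lambda>t. if t \<in> {0<..} then f t else 0) has_integral G b) (cbox a b)"
      if ab: "a \<le> 0" "0 \<le> b" for a b
    proof -
      have "((\<lambda>t. if t \<in> {0<..} then f t else 0) has_integral 0) {a..0}"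
        by (rule has_integral_is_0) auto
      moreover have "((\<lambda>t. if t \<in> {0<..} then f t else 0) has_integral G b) {0..b}"
        by (rule has_integral_spike[of "{0}", OF _ _ Gint[OF ab(2)]]) auto
      ultimately have "((\<lambda>t. if t \<in> {0<..} then f t else 0) has_integral 0 + G b) {a..b}"
        by (rule has_integral_combine_hilbert[OF ab])
      then show ?thesis by simp
    qed
    have Glim: "norm (G b - c *\<^sub>R fc (\<lambda>r. r powr s) x) \<le> (b powr s) powr (1 - p) / (s * (p - 1)) * norm x"
      if b: "b > 0" for b
    proof -
      have cs: "continuous_on {0..1} (\<lambda>r. r powr s)"
        using s by (intro continuous_intros continuous_on_powr') auto
      have "G b - c *\<^sub>R fc (\<lambda>r. r powr s) x = fc (\<lambda>r. g b r - c * r powr s) x"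
        using contg b by (simp add: G_def fc_diff fc_scale continuous_intros cs)
      also have "norm \<dots> \<le> (b powr s) powr (1 - p) / (s * (p - 1)) * norm x"
      proof (rule norm_fc_le)
        show "continuous_on {0..1} (\<lambda>r. g b r - c * r powr s)"
          using contg b by (intro continuous_intros cs) simp
        fix r :: real assume r: "0 \<le> r" "r \<le> 1"
        show "\<bar>g b r - c * r powr s\<bar> \<le> (b powr s) powr (1 - p) / (s * (p - 1))"
        proof (cases "r = 0")
          case False
          define w where "w = (b / r) powr s"
          have w: "w > 0" using b r False by (simp add: w_def)
          have "c * r powr s - g b r = r powr s / s * (K - k w)"
            using s by (simp add: c_def g_def w_def field_simps)
          moreover have "0 \<le> K - k w" "K - k w \<le> w powr (1 - p) / (p - 1)"
            using kK[of w] Kk[of w] w by simp_all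
          moreover have "0 \<le> r powr s / s" using s by simp
          ultimately have "0 \<le> c * r powr s - g b r"
              "c * r powr s - g b r \<le> r powr s / s * (w powr (1 - p) / (p - 1))"
            by (metis mult_nonneg_nonneg, metis mult_left_mono)
          then have "\<bar>g b r - c * r powr s\<bar> \<le> r powr s / s * (w powr (1 - p) / (p - 1))" by linarith
          also have "\<dots> = (r powr s * w powr (1 - p)) / (s * (p - 1))" by simp
          \<comment> \<open>Because \<open>p = 1 / s\<close>, the powers of \<open>r\<close>
            collapse to \<open>r\<close> itself, which is at most 1: the error is uniform in the
            spectral parameter.\<close>
          also have "r powr s * w powr (1 - p) = r * (b powr s) powr (1 - p)"
          proof -
            have "w = b powr s / r powr s" using b r False by (simp add: w_def powr_divide)
            then have "w powr (1 - p) = (b powr s) powr (1 - p) / (r powr s) powr (1 - p)"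
              using b r False by (simp add: powr_divide)
            moreover have "(r powr s) powr (1 - p) = r powr s / r"
              using r False by (simp add: powr_diff ps)
            ultimately show ?thesis using r False by simp
          qed
          also have "\<dots> \<le> 1 * (b powr s) powr (1 - p)" using r by (intro mult_right_mono) auto
          finally show ?thesis using s p by (simp add: divide_right_mono)
        qed (use s p in \<open>simp add: g_def\<close>)
      qed
      finally show ?thesis .
    qed
    have lim0: "((\<lambda>b. (b powr s) powr (1 - p) / (s * (p - 1)) * norm x) \<longlongrightarrow> 0) at_top"
    proof -
      have "((\<lambda>b. b powr (s * (1 - p))) \<longlongrightarrow> 0) at_top"
        using s p by (intro tendsto_neg_powr filterlim_ident) (simp add: mult_pos_neg)
      then show ?thesis by (simp add: powr_powr tendsto_mult_left_zero tendsto_divide_zero)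
    qed
    \<comment> \<open>\<open>has_integral_alt\<close> treats boxes separately, so the half line has
      to be recognised as not being one.\<close>
    have notbox: "\<not> (\<exists>a b :: real. {0<..} = cbox a b)"
    proof
      assume "\<exists>a b :: real. {0<..} = cbox a b"
      then obtain a b :: real where "{0<..} = cbox a b" by blast
      then have "\<bar>b\<bar> + 1 \<in> {a..b}" by (metis abs_ge_zero add_nonneg_pos cbox_interval greaterThan_iff zero_less_one)
      then show False by auto
    qed
    have "\<forall>e>0. \<exists>B>0. \<forall>a b. ball 0 B \<subseteq> cbox a b \<longrightarrow>
        (\<exists>z. ((\<lambda>t. if t \<in> {0<..} then f t else 0) has_integral z) (cbox a b) \<and>
          norm (z - c *\<^sub>R fc (\<lambda>r. r powr s) x) < e)"
    proof (intro allI impI)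
      fix e :: real assume "e > 0"
      then have "\<forall>\<^sub>F b in at_top. (b powr s) powr (1 - p) / (s * (p - 1)) * norm x < e"
        using lim0 by (intro order_tendstoD(2))
      then obtain B0 where B0: "\<And>b. b \<ge> B0 \<Longrightarrow> (b powr s) powr (1 - p) / (s * (p - 1)) * norm x < e"
        unfolding eventually_at_top_linorder by blast
      define B where "B = max B0 1"
      show "\<exists>B>0. \<forall>a b. ball 0 B \<subseteq> cbox a b \<longrightarrow>
          (\<exists>z. ((\<lambda>t. if t \<in> {0<..} then f t else 0) has_integral z) (cbox a b) \<and>
            norm (z - c *\<^sub>R fc (\<lambda>r. r powr s) x) < e)"
      proof (intro exI[of _ B] conjI allI impI)
        show "B > 0" by (simp add: B_def)
        fix a b :: real assume sub: "ball 0 B \<subseteq> cbox a b"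
        have "closure (ball 0 B) \<subseteq> cbox a b" using sub by (rule closure_minimal[OF _ closed_cbox])
        then have "cball 0 B \<subseteq> {a..b}" using \<open>B > 0\<close> by simp
        moreover have "B \<in> cball 0 B" "- B \<in> cball 0 B" using \<open>B > 0\<close> by auto
        ultimately have "B \<in> {a..b}" "- B \<in> {a..b}" by blast+
        then have "B \<le> b" "a \<le> - B" by simp_all
        then have ab: "a \<le> 0" "b > 0" "b \<ge> B0" by (auto simp: B_def)
        have "norm (G b - c *\<^sub>R fc (\<lambda>r. r powr s) x) < e"
          using Glim[OF ab(2)] B0[OF ab(3)] by linarith
        then show "\<exists>z. ((\<lambda>t. if t \<in> {0<..} then f t else 0) has_integral z) (cbox a b) \<and>
            norm (z - c *\<^sub>R fc (\<lambda>r. r powr s) x) < e"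
          using Gint'[of a b] ab by (intro exI[of _ "G b"]) simp
      qed
    qed
    then have "(f has_integral c *\<^sub>R fc (\<lambda>r. r powr s) x) {0<..}"
      by (subst has_integral_alt) (simp only: notbox if_False)
    then show ?thesis by (simp add: f_def[abs_def])
  qed
  moreover have "c > 0" using K s by (simp add: c_def)
  moreover have "c = pi" if "s = 1/2"
  proof -
    have "K = pi / 2" using K(2) that by (simp add: p_def)
    then show ?thesis by (simp add: c_def that)
  qed
  ultimately show ?thesis by blast
qed

text \<open>For exponents other than 1/2 only the positivity of the factor is recorded: such powers
  enter through estimates, while the square root must be exact.\<close>

lemma fpow01_eq:
  assumes s: "0 < s" "s < 1"
  shows "\<exists>\<kappa>>0. (s = 1/2 \<longrightarrow> \<kappa> = 1) \<and> (\<forall>x. fpow01 R s x = \<kappa> *\<^sub>R fc (\<lambda>r. r powr s) x)"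
proof -
  obtain c where c: "c > 0" "s = 1/2 \<longrightarrow> c = pi"
    "\<And>x. ((\<lambda>t. t powr (s - 1) *\<^sub>R R (shifted_inv R t x)) has_integral c *\<^sub>R fc (\<lambda>r. r powr s) x) {0<..}"
    using has_integral_fractional_power[OF s] by blast
  have "sin (pi * s) > 0" using s by (intro sin_gt_zero) simp_all
  moreover have "sin (pi * s) = 1" if "s = 1/2" unfolding that by simp
  ultimately show ?thesis using c(1,2)
    by (intro exI[of _ "sin (pi * s) / pi * c"]) (auto simp: fpow01_def integral_unique[OF c(3)])
qed

end

subsection \<open>Compact solutions of a Sylvester equation\<close>

lemma sum_telescope_le:
  fixes f :: "nat \<Rightarrow> 'a::real_normed_vector"
  assumes "N \<le> M"
  shows "norm (f N) \<le> norm (f M) + (\<Sum>n\<in>{N..<M}. norm (f n - f (Suc n)))"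
  using assms
proof (induction M rule: dec_induct)
  case (step M)
  have "norm (f M) \<le> norm (f (Suc M)) + norm (f M - f (Suc M))"
    using norm_triangle_ineq[of "f (Suc M)" "f M - f (Suc M)"] by simp
  then show ?case using step by (simp add: sum.atLeastLessThan_Suc)
qed simp

text \<open>Let q = (1 - u) / (1 + u). Then q <= (1 + u)^(-2), and Bernoulli's inequality gives q^n
  <= (1 + n u)^(-2). Each of the two factors 1 / (1 + n u) can absorb one factor u at the price of
  1/n.\<close>

lemma cayley_power_le:
  fixes u :: real
  assumes u: "0 \<le> u" "u \<le> 1" and n: "n \<ge> 1"
  shows "u * ((1 - u) / (1 + u)) ^ n \<le> 1 / real n" "u * (u * ((1 - u) / (1 + u)) ^ n) \<le> 1 / (real n)\<^sup>2"
proof -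
  have pos: "1 + real n * u > 0" using u by (simp add: add_pos_nonneg)
  have "(1 - u) * (1 + u) \<le> 1" using u by (simp add: algebra_simps)
  then have "(1 - u) / (1 + u) \<le> 1 / (1 + u)\<^sup>2"
    using u by (simp add: divide_simps power2_eq_square)
  then have "((1 - u) / (1 + u)) ^ n \<le> (1 / (1 + u)\<^sup>2) ^ n"
    using u by (intro power_mono) simp_all
  also have "\<dots> = 1 / ((1 + u) ^ n)\<^sup>2" by (simp add: power_divide power_mult[symmetric] mult.commute)
  also have "\<dots> \<le> 1 / (1 + real n * u)\<^sup>2"
    using u pos Bernoulli_inequality[of u n] by (intro divide_left_mono power_mono) simp_all
  finally have q: "((1 - u) / (1 + u)) ^ n \<le> 1 / (1 + real n * u)\<^sup>2" .
  have "real n * u \<le> 1 + real n * u" by simp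
  then have v: "u / (1 + real n * u) \<le> 1 / real n" using n pos by (simp add: divide_simps mult.commute)
  have v0: "0 \<le> u / (1 + real n * u)" using u pos by simp
  have "u * (u * ((1 - u) / (1 + u)) ^ n) \<le> u * (u * (1 / (1 + real n * u)\<^sup>2))"
    using u q by (intro mult_left_mono) simp_all
  also have "\<dots> = (u / (1 + real n * u))\<^sup>2" by (simp add: power2_eq_square)
  also have "\<dots> \<le> (1 / real n)\<^sup>2" using v v0 by (rule power_mono)
  finally show "u * (u * ((1 - u) / (1 + u)) ^ n) \<le> 1 / (real n)\<^sup>2" by (simp add: power_divide)
  have "u * ((1 - u) / (1 + u)) ^ n \<le> u * (1 / (1 + real n * u)\<^sup>2)"
    using u q by (intro mult_left_mono) simp_all
  also have "\<dots> = u / (1 + real n * u) * (1 / (1 + real n * u))" by (simp add: power2_eq_square)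
  also have "\<dots> \<le> u / (1 + real n * u) * 1" using v0 u pos by (intro mult_left_mono) (simp_all add: divide_le_eq)
  finally show "u * ((1 - u) / (1 + u)) ^ n \<le> 1 / real n" using v by simp
qed

text \<open>Injectivity makes \<open>range S\<close> dense, hence the Cayley powers tend to 0
  strongly. It also lets identities be checked after applying \<open>S\<close>.\<close>

locale inj_pos_contraction = pos_contraction +
  assumes inj: "R x = 0 \<Longrightarrow> x = 0"
begin

definition S :: "'a \<Rightarrow> 'a" where "S = fc sqrt"

text \<open>The \<open>n\<close>-th power of the Cayley transform \<open>(1 - S) (1 + S)\<^sup>-\<^sup>1\<close>.\<close>
definition cay :: "nat \<Rightarrow> 'a \<Rightarrow> 'a" where
  "cay n = fc (\<lambda>r. ((1 - sqrt r) / (1 + sqrt r)) ^ n)"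

definition P :: "'a \<Rightarrow> 'a" where "P = fc (\<lambda>r. 1 / (1 + sqrt r))"

lemma one_plus_sqrt_pos: "0 \<le> r \<Longrightarrow> 1 + sqrt r > 0"
  using real_sqrt_ge_zero[of r] by linarith

lemma one_plus_sqrt_neq_0: "r \<in> {0..1} \<Longrightarrow> 1 + sqrt r \<noteq> 0"
  using one_plus_sqrt_pos[of r] by auto

lemma cont_sqrt: "continuous_on {0..1} sqrt" by (intro continuous_intros)
lemma cont_cay: "continuous_on {0..1} (\<lambda>r. ((1 - sqrt r) / (1 + sqrt r)) ^ n)"
  by (intro continuous_intros) (use one_plus_sqrt_neq_0 in auto)
lemma cont_P: "continuous_on {0..1} (\<lambda>r. 1 / (1 + sqrt r))"
  by (intro continuous_intros) (use one_plus_sqrt_neq_0 in auto)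

lemma S_S: "S (S x) = R x"
proof -
  have "S (S x) = fc (\<lambda>r. sqrt r * sqrt r) x" by (simp only: S_def fc_mult[OF cont_sqrt cont_sqrt])
  also have "\<dots> = fc (\<lambda>r. r) x" by (rule fc_cong) simp
  finally show ?thesis by (simp add: fc_ident)
qed

lemma S_bounded_linear: "bounded_linear S" unfolding S_def by (rule fc_bounded_linear[OF cont_sqrt])
lemma P_bounded_linear: "bounded_linear P" unfolding P_def by (rule fc_bounded_linear[OF cont_P])
lemma cay_bounded_linear: "bounded_linear (cay n)" unfolding cay_def by (rule fc_bounded_linear[OF cont_cay])

sublocale S: bounded_linear S by (rule S_bounded_linear)
sublocale P: bounded_linear P by (rule P_bounded_linear)
sublocale cay: bounded_linear "cay n" for n by (rule cay_bounded_linear)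

lemma S_sym: "inner (S x) y = inner x (S y)" unfolding S_def by (rule fc_sym[OF cont_sqrt])
lemma cay_sym: "inner (cay n x) y = inner x (cay n y)" unfolding cay_def by (rule fc_sym[OF cont_cay])

lemma S_inj: "S x = 0 \<Longrightarrow> x = 0"
  using S_S[of x] inj[of x] by (simp add: S.zero)

lemma norm_P_le: "norm (P x) \<le> norm x"
proof -
  have "norm (P x) \<le> 1 * norm x" unfolding P_def
  proof (rule norm_fc_le[OF cont_P])
    fix r :: real assume "0 \<le> r"
    then show "\<bar>1 / (1 + sqrt r)\<bar> \<le> 1" by (simp add: abs_of_pos one_plus_sqrt_pos divide_le_eq)
  qed
  then show ?thesis by simp
qed

lemma cayley_abs_le_1:
  assumes "0 \<le> r" "r \<le> 1"
  shows "\<bar>((1 - sqrt r) / (1 + sqrt r)) ^ n\<bar> \<le> 1"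
proof -
  have "sqrt r \<le> 1" "0 \<le> sqrt r" using assms by simp_all
  then have "0 \<le> (1 - sqrt r) / (1 + sqrt r)" "(1 - sqrt r) / (1 + sqrt r) \<le> 1"
    using one_plus_sqrt_pos[OF assms(1)] by (simp_all add: divide_le_eq)
  then show ?thesis by (simp add: power_le_one)
qed

lemma norm_cay_le: "norm (cay n x) \<le> norm x"
  using norm_fc_le[OF cont_cay cayley_abs_le_1, of n x] by (simp add: cay_def)

lemma norm_S_cay_le:
  assumes "n \<ge> 1"
  shows "norm (S (cay n x)) \<le> 1 / real n * norm x"
proof -
  have "S (cay n x) = fc (\<lambda>r. sqrt r * ((1 - sqrt r) / (1 + sqrt r)) ^ n) x"
    unfolding S_def cay_def by (rule fc_mult[OF cont_sqrt cont_cay, symmetric])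
  also have "norm \<dots> \<le> 1 / real n * norm x"
  proof (rule norm_fc_le)
    show "continuous_on {0..1} (\<lambda>r. sqrt r * ((1 - sqrt r) / (1 + sqrt r)) ^ n)"
      by (rule continuous_on_mult[OF cont_sqrt cont_cay])
    fix r :: real assume "0 \<le> r" "r \<le> 1"
    then show "\<bar>sqrt r * ((1 - sqrt r) / (1 + sqrt r)) ^ n\<bar> \<le> 1 / real n"
      using cayley_power_le(1)[of "sqrt r" n] assms by simp
  qed
  finally show ?thesis .
qed

lemma norm_S_S_cay_le:
  assumes "n \<ge> 1"
  shows "norm (S (S (cay n x))) \<le> 1 / (real n)\<^sup>2 * norm x"
proof -
  have c: "continuous_on {0..1} (\<lambda>r. sqrt r * ((1 - sqrt r) / (1 + sqrt r)) ^ n)"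
    by (rule continuous_on_mult[OF cont_sqrt cont_cay])
  have "S (S (cay n x)) = fc (\<lambda>r. sqrt r * (sqrt r * ((1 - sqrt r) / (1 + sqrt r)) ^ n)) x"
    unfolding S_def cay_def by (simp only: fc_mult[OF cont_sqrt cont_cay] fc_mult[OF cont_sqrt c])
  also have "norm \<dots> \<le> 1 / (real n)\<^sup>2 * norm x"
  proof (rule norm_fc_le)
    show "continuous_on {0..1} (\<lambda>r. sqrt r * (sqrt r * ((1 - sqrt r) / (1 + sqrt r)) ^ n))"
      by (rule continuous_on_mult[OF cont_sqrt c])
    fix r :: real assume r: "0 \<le> r" "r \<le> 1"
    then have "0 \<le> sqrt r * (sqrt r * ((1 - sqrt r) / (1 + sqrt r)) ^ n)" by simp
    then show "\<bar>sqrt r * (sqrt r * ((1 - sqrt r) / (1 + sqrt r)) ^ n)\<bar> \<le> 1 / (real n)\<^sup>2"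
      using cayley_power_le(2)[of "sqrt r" n] assms r by (simp only: abs_of_nonneg) simp
  qed
  finally show ?thesis .
qed

lemma S_cay: "S (cay n x) = cay n (S x)"
  unfolding S_def cay_def
  by (simp only: fc_mult[OF cont_sqrt cont_cay, symmetric] fc_mult[OF cont_cay cont_sqrt, symmetric] mult.commute)

lemma P_cay: "P (cay n x) = cay n (P x)"
  unfolding P_def cay_def
  by (simp only: fc_mult[OF cont_P cont_cay, symmetric] fc_mult[OF cont_cay cont_P, symmetric] mult.commute)

lemma S_P: "S (P x) = P (S x)"
  unfolding S_def P_def
  by (simp only: fc_mult[OF cont_sqrt cont_P, symmetric] fc_mult[OF cont_P cont_sqrt, symmetric] mult.commute)

lemma cay_0: "cay 0 x = x" unfolding cay_def by (simp add: fc_const)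

lemma cay_Suc: "cay (Suc n) x = cay n (cay 1 x)"
proof -
  have "cay (Suc n) x = fc (\<lambda>r. ((1 - sqrt r) / (1 + sqrt r)) ^ n * ((1 - sqrt r) / (1 + sqrt r)) ^ 1) x"
    unfolding cay_def by (simp only: power_Suc2 power_one_right)
  then show ?thesis by (simp only: cay_def fc_mult[OF cont_cay cont_cay])
qed

lemma P_plus_S_P: "P x + S (P x) = x"
proof -
  have c: "continuous_on {0..1} (\<lambda>r. sqrt r * (1 / (1 + sqrt r)))"
    by (rule continuous_on_mult[OF cont_sqrt cont_P])
  have "P x + S (P x) = fc (\<lambda>r. 1 / (1 + sqrt r) + sqrt r * (1 / (1 + sqrt r))) x"
    unfolding P_def S_def by (simp only: fc_mult[OF cont_sqrt cont_P] fc_add[OF cont_P c])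
  also have "\<dots> = fc (\<lambda>r. 1) x"
  proof (rule fc_cong)
    fix r :: real assume "0 \<le> r" "r \<le> 1"
    then have "1 + sqrt r \<noteq> 0" using one_plus_sqrt_neq_0 by simp
    then show "1 / (1 + sqrt r) + sqrt r * (1 / (1 + sqrt r)) = 1"
      by (simp add: add_divide_distrib[symmetric])
  qed
  finally show ?thesis by (simp add: fc_const)
qed

lemma cay_1: "cay 1 x = P x - S (P x)"
proof -
  have c: "continuous_on {0..1} (\<lambda>r. sqrt r * (1 / (1 + sqrt r)))"
    by (rule continuous_on_mult[OF cont_sqrt cont_P])
  have "P x - S (P x) = fc (\<lambda>r. 1 / (1 + sqrt r) - sqrt r * (1 / (1 + sqrt r))) x"
    unfolding P_def S_def by (simp only: fc_mult[OF cont_sqrt cont_P] fc_diff[OF cont_P c])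
  also have "\<dots> = cay 1 x" unfolding cay_def
    by (rule fc_cong) (simp add: diff_divide_distrib)
  finally show ?thesis ..
qed

lemma range_S_dense: "closure (range S) = UNIV"
proof (rule dense_subspace_if_orthogonal_trivial)
  show "subspace (range S)" by (rule linear_subspace_image[OF S.linear]) simp
  fix x assume "\<And>w. w \<in> range S \<Longrightarrow> inner x w = 0"
  then have "inner (S x) (S x) = 0" by (simp add: S_sym)
  then show "x = 0" using S_inj by simp
qed

text \<open>On \<open>range S\<close> there is the rate 1/n; contractivity carries the convergence
  to the closure, without a rate.\<close>

lemma cay_tendsto_0: "(\<lambda>n. cay n x) \<longlonglongrightarrow> 0"
proof (rule LIMSEQ_I)
  fix e :: real assume e: "e > 0"
  have "x \<in> closure (range S)" using range_S_dense by simp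
  then obtain w where w: "norm (S w - x) < e / 2"
    using e unfolding closure_approachable dist_norm by (metis half_gt_zero rangeE)
  obtain N where N: "real N > 2 * norm w / e" using reals_Archimedean2 by blast
  have "norm (cay n x - 0) < e" if n: "n \<ge> Suc N" for n
  proof -
    have "real n > 0" "real n > 2 * norm w / e" using n N by simp_all
    then have "1 / real n * norm w < e / 2" using e by (simp add: field_simps)
    moreover have "norm (cay n (S w)) \<le> 1 / real n * norm w"
      using norm_S_cay_le[of n w] n by (simp add: S_cay)
    moreover have "norm (cay n (S w - x)) \<le> norm (S w - x)" by (rule norm_cay_le)
    moreover have eq: "cay n x = cay n (S w) - cay n (S w - x)" by (simp add: cay.diff)
    moreover have "norm (cay n (S w) - cay n (S w - x)) \<le> norm (cay n (S w)) + norm (cay n (S w - x))"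
      by (rule norm_triangle_ineq4)
    ultimately have "norm (cay n (S w) - cay n (S w - x)) < e" using w by linarith
    then show ?thesis by (simp only: eq[symmetric] diff_zero)
  qed
  then show "\<exists>N. \<forall>n\<ge>N. norm (cay n x - 0) < e" by blast
qed

text \<open>An exponent below -1 is what makes the series for \<open>Z\<close> summable in norm.
  \<open>P\<close> does not appear because it commutes with \<open>cay n\<close> and is a
  contraction.\<close>

definition cayley_decay :: "('a \<Rightarrow> 'a) \<Rightarrow> bool" where
  "cayley_decay G \<longleftrightarrow> (\<exists>c\<ge>0. \<exists>d>0. \<forall>n\<ge>1. \<forall>x.
    norm (cay n (G (cay n x))) \<le> c * real n powr (- 1 - d) * norm x)"

lemma cayley_decay_add:
  assumes "cayley_decay G" "cayley_decay H"
  shows "cayley_decay (\<lambda>x. G x + H x)"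
proof -
  obtain c d where c: "c \<ge> 0" "d > 0"
    "\<And>n x. n \<ge> 1 \<Longrightarrow> norm (cay n (G (cay n x))) \<le> c * real n powr (- 1 - d) * norm x"
    using assms(1) unfolding cayley_decay_def by blast
  obtain c' d' where c': "c' \<ge> 0" "d' > 0"
    "\<And>n x. n \<ge> 1 \<Longrightarrow> norm (cay n (H (cay n x))) \<le> c' * real n powr (- 1 - d') * norm x"
    using assms(2) unfolding cayley_decay_def by blast
  have "norm (cay n (G (cay n x) + H (cay n x))) \<le> (c + c') * real n powr (- 1 - min d d') * norm x"
    if n: "n \<ge> 1" for n x
  proof -
    have "norm (cay n (G (cay n x) + H (cay n x)))
        \<le> c * real n powr (- 1 - d) * norm x + c' * real n powr (- 1 - d') * norm x"
      unfolding cay.add by (intro norm_triangle_mono c c' n)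
    also have "\<dots> \<le> c * real n powr (- 1 - min d d') * norm x + c' * real n powr (- 1 - min d d') * norm x"
      using n c c' by (intro add_mono mult_right_mono mult_left_mono powr_mono) simp_all
    finally show ?thesis by (simp add: algebra_simps)
  qed
  then show ?thesis using c c' unfolding cayley_decay_def
    by (intro exI[of _ "c + c'"] conjI exI[of _ "min d d'"]) auto
qed

lemma cayley_decay_uminus: "cayley_decay G \<Longrightarrow> cayley_decay (\<lambda>x. - G x)"
  by (simp add: cayley_decay_def cay.neg)

lemma cayley_decay_diff: "cayley_decay G \<Longrightarrow> cayley_decay H \<Longrightarrow> cayley_decay (\<lambda>x. G x - H x)"
  using cayley_decay_add[of G "\<lambda>x. - H x"] cayley_decay_uminus[of H] by simp

theorem compact_solution_of_sylvester:
  assumes Z: "bounded_linear Z" and eq: "\<And>x. S (Z x) + Z (S x) = G x"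
    and G: "compact_op G" and decay: "cayley_decay G"
  shows "compact_op Z"
proof (rule compact_op_limit)
  interpret Z: bounded_linear Z by fact
  show "linear Z" by (rule Z.linear)
  fix e :: real assume e: "e > 0"
  obtain c d where c: "c \<ge> 0" "d > 0"
    "\<And>n x. n \<ge> 1 \<Longrightarrow> norm (cay n (G (cay n x))) \<le> c * real n powr (- 1 - d) * norm x"
    using decay unfolding cayley_decay_def by blast
  obtain B where B: "B > 0" "\<And>x. norm (Z x) \<le> B * norm x" using bounded_linear_bound[OF Z] by blast
  \<comment> \<open>Since \<open>(1 + S) P = 1\<close> and \<open>(1 - S) P = C\<close>, the
    left-hand side is \<open>P ((1 + S) Z (1 + S) - (1 - S) Z (1 - S)) P\<close>, in which the terms
    \<open>Z\<close> and \<open>S Z S\<close> cancel.\<close>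
  have step1: "Z y - cay 1 (Z (cay 1 y)) = 2 *\<^sub>R P (G (P y))" for y
  proof -
    define p where "p = P y"
    define q where "q = Z p"
    have y: "y = p + S p" using P_plus_S_P[of y] by (simp add: p_def)
    have id: "v = P v + S (P v)" for v by (rule P_plus_S_P[symmetric])
    have "Z y = P (Z y + S (Z y))" using P_plus_S_P[of "Z y"] by (simp add: P.add S_P)
    also have "\<dots> = P (Z (p + S p) + S (Z (p + S p)))" using y by simp
    finally have 1: "Z y = P (Z p + Z (S p) + (S (Z p) + S (Z (S p))))" by (simp add: S.add Z.add)
    have "cay 1 (Z (cay 1 y)) = P (Z (p - S p) - S (Z (p - S p)))"
      by (simp only: cay_1 P.diff S_P p_def)
    then have 2: "cay 1 (Z (cay 1 y)) = P (Z p - Z (S p) - (S (Z p) - S (Z (S p))))"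
      by (simp add: Z.diff S.diff)
    have "Z y - cay 1 (Z (cay 1 y)) = P (2 *\<^sub>R (S (Z p) + Z (S p)))"
      unfolding 1 2 P.diff[symmetric] by (simp add: algebra_simps scaleR_2)
    then show ?thesis by (simp add: eq P.scaleR p_def)
  qed
  define f where "f x n = cay n (Z (cay n x))" for x n
  define T where "T n x = 2 *\<^sub>R P (cay n (G (cay n (P x))))" for n x
  have cay_Suc': "cay (Suc n) x = cay 1 (cay n x)" for n x
  proof (induction n arbitrary: x)
    case 0
    then show ?case by (simp add: cay_0)
  next
    case (Suc n)
    then show ?case by (metis cay_Suc)
  qed
  have step: "f x n - f x (Suc n) = T n x" for x n
  proof -
    have "f x (Suc n) = cay n (cay 1 (Z (cay 1 (cay n x))))" by (metis f_def cay_Suc cay_Suc')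
    then have "f x n - f x (Suc n) = cay n (Z (cay n x) - cay 1 (Z (cay 1 (cay n x))))"
      by (simp add: f_def cay.diff)
    then show ?thesis by (simp only: step1 T_def cay.scaleR P_cay)
  qed
  have T_le: "norm (T n x) \<le> 2 * c * real n powr (- 1 - d) * norm x" if n: "n \<ge> 1" for n x
  proof -
    have "norm (T n x) \<le> 2 * norm (cay n (G (cay n (P x))))"
      by (simp add: T_def norm_P_le)
    also have "\<dots> \<le> 2 * (c * real n powr (- 1 - d) * norm (P x))" using c(3)[OF n] by simp
    also have "\<dots> \<le> 2 * (c * real n powr (- 1 - d) * norm x)"
      using c(1) by (intro mult_left_mono norm_P_le) simp_all
    finally show ?thesis by simp
  qed
  define a where "a n = 2 * c * real n powr (- 1 - d)" for n
  have a0: "a n \<ge> 0" for n using c by (simp add: a_def)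
  have sa: "summable a" unfolding a_def
    using c(2) by (intro summable_mult) (simp add: summable_real_powr_iff)
  obtain N0 where N0: "\<And>n. n \<ge> N0 \<Longrightarrow> norm (\<Sum>i. a (i + n)) < e"
    using suminf_exist_split[OF e sa] by blast
  \<comment> \<open>The shift by one keeps \<open>n = 0\<close>, for which \<open>T_le\<close> makes
    no claim, out of the tail.\<close>
  define N where "N = Suc N0"
  have N: "N \<ge> 1" "norm (\<Sum>i. a (i + N)) < e" using N0[of N] by (simp_all add: N_def)
  have small: "norm (f x N) \<le> e * norm x" for x
  proof -
    \<comment> \<open>Telescoping up to \<open>M\<close> leaves the boundary term
      \<open>f x M\<close>. It vanishes in the limit for each fixed \<open>x\<close> only, yet the
      resulting bound on \<open>f x N\<close> is uniform on bounded sets.\<close>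
    have bound: "norm (f x N) \<le> B * norm (cay M x) + e * norm x" if M: "M \<ge> N" for M
    proof -
      have "(\<Sum>n\<in>{N..<M}. norm (f x n - f x (Suc n))) \<le> (\<Sum>n\<in>{N..<M}. a n * norm x)"
        unfolding step a_def using N(1) by (intro sum_mono T_le) simp
      also have "\<dots> = (\<Sum>i<M - N. a (i + N)) * norm x"
        using M by (simp add: sum_distrib_right sum.nat_group[symmetric])
          (rule sum.reindex_bij_witness[where i = "\<lambda>i. i + N" and j = "\<lambda>n. n - N"], auto)
      also have "\<dots> \<le> (\<Sum>i. a (i + N)) * norm x"
        using sa a0 by (intro mult_right_mono sum_le_suminf) (simp_all add: summable_iff_shift)
      also have "\<dots> \<le> e * norm x" using N(2) by (intro mult_right_mono) simp_all
      finally have "norm (f x N) \<le> norm (f x M) + e * norm x"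
        using sum_telescope_le[OF M, of "f x"] by linarith
      moreover have "norm (f x M) \<le> B * norm (cay M x)"
        unfolding f_def by (rule order_trans[OF norm_cay_le B(2)])
      ultimately show ?thesis by linarith
    qed
    have "(\<lambda>M. B * norm (cay M x) + e * norm x) \<longlonglongrightarrow> B * norm (0::'a) + e * norm x"
      by (intro tendsto_intros cay_tendsto_0)
    then show ?thesis using LIMSEQ_le_const[of _ "B * norm (0::'a) + e * norm x" "norm (f x N)"] bound
      by auto
  qed
  have "Z x - (\<Sum>n<N. T n x) = f x N" for x
  proof -
    have "(\<Sum>n<N. T n x) = f x 0 - f x N"
      unfolding step[symmetric] by (rule sum_lessThan_telescope')
    then show ?thesis by (simp add: f_def cay_0)
  qed
  moreover have "compact_op (\<lambda>x. \<Sum>n<N. T n x)"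
    unfolding T_def
    by (intro compact_op_sum compact_op_scaleR compact_op_compose_left[OF _ P_bounded_linear]
        compact_op_compose_left[OF _ cay_bounded_linear]
        compact_op_compose_right[OF compact_op_compose_right[OF G cay_bounded_linear] P_bounded_linear])
  ultimately show "\<exists>B. compact_op B \<and> (\<forall>x. norm (Z x - B x) \<le> e * norm x)"
    using small by (intro exI[of _ "\<lambda>x. \<Sum>n<N. T n x"]) simp
qed

text \<open>This is how the condition of higher order enters: \<open>K = [D, a] S\<close> is bounded relative to a positive
  power of \<open>S\<close>, stated through the interpolation inequality to avoid fractional powers.\<close>
definition sub_order :: "('a \<Rightarrow> 'a) \<Rightarrow> bool" where
  "sub_order K \<longleftrightarrow> (\<exists>A\<ge>0. \<exists>d. 0 < d \<and> d \<le> 1 \<and>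
    (\<forall>w. norm (K w) \<le> A * (norm (S w) powr d * norm w powr (1 - d))))"

text \<open>The interpolation inequality is fed with the rates 1/n and 1 in the first case, which
  gives n^(-d), and with 1/n^2 and 1/n in the second, which gives n^(-1-d).\<close>

lemma sub_order_cay:
  assumes "sub_order K"
  shows "\<exists>A\<ge>0. \<exists>d>0. \<forall>n\<ge>1. \<forall>w. norm (K (cay n w)) \<le> A * real n powr (- d) * norm w \<and>
    norm (K (S (cay n w))) \<le> A * real n powr (- 1 - d) * norm w"
proof -
  obtain A d where A: "A \<ge> 0" "0 < d" "d \<le> 1"
    "\<And>w. norm (K w) \<le> A * (norm (S w) powr d * norm w powr (1 - d))"
    using assms unfolding sub_order_def by blast
  have "norm (K (cay n w)) \<le> A * real n powr (- d) * norm w"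
    "norm (K (S (cay n w))) \<le> A * real n powr (- 1 - d) * norm w" if n: "n \<ge> 1" for n w
  proof -
    have "norm (K (cay n w)) \<le> A * (norm (S (cay n w)) powr d * norm (cay n w) powr (1 - d))" by (rule A)
    also have "\<dots> \<le> A * ((1 / real n * norm w) powr d * norm w powr (1 - d))"
      using A n by (intro mult_left_mono mult_mono powr_mono2 norm_S_cay_le norm_cay_le) simp_all
    also have "\<dots> = A * (real n powr (- d) * (norm w powr d * norm w powr (1 - d)))"
      by (simp add: powr_mult powr_divide powr_minus_divide)
    also have "norm w powr d * norm w powr (1 - d) = norm w" by (simp add: powr_add[symmetric])
    finally show "norm (K (cay n w)) \<le> A * real n powr (- d) * norm w" by simp
    have "norm (K (S (cay n w))) \<le> A * (norm (S (S (cay n w))) powr d * norm (S (cay n w)) powr (1 - d))" by (rule A)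
    also have "\<dots> \<le> A * ((1 / (real n)\<^sup>2 * norm w) powr d * (1 / real n * norm w) powr (1 - d))"
      using A n by (intro mult_left_mono mult_mono powr_mono2 norm_S_cay_le norm_S_S_cay_le) simp_all
    also have "\<dots> = A * ((real n powr (- 2 * d) * real n powr (d - 1)) * (norm w powr d * norm w powr (1 - d)))"
    proof -
      have "(1 / (real n)\<^sup>2) powr d = real n powr (- 2 * d)"
        using n by (simp add: powr_divide powr_minus_divide powr_powr flip: powr_numeral)
      moreover have "(1 / real n) powr (1 - d) = real n powr (d - 1)"
        using n by (simp add: powr_divide powr_minus_divide[of _ "1 - d", symmetric])
      moreover have "(1 / (real n)\<^sup>2 * norm w) powr d = (1 / (real n)\<^sup>2) powr d * norm w powr d"
        "(1 / real n * norm w) powr (1 - d) = (1 / real n) powr (1 - d) * norm w powr (1 - d)"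
        by (rule powr_mult; simp)+
      ultimately show ?thesis by simp
    qed
    also have "norm w powr d * norm w powr (1 - d) = norm w" by (simp add: powr_add[symmetric])
    also have "real n powr (- 2 * d) * real n powr (d - 1) = real n powr (- 1 - d)"
      by (simp add: powr_add[symmetric] minus_diff_commute)
    finally show "norm (K (S (cay n w))) \<le> A * real n powr (- 1 - d) * norm w" by simp
  qed
  then show ?thesis using A by blast
qed

lemma cayley_decay_mult_S_right:
  assumes K: "sub_order K" and B: "bounded_linear B"
  shows "cayley_decay (\<lambda>x. B (K (S x)))"
proof -
  obtain A d where A: "A \<ge> 0" "d > 0"
    "\<And>n w. n \<ge> 1 \<Longrightarrow> norm (K (S (cay n w))) \<le> A * real n powr (- 1 - d) * norm w"
    using sub_order_cay[OF K] by blast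
  obtain C where C: "C > 0" "\<And>x. norm (B x) \<le> C * norm x" using bounded_linear_bound[OF B] by blast
  have "norm (cay n (B (K (S (cay n x))))) \<le> C * A * real n powr (- 1 - d) * norm x" if "n \<ge> 1" for n x
  proof -
    have "norm (cay n (B (K (S (cay n x))))) \<le> C * norm (K (S (cay n x)))"
      by (rule order_trans[OF norm_cay_le C(2)])
    also have "\<dots> \<le> C * (A * real n powr (- 1 - d) * norm x)"
      using C(1) by (intro mult_left_mono A(3) that) simp
    finally show ?thesis by (simp add: mult.assoc)
  qed
  then show ?thesis unfolding cayley_decay_def using A C
    by (intro exI[of _ "C * A"] conjI exI[of _ d]) auto
qed

text \<open>Here \<open>K\<close> meets the right-hand \<open>cay n\<close> and yields n^(-d), while
  the missing 1/n comes from \<open>S\<close> meeting the left-hand one.\<close>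

lemma cayley_decay_mult_S_left:
  assumes K: "sub_order K" and B: "bounded_linear B"
  shows "cayley_decay (\<lambda>x. S (B (K x)))"
proof -
  obtain A d where A: "A \<ge> 0" "d > 0"
    "\<And>n w. n \<ge> 1 \<Longrightarrow> norm (K (cay n w)) \<le> A * real n powr (- d) * norm w"
    using sub_order_cay[OF K] by blast
  obtain C where C: "C > 0" "\<And>x. norm (B x) \<le> C * norm x" using bounded_linear_bound[OF B] by blast
  have "norm (cay n (S (B (K (cay n x))))) \<le> C * A * real n powr (- 1 - d) * norm x" if n: "n \<ge> 1" for n x
  proof -
    have "norm (cay n (S (B (K (cay n x))))) \<le> 1 / real n * norm (B (K (cay n x)))"
      using norm_S_cay_le[OF n] by (simp only: S_cay)
    also have "\<dots> \<le> 1 / real n * (C * (A * real n powr (- d) * norm x))"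
      using C(1) by (intro mult_left_mono order_trans[OF C(2)] A(3) n) simp_all
    also have "\<dots> = C * A * (real n powr (- d) / real n) * norm x" by simp
    also have "real n powr (- d) / real n = real n powr (- 1 - d)"
      using n powr_diff[of "real n" "- d" 1] by (simp add: minus_diff_commute)
    finally show ?thesis .
  qed
  then show ?thesis unfolding cayley_decay_def using A C
    by (intro exI[of _ "C * A"] conjI exI[of _ d]) auto
qed

lemma cayley_decay_badj:
  assumes G: "bounded_linear G" and decay: "cayley_decay G"
  shows "cayley_decay (badj G)"
proof -
  obtain c d where c: "c \<ge> 0" "d > 0"
    "\<And>n x. n \<ge> 1 \<Longrightarrow> norm (cay n (G (cay n x))) \<le> c * real n powr (- 1 - d) * norm x"
    using decay unfolding cayley_decay_def by blast
  have "norm (cay n (badj G (cay n x))) \<le> c * real n powr (- 1 - d) * norm x" if "n \<ge> 1" for n x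
  proof (rule norm_le_if_badj_le)
    show "inner (cay n (badj G (cay n x))) y = inner x (cay n (G (cay n y)))" for x y
      by (simp add: cay_sym inner_badj_left[OF G])
  qed (rule c(3)[OF that])
  then show ?thesis unfolding cayley_decay_def using c by blast
qed

end

subsection \<open>The bounded transform of a closed symmetric operator\<close>

locale closed_symmetric_op =
  fixes ci :: "'h::{real_inner,complete_space} \<Rightarrow> 'h" and dm :: "'h set" and D :: "'h \<Rightarrow> 'h"
  assumes cds: "closed_dd_symmetric ci dm D"
begin

lemma dm_subspace: "subspace dm" using cds by (simp add: closed_dd_symmetric_def)
lemma dm_add: "x \<in> dm \<Longrightarrow> y \<in> dm \<Longrightarrow> x + y \<in> dm" using dm_subspace by (rule subspace_add)
lemma dm_diff: "x \<in> dm \<Longrightarrow> y \<in> dm \<Longrightarrow> x - y \<in> dm" using dm_subspace by (rule subspace_diff)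
lemma dm_scale: "x \<in> dm \<Longrightarrow> r *\<^sub>R x \<in> dm" using dm_subspace by (rule subspace_scale)
lemma dm_0: "0 \<in> dm" using dm_subspace by (rule subspace_0)
lemma dm_dense: "closure dm = UNIV" using cds by (simp add: closed_dd_symmetric_def)
lemma dm_ci: "x \<in> dm \<Longrightarrow> ci x \<in> dm" using cds by (auto simp: closed_dd_symmetric_def)
lemma D_ci: "x \<in> dm \<Longrightarrow> D (ci x) = ci (D x)" using cds by (simp add: closed_dd_symmetric_def)
lemma D_add: "x \<in> dm \<Longrightarrow> y \<in> dm \<Longrightarrow> D (x + y) = D x + D y" using cds by (simp add: closed_dd_symmetric_def)
lemma D_scale: "x \<in> dm \<Longrightarrow> D (r *\<^sub>R x) = r *\<^sub>R D x" using cds by (simp add: closed_dd_symmetric_def)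
lemma D_sym: "x \<in> dm \<Longrightarrow> y \<in> dm \<Longrightarrow> inner (D x) y = inner x (D y)"
  using cds by (simp add: closed_dd_symmetric_def)
lemma D_0: "D 0 = 0" using D_scale[OF dm_0, of 0] by simp
lemma D_diff: "x \<in> dm \<Longrightarrow> y \<in> dm \<Longrightarrow> D (x - y) = D x - D y"
  using D_add[of x "(-1) *\<^sub>R y"] D_scale[of y "-1"] dm_scale[of y "-1"] by simp
lemma closed_graph: "closed {(x, D x) | x. x \<in> dm}" using cds by (simp add: closed_dd_symmetric_def)

lemma adj_opI:
  assumes "\<And>x. x \<in> dm \<Longrightarrow> inner (D x) y = inner x z"
  shows "y \<in> adj_dom dm D" "adj_op dm D y = z"
proof -
  show "y \<in> adj_dom dm D" using assms by (auto simp: adj_dom_def)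
  show "adj_op dm D y = z" unfolding adj_op_def
  proof (rule the_equality)
    fix z' assume z': "\<forall>x\<in>dm. inner (D x) y = inner x z'"
    have "z' - z = 0"
    proof (rule orthogonal_dense_imp_0[OF dm_dense])
      fix w assume "w \<in> dm"
      then have "inner w z' = inner w z" using z' assms by simp
      then show "inner (z' - z) w = 0" by (simp add: inner_commute[of _ w] inner_diff_right)
    qed
    then show "z' = z" by simp
  qed (use assms in blast)
qed

lemma inner_adj_op:
  assumes "y \<in> adj_dom dm D" "x \<in> dm"
  shows "inner (D x) y = inner x (adj_op dm D y)"
proof -
  obtain z where z: "\<And>x. x \<in> dm \<Longrightarrow> inner (D x) y = inner x z" using assms(1) by (auto simp: adj_dom_def)
  then show ?thesis using adj_opI(2)[OF z] assms(2) by simp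
qed

abbreviation R :: "'h \<Rightarrow> 'h" where "R \<equiv> res_op dm D"

lemma res_op_unique:
  assumes "x \<in> dm" "\<And>w. w \<in> dm \<Longrightarrow> inner (D x) (D w) = inner (y - x) w"
    and "x' \<in> dm" "\<And>w. w \<in> dm \<Longrightarrow> inner (D x') (D w) = inner (y - x') w"
  shows "x = x'"
proof -
  define w where "w = x - x'"
  have w: "w \<in> dm" unfolding w_def using assms(1,3) by (rule dm_diff)
  have "inner (D w) (D w) = - inner w w"
    using assms(2)[OF w] assms(4)[OF w] by (simp add: w_def D_diff assms(1,3) inner_diff)
  then have "inner w w = 0" using inner_ge_zero[of "D w"] inner_ge_zero[of w] by linarith
  then show ?thesis by (simp add: w_def)
qed

text \<open>The hypothesis is the weak form of \<open>x + D\<^sup>*D x = y\<close>, tested against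
  the domain of \<open>D\<close>; membership of \<open>D x\<close> in the domain of the adjoint is
  contained in it.\<close>

lemma res_op_eqI:
  assumes x: "x \<in> dm" "\<And>w. w \<in> dm \<Longrightarrow> inner (D x) (D w) = inner (y - x) w"
  shows "R y = x"
  unfolding res_op_def
proof (rule the_equality)
  have "inner (D w) (D x) = inner w (y - x)" if "w \<in> dm" for w
    using x(2)[OF that] by (simp add: inner_commute)
  note adj = adj_opI[OF this]
  show "x \<in> dm \<and> D x \<in> adj_dom dm D \<and> x + adj_op dm D (D x) = y" using x(1) adj by simp
  fix x' assume x': "x' \<in> dm \<and> D x' \<in> adj_dom dm D \<and> x' + adj_op dm D (D x') = y"
  show "x' = x"
  proof (rule res_op_unique[OF _ _ x])
    fix w assume "w \<in> dm"
    then have "inner (D w) (D x') = inner w (adj_op dm D (D x'))" using x' inner_adj_op by blast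
    moreover have "adj_op dm D (D x') = y - x'" using x' by (simp add: algebra_simps)
    ultimately show "inner (D x') (D w) = inner (y - x') w" by (simp add: inner_commute)
  qed (use x' in simp)
qed

text \<open>Von Neumann's argument: the orthogonal projection of \<open>(y, 0)\<close> onto the
  closed graph of \<open>D\<close> is a point \<open>(x, D x)\<close>, and orthogonality of the
  remainder to the graph is exactly the weak resolvent equation.\<close>

lemma res_op_props:
  shows R_in_dm: "R y \<in> dm" and inner_D_R: "w \<in> dm \<Longrightarrow> inner (D (R y)) (D w) = inner (y - R y) w"
proof -
  define V where "V = {(x, D x) | x. x \<in> dm}"
  have "closed V" unfolding V_def by (rule closed_graph)
  moreover have "subspace V" unfolding subspace_def V_def
    using dm_0 D_0 by (auto simp: dm_add D_add dm_scale D_scale zero_prod_def)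
  ultimately obtain v where v: "v \<in> V" "\<And>w. w \<in> V \<Longrightarrow> inner ((y, 0) - v) w = 0"
    using orthogonal_projection by metis
  then obtain x where x: "x \<in> dm" "v = (x, D x)" by (auto simp: V_def)
  have orth: "inner (D x) (D w) = inner (y - x) w" if "w \<in> dm" for w
  proof -
    have "(w, D w) \<in> V" using that by (auto simp: V_def)
    from v(2)[OF this] show ?thesis by (simp add: x(2) inner_prod_def)
  qed
  have "R y = x" by (rule res_op_eqI[OF x(1) orth])
  then show "R y \<in> dm" "w \<in> dm \<Longrightarrow> inner (D (R y)) (D w) = inner (y - R y) w" using x(1) orth by simp_all
qed

text \<open>In other words, \<open>R\<close> represents the inner product of the space by the graph
  inner product on the domain. This is how a pairing with an arbitrary \<open>y\<close> acquires one
  factor \<open>D\<close> on either side.\<close>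

lemma inner_R:
  "w \<in> dm \<Longrightarrow> inner w y = inner w (R y) + inner (D w) (D (R y))"
  using inner_D_R[of w y] by (simp add: inner_diff_right inner_commute)

lemma R_linear: "linear R"
proof (rule linearI)
  show "R (x + y) = R x + R y" for x y
    by (rule res_op_eqI)
      (simp_all add: R_in_dm dm_add D_add inner_add_left inner_diff_left inner_D_R)
  show "R (c *\<^sub>R x) = c *\<^sub>R R x" for c x
    by (rule res_op_eqI)
      (simp_all add: R_in_dm dm_scale D_scale inner_diff_left inner_D_R algebra_simps)
qed

sublocale inj_pos_contraction R
proof
  show "inner (R x) y = inner x (R y)" for x y
    using inner_R[OF R_in_dm, of x y] inner_R[OF R_in_dm, of y x] by (simp add: inner_commute)
  have *: "inner (R x) x = inner (R x) (R x) + inner (D (R x)) (D (R x))" for x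
    by (rule inner_R[OF R_in_dm])
  show "0 \<le> inner (R x) x" for x unfolding * by simp
  show "inner (R x) x \<le> inner x x" for x
  proof -
    have "inner x x - inner (R x) x = inner (x - R x) (x - R x) + inner (x - R x) (R x)"
      by (simp add: inner_diff inner_commute)
    moreover have "inner (x - R x) (R x) = inner (D (R x)) (D (R x))"
      using inner_D_R[OF R_in_dm, of x x] by simp
    ultimately show ?thesis using inner_ge_zero[of "x - R x"] inner_ge_zero[of "D (R x)"] by linarith
  qed
  show "x = 0" if "R x = 0" for x
    by (rule orthogonal_dense_imp_0[OF dm_dense]) (use inner_D_R[of _ x] that in \<open>simp add: D_0\<close>)
qed (simp_all add: linear_add[OF R_linear] linear_scale[OF R_linear])

definition F :: "'h \<Rightarrow> 'h" where "F x = D (S x)"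

lemma F_S: "F (S x) = D (R x)" by (simp add: F_def S_S)

text \<open>For \<open>x\<close> in \<open>range S\<close> the vector \<open>S x\<close> lies in the
  range of \<open>R\<close>, and the norm identity is an instance of \<open>inner_R\<close>. The
  identity bounds \<open>D (S x)\<close> by \<open>x\<close>, so closedness of the graph carries
  both claims to the closure of \<open>range S\<close>.\<close>

lemma S_in_dm_aux:
  shows S_in_dm: "S x \<in> dm" and norm_F_aux: "(norm (F x))\<^sup>2 + (norm (S x))\<^sup>2 = (norm x)\<^sup>2"
proof -
  have range_dm: "S (S w) \<in> dm" for w by (simp add: S_S R_in_dm)
  have range_norm: "(norm (D (S (S w))))\<^sup>2 + (norm (S (S w)))\<^sup>2 = (norm (S w))\<^sup>2" for w
    using inner_R[OF R_in_dm, of w w] S_sym[of "S w" w] by (simp add: power2_norm_eq_inner S_S)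
  have "x \<in> closure (range S)" by (simp add: range_S_dense)
  then obtain X where X: "\<And>n. X n \<in> range S" "X \<longlonglongrightarrow> x" by (auto simp: closure_sequential)
  have "\<forall>n. \<exists>w. X n = S w" using X(1) by blast
  then obtain W where W: "\<And>n. X n = S (W n)" by metis
  have lim: "(\<lambda>n. S (X n)) \<longlonglongrightarrow> S x" by (rule S.tendsto[OF X(2)])
  have dist_le: "dist (D (S (X m))) (D (S (X n))) \<le> dist (X m) (X n)" for m n
  proof -
    have dm: "S (X n) \<in> dm" for n unfolding W by (rule range_dm)
    have X_diff: "X m - X n = S (W m - W n)" unfolding W by (simp only: S.diff)
    have eq: "D (S (X m)) - D (S (X n)) = D (S (X m - X n))"
      by (simp only: S.diff D_diff[OF dm dm])
    have "(norm (D (S (X m - X n))))\<^sup>2 + (norm (S (X m - X n)))\<^sup>2 = (norm (X m - X n))\<^sup>2"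
      unfolding X_diff by (rule range_norm)
    then have "(norm (D (S (X m)) - D (S (X n))))\<^sup>2 \<le> (norm (X m - X n))\<^sup>2"
      unfolding eq using zero_le_power2[of "norm (S (X m - X n))"] by linarith
    then show ?thesis unfolding dist_norm by (rule power2_le_imp_le) simp
  qed
  have "Cauchy (\<lambda>n. D (S (X n)))"
    using LIMSEQ_imp_Cauchy[OF X(2)] dist_le unfolding Cauchy_def by (meson le_less_trans)
  then obtain u where u: "(\<lambda>n. D (S (X n))) \<longlonglongrightarrow> u"
    by (auto simp: Cauchy_convergent_iff convergent_def)
  have mem: "(S (X n), D (S (X n))) \<in> {(x, D x) | x. x \<in> dm}" for n
    using range_dm W by auto
  have "(S x, u) \<in> {(x, D x) | x. x \<in> dm}"
    by (rule closed_sequentially[OF closed_graph _ tendsto_Pair[OF lim u]]) (rule mem)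
  then have Sx: "S x \<in> dm" "u = F x" by (auto simp: F_def)
  show "S x \<in> dm" by fact
  have "(\<lambda>n. (norm (D (S (X n))))\<^sup>2 + (norm (S (X n)))\<^sup>2) \<longlonglongrightarrow> (norm (F x))\<^sup>2 + (norm (S x))\<^sup>2"
    using u lim Sx(2) by (intro tendsto_intros) simp_all
  moreover have "(norm (D (S (X n))))\<^sup>2 + (norm (S (X n)))\<^sup>2 = (norm (X n))\<^sup>2" for n
    using range_norm W by simp
  moreover have "(\<lambda>n. (norm (X n))\<^sup>2) \<longlonglongrightarrow> (norm x)\<^sup>2" by (intro tendsto_intros X(2))
  ultimately show "(norm (F x))\<^sup>2 + (norm (S x))\<^sup>2 = (norm x)\<^sup>2"
    using LIMSEQ_unique by simp
qed

lemma F_bounded_linear: "bounded_linear F"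
proof (rule bounded_linear_intro[of _ 1])
  show "norm (F x) \<le> norm x * 1" for x
  proof (rule power2_le_imp_le)
    show "(norm (F x))\<^sup>2 \<le> (norm x * 1)\<^sup>2"
      using norm_F_aux[of x] zero_le_power2[of "norm (S x)"] unfolding mult_1_right by linarith
  qed simp
qed (simp_all add: F_def S.add S.scaleR D_add D_scale S_in_dm)

sublocale F: bounded_linear F by (rule F_bounded_linear)

lemma inner_F_F: "inner (F x) (F y) = inner x y - inner (S x) (S y)"
proof -
  have "inner (F (x + y)) (F (x + y)) + inner (S (x + y)) (S (x + y)) = inner (x + y) (x + y)"
    "inner (F x) (F x) + inner (S x) (S x) = inner x x"
    "inner (F y) (F y) + inner (S y) (S y) = inner y y"
    using norm_F_aux unfolding power2_norm_eq_inner by blast+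
  then show ?thesis
    by (simp add: F.add S.add inner_add_left inner_add_right inner_commute[of y x]
        inner_commute[of "F y" "F x"] inner_commute[of "S y" "S x"])
qed

lemma badj_F_F: "badj F (F x) = x - R x"
proof (rule vector_eq_inner)
  show "inner (badj F (F x)) z = inner (x - R x) z" for z
    by (simp add: inner_badj_left[OF F_bounded_linear] inner_F_F inner_diff_left S_sym S_S sym[symmetric])
qed

text \<open>By \<open>norm_F_aux\<close> the map \<open>J\<close> is an isometry into the graph of
  \<open>D\<close>, hence has closed range. A vector of the graph orthogonal to that range is
  orthogonal to every \<open>(R y, D (R y))\<close>, and \<open>inner_R\<close> makes it 0.\<close>

lemma range_S: "range S = dm"
proof
  show "range S \<subseteq> dm" using S_in_dm by blast
  show "dm \<subseteq> range S"
  proof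
    fix u assume u: "u \<in> dm"
    define J where "J x = (S x, F x)" for x
    have J: "bounded_linear J" unfolding J_def
      by (rule bounded_linear_Pair[OF S_bounded_linear F_bounded_linear])
    have normJ: "norm (J x) = norm x" for x
      using norm_F_aux[of x] by (simp add: J_def norm_prod_def add.commute)
    have "complete (J ` UNIV)"
      using complete_isometric_image[of 1 UNIV J] J normJ by (simp add: complete_UNIV)
    then have "closed (range J)" by (rule complete_imp_closed)
    moreover have "subspace (range J)"
      using J by (intro linear_subspace_image bounded_linear.linear) simp_all
    ultimately obtain v where v: "v \<in> range J" "\<And>w. w \<in> range J \<Longrightarrow> inner ((u, D u) - v) w = 0"
      using orthogonal_projection by metis
    then obtain x where x: "v = J x" by blast
    define w where "w = u - S x"
    have w: "w \<in> dm" unfolding w_def by (rule dm_diff[OF u S_in_dm])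
    have Dw: "D w = D u - F x" by (simp add: w_def F_def D_diff u S_in_dm)
    have "inner w y = 0" for y
    proof -
      have "inner ((u, D u) - J x) (J (S y)) = 0" using v(2) x by blast
      then have "inner (u - S x) (S (S y)) + inner (D u - F x) (F (S y)) = 0"
        by (simp add: J_def inner_prod_def)
      then have "inner w (R y) + inner (D w) (D (R y)) = 0"
        by (simp only: w_def Dw[unfolded w_def] S_S F_S)
      then show ?thesis using inner_R[OF w, of y] by linarith
    qed
    from this[of w] have "w = 0" by simp
    then show "u \<in> range S" by (simp add: w_def)
  qed
qed

text \<open>Pointwise solutions exist because \<open>S\<close> maps onto \<open>dm\<close>, and
  injectivity of \<open>S\<close> makes them linear. Boundedness follows from weak boundedness, as
  \<open>inner (X y) (S z) = inner (T y) z\<close>.\<close>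

lemma factor_through_S:
  fixes T :: "'h \<Rightarrow> 'h"
  assumes T: "bounded_linear T" "\<And>x. T x \<in> dm"
  shows "\<exists>X. bounded_linear X \<and> (\<forall>x. S (X x) = T x)"
proof -
  interpret T: bounded_linear T by (rule T(1))
  have "\<exists>y. S y = T x" for x
  proof -
    have "T x \<in> range S" unfolding range_S by (rule T(2))
    then show ?thesis by (metis image_iff)
  qed
  then obtain X where X: "\<And>x. S (X x) = T x" by metis
  have S_eq: "y = z" if "S y = S z" for y z
    using S_inj[of "y - z"] that by (simp add: S.diff)
  have lin: "linear X"
  proof (rule linearI)
    show "X (x + y) = X x + X y" for x y by (rule S_eq) (simp add: X S.add T.add)
    show "X (c *\<^sub>R x) = c *\<^sub>R X x" for c x by (rule S_eq) (simp add: X S.scaleR T.scaleR)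
  qed
  have weak: "bounded_linear (\<lambda>y. inner (X y) v)" if "v \<in> range S" for v
  proof -
    obtain z where "v = S z" using \<open>v \<in> range S\<close> by blast
    then have "(\<lambda>y. inner (X y) v) = (\<lambda>y. inner (T y) z)" by (simp add: S_sym[symmetric] X)
    then show ?thesis using bounded_linear_compose[OF bounded_linear_inner_left T(1)] by simp
  qed
  have "bounded_linear X"
  proof (rule bounded_linear_if_weakly_bounded)
    show "linear X" by (rule lin)
    show "closure (range S) = UNIV" by (rule range_S_dense)
  qed (rule weak)
  then show ?thesis using X by blast
qed

section \<open>Compactness of commutators with the bounded transform\<close>

definition comm :: "('h \<Rightarrow> 'h) \<Rightarrow> 'h \<Rightarrow> 'h" where
  "comm a x = D (a (S x)) - a (F x)"

text \<open>Collects what the axioms of a spectral triple say about one element of the dense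
  subalgebra; \<open>comm a\<close> is \<open>[D, a] S\<close>, defined everywhere because
  \<open>S\<close> maps into \<open>dm\<close>.\<close>

definition admissible :: "('h \<Rightarrow> 'h) \<Rightarrow> bool" where
  "admissible a \<longleftrightarrow> bounded_linear a \<and> a ` dm \<subseteq> dm \<and> compact_op (comm a) \<and> sub_order (comm a)"

lemma comm_S: "comm a (S x) = D (a (R x)) - a (D (R x))"
  by (simp add: comm_def S_S F_def)

theorem compact_commutator:
  assumes a: "admissible a" "admissible a'" and adj: "\<And>x y. inner (a x) y = inner x (a' y)"
  shows "compact_op (\<lambda>x. F (a x) - a (F x))"
proof -
  have abl: "bounded_linear a" and ain: "\<And>x. x \<in> dm \<Longrightarrow> a x \<in> dm"
    and K: "compact_op (comm a)" "sub_order (comm a)" using a(1) by (auto simp: admissible_def)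
  have ain': "\<And>x. x \<in> dm \<Longrightarrow> a' x \<in> dm"
    and K': "compact_op (comm a')" "sub_order (comm a')" using a(2) by (auto simp: admissible_def)
  interpret a: bounded_linear a by (rule abl)
  have Kbl: "bounded_linear (comm a)" "bounded_linear (comm a')"
    using K(1) K'(1) by (simp_all add: compact_op_bounded_linear)
  note Fbl = F_bounded_linear
  note F'bl = bounded_linear_badj[OF Fbl]
  obtain Y where Y: "bounded_linear Y" "\<And>x. S (Y x) = a (S x)"
    using factor_through_S[OF bounded_linear_compose[OF abl S_bounded_linear]] ain S_in_dm by blast
  interpret Y: bounded_linear Y by (rule Y(1))
  define Z where "Z x = Y x - a x" for x
  define G where "G x = badj F (comm a (S x)) - badj (comm a') (F (S x))" for x
  have "compact_op Z"
  proof (rule compact_solution_of_sylvester)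
    show "bounded_linear Z" unfolding Z_def by (rule bounded_linear_sub[OF Y(1) abl])
    show "S (Z x) + Z (S x) = G x" for x
    proof -
      \<comment> \<open>Applying \<open>S\<close> first eliminates \<open>Y\<close>: what remains is
        \<open>a (R x) - R (a x)\<close>, and \<open>inner_R\<close> can be used on both of its
        terms.\<close>
      have "S (S (Z x) + Z (S x) - G x) = 0"
      proof (rule vector_eq_inner)
        fix y
        have "S (S (Z x) + Z (S x)) = a (R x) - R (a x)"
          by (simp add: Z_def S.add S.diff Y(2) S_S)
        moreover have "inner (R (a x)) y = inner (a' (R y)) x"
          by (subst sym, subst adj, rule inner_commute)
        ultimately have "inner (S (S (Z x) + Z (S x))) y = inner (a (R x)) y - inner (a' (R y)) x"
          by (simp only: inner_diff_left)
        also have "\<dots> = (inner (a (R x)) (R y) + inner (D (a (R x))) (D (R y)))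
            - (inner (a' (R y)) (R x) + inner (D (a' (R y))) (D (R x)))"
          by (simp add: inner_R[OF ain[OF R_in_dm], of x y] inner_R[OF ain'[OF R_in_dm], of y x])
        also have "\<dots> = inner (comm a (S x)) (D (R y)) - inner (comm a' (S y)) (D (R x))"
        proof -
          \<comment> \<open>The terms without a commutator agree by adjointness and drop
            out.\<close>
          have "inner (a (R x)) (R y) = inner (a' (R y)) (R x)"
            "inner (a (D (R x))) (D (R y)) = inner (a' (D (R y))) (D (R x))"
            by (subst adj, rule inner_commute)+
          then show ?thesis by (simp add: comm_S inner_diff_left)
        qed
        also have "\<dots> = inner (S (G x)) y"
          by (simp add: S_sym G_def inner_diff_left inner_badj_left Fbl Kbl F_def S_S)
            (simp add: inner_commute)
        finally show "inner (S (S (Z x) + Z (S x) - G x)) y = inner 0 y"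
          by (simp add: S.diff inner_diff_left)
      qed
      then show ?thesis using S_inj by force
    qed
    show "compact_op G" unfolding G_def
      by (intro compact_op_diff compact_op_compose_left[OF _ F'bl] compact_op_compose_right[OF K(1) S_bounded_linear]
        compact_op_compose_right[OF compact_op_badj[OF K'(1)] bounded_linear_compose[OF Fbl S_bounded_linear]])
    \<comment> \<open>The decay of the second summand of \<open>G\<close> is obtained from its
      adjoint, where \<open>S\<close> stands on the left and \<open>comm a'\<close> on the
      right.\<close>
    have "badj (\<lambda>x. S (badj F (comm a' x))) = (\<lambda>x. badj (comm a') (F (S x)))"
      by (rule badj_eqI)
        (simp_all add: bounded_linear_compose[OF S_bounded_linear bounded_linear_compose[OF F'bl Kbl(2)]]
          S_sym inner_badj_left[OF Fbl] inner_badj[OF Kbl(2)])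
    then have "cayley_decay (\<lambda>x. badj (comm a') (F (S x)))"
      using cayley_decay_badj[OF _ cayley_decay_mult_S_left[OF K'(2) F'bl]]
        bounded_linear_compose[OF S_bounded_linear bounded_linear_compose[OF F'bl Kbl(2)]] by simp
    then show "cayley_decay G" unfolding G_def
      by (intro cayley_decay_diff cayley_decay_mult_S_right[OF K(2) F'bl])
  qed
  then have "compact_op (\<lambda>x. comm a x - F (Z x))"
    by (intro compact_op_diff K compact_op_compose_left[OF _ Fbl])
  moreover have "comm a x - F (Z x) = F (a x) - a (F x)" for x
  proof -
    have "D (a (S x)) = F (Y x)" by (simp add: F_def Y(2))
    then show ?thesis by (simp add: comm_def Z_def F.diff)
  qed
  ultimately show ?thesis by simp
qed

text \<open>Both norms in the interpolation inequality have to be controlled. The hypothesis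
  \<open>SX\<close> is automatic if \<open>S X = B S\<close> with \<open>B\<close> bounded, as
  happens for \<open>X1\<close> and \<open>X2\<close> below.\<close>

lemma sub_order_compose:
  assumes K: "sub_order K" and X: "bounded_linear X" and SX: "\<And>x. norm (S (X x)) \<le> c * norm (S x)"
  shows "sub_order (\<lambda>x. K (X x))"
proof -
  obtain A d where A: "A \<ge> 0" "0 < d" "d \<le> 1"
    "\<And>w. norm (K w) \<le> A * (norm (S w) powr d * norm w powr (1 - d))"
    using K unfolding sub_order_def by blast
  obtain C where C: "C > 0" "\<And>x. norm (X x) \<le> C * norm x" using bounded_linear_bound[OF X] by blast
  have SX': "norm (S (X x)) \<le> \<bar>c\<bar> * norm (S x)" for x
    by (rule order_trans[OF SX]) (simp add: mult_right_mono)
  have "norm (K (X w)) \<le> (A * (\<bar>c\<bar> powr d * C powr (1 - d))) * (norm (S w) powr d * norm w powr (1 - d))" for w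
  proof -
    have "norm (K (X w)) \<le> A * (norm (S (X w)) powr d * norm (X w) powr (1 - d))" by (rule A)
    also have "\<dots> \<le> A * ((\<bar>c\<bar> * norm (S w)) powr d * (C * norm w) powr (1 - d))"
      using A C by (intro mult_left_mono mult_mono powr_mono2 SX') simp_all
    also have "\<dots> = (A * (\<bar>c\<bar> powr d * C powr (1 - d))) * (norm (S w) powr d * norm w powr (1 - d))"
      using C by (simp add: powr_mult)
    finally show ?thesis .
  qed
  then show ?thesis unfolding sub_order_def using A
    by (intro exI[of _ "A * (\<bar>c\<bar> powr d * C powr (1 - d))"] conjI exI[of _ d]) auto
qed

text \<open>\<open>Z\<close> differs from the compact operator \<open>comm a\<close> by the desired
  one. In its Sylvester equation the terms with two factors \<open>D\<close> must cancel; this is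
  arranged by the Leibniz rule for \<open>j1 j2\<close> in one argument and for the adjoint product
  \<open>j2' j1'\<close> in the other.\<close>

theorem compact_adjoint_commutator:
  assumes adm: "admissible (\<lambda>x. j1 (j2 x))" "admissible j1" "admissible j2'"
    and bl: "bounded_linear j2" "bounded_linear j1'"
    and adj1: "\<And>x y. inner (j1 x) y = inner x (j1' y)"
    and adj2: "\<And>x y. inner (j2 x) y = inner x (j2' y)"
    and in_dm: "j2 ` adj_dom dm D \<subseteq> dm" "j1' ` adj_dom dm D \<subseteq> dm"
  shows "compact_op (\<lambda>x. badj F (j1 (j2 x)) - j1 (j2 (F x)))"
proof -
  define a where "a x = j1 (j2 x)" for x
  have a_adm: "admissible a" using adm(1) by (simp add: a_def[abs_def])
  have abl: "bounded_linear a" and ain: "\<And>x. x \<in> dm \<Longrightarrow> a x \<in> dm"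
    and K: "compact_op (comm a)" "sub_order (comm a)" using a_adm by (auto simp: admissible_def)
  have j1bl: "bounded_linear j1" and j1in: "\<And>x. x \<in> dm \<Longrightarrow> j1 x \<in> dm"
    and K1: "compact_op (comm j1)" "sub_order (comm j1)" using adm(2) by (auto simp: admissible_def)
  have j2'bl: "bounded_linear j2'" and j2'in: "\<And>x. x \<in> dm \<Longrightarrow> j2' x \<in> dm"
    and K2: "compact_op (comm j2')" "sub_order (comm j2')" using adm(3) by (auto simp: admissible_def)
  note Fbl = F_bounded_linear
  note F'bl = bounded_linear_badj[OF Fbl]
  note FSbl = bounded_linear_compose[OF Fbl S_bounded_linear]
  have FS_adj: "F (S x) \<in> adj_dom dm D" for x unfolding F_S
    by (rule adj_opI(1)[of _ "x - R x"]) (use inner_D_R in \<open>simp add: inner_commute\<close>)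
  \<comment> \<open>\<open>S (X2 x)\<close> is \<open>j2 (D (R x))\<close>, so
    \<open>comm j1 (X2 x)\<close> is the commutator of \<open>D\<close> with \<open>j1\<close> at
    that vector. \<open>X1\<close> does the same for \<open>j1'\<close> and
    \<open>j2'\<close>.\<close>
  obtain X2 where X2: "bounded_linear X2" "\<And>x. S (X2 x) = j2 (F (S x))"
    using factor_through_S[OF bounded_linear_compose[OF bl(1) FSbl]] FS_adj in_dm(1) by blast
  obtain X1 where X1: "bounded_linear X1" "\<And>x. S (X1 x) = j1' (F (S x))"
    using factor_through_S[OF bounded_linear_compose[OF bl(2) FSbl]] FS_adj in_dm(2) by blast
  have comm_bl: "bounded_linear (comm a)" "bounded_linear (comm j1)" "bounded_linear (comm j2')"
    using K(1) K1(1) K2(1) by (simp_all add: compact_op_bounded_linear)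
  have "sub_order (\<lambda>x. comm j1 (X2 x))"
  proof -
    obtain c where "\<And>x. norm (j2 (F x)) \<le> c * norm x"
      using bounded_linear_bound[OF bounded_linear_compose[OF bl(1) Fbl]] by blast
    then show ?thesis using sub_order_compose[OF K1(2) X2(1)] X2(2) by metis
  qed
  note decay1 = cayley_decay_mult_S_left[OF this F'bl]
  have "sub_order (\<lambda>x. comm j2' (X1 x))"
  proof -
    obtain c where "\<And>x. norm (j1' (F x)) \<le> c * norm x"
      using bounded_linear_bound[OF bounded_linear_compose[OF bl(2) Fbl]] by blast
    then show ?thesis using sub_order_compose[OF K2(2) X1(1)] X1(2) by metis
  qed
  note decay2 = cayley_decay_mult_S_left[OF this F'bl]
  define L where "L x = comm j2' (X1 x)" for x
  have L: "bounded_linear L" "compact_op L" unfolding L_def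
    by (rule bounded_linear_compose[OF comm_bl(3) X1(1)], rule compact_op_compose_right[OF K2(1) X1(1)])
  define Z where "Z x = D (a (S x)) - badj F (a x)" for x
  define G where "G x = (comm a (S x) - R (comm a (S x))) + S (badj F (comm j1 (X2 x))) - badj L (F (S x))" for x
  have M: "D (a (S x)) = comm a x + a (F x)" for x by (simp add: comm_def)
  have Mbl: "bounded_linear (\<lambda>x. D (a (S x)))"
    unfolding M by (intro bounded_linear_add comm_bl bounded_linear_compose[OF abl Fbl])
  have "compact_op Z"
  proof (rule compact_solution_of_sylvester)
    show "bounded_linear Z" unfolding Z_def
      by (intro bounded_linear_sub Mbl bounded_linear_compose[OF F'bl abl])
    show "S (Z x) + Z (S x) = G x" for x
    proof (rule vector_eq_inner)
      fix y
      define p where "p = D (R x)"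
      define q where "q = D (R y)"
      have adj_a: "inner (a x) y = inner x (j2' (j1' y))" for x y by (simp add: a_def adj1 adj2)
      have p_dom: "j2 p \<in> dm" using in_dm(1) FS_adj[of x] by (auto simp: F_S p_def)
      have q_dom: "j1' q \<in> dm" using in_dm(2) FS_adj[of y] by (auto simp: F_S q_def)
      have ap: "a p \<in> dm" unfolding a_def by (rule j1in[OF p_dom])
      \<comment> \<open>On vectors of the domain \<open>badj F\<close> agrees with
        \<open>S D\<close>, by symmetry of \<open>D\<close>; this removes the adjoint from
        \<open>Z (S x)\<close>.\<close>
      have "badj F (a (S x)) = S (D (a (S x)))"
      proof (rule vector_eq_inner)
        show "inner (badj F (a (S x))) z = inner (S (D (a (S x)))) z" for z
          by (simp add: inner_badj_left[OF Fbl] S_sym F_def D_sym ain S_in_dm)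
      qed
      then have "S (Z x) + Z (S x) = D (a (R x)) - S (badj F (a x))"
        by (simp add: Z_def S.diff S_S)
      then have "inner (S (Z x) + Z (S x)) y = inner (D (a (R x))) y - inner (a x) q"
        by (simp add: inner_diff_left S_sym inner_badj_left[OF Fbl] F_S q_def)
      \<comment> \<open>By symmetry of \<open>D\<close> the same number is subtracted from both
        terms. Afterwards \<open>y - R y\<close> and \<open>x - R x\<close> are the adjoint of
        \<open>D\<close> applied to \<open>q\<close> and \<open>p\<close>, so
        \<open>inner_D_R\<close> becomes applicable.\<close>
      also have "\<dots> = inner (D (a (R x))) (y - R y) - inner (a (x - R x)) q"
      proof -
        interpret a: bounded_linear a by (rule abl)
        have "inner (D (a (R x))) (R y) = inner (a (R x)) q"
          unfolding q_def by (rule D_sym[OF ain[OF R_in_dm] R_in_dm])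
        then show ?thesis by (simp add: inner_diff a.diff)
      qed
      also have "\<dots> = inner (comm a (S x)) (y - R y) + inner (a p) (y - R y) - inner (a (x - R x)) q"
        by (simp add: comm_S p_def inner_diff_left)
      also have "inner (comm a (S x)) (y - R y) = inner (comm a (S x) - R (comm a (S x))) y"
        by (simp add: inner_diff sym)
      also have "inner (a p) (y - R y) = inner (D (a p)) q"
        using inner_D_R[OF ap, of y] by (simp add: q_def inner_commute)
      \<comment> \<open>The Leibniz rule for \<open>j1 j2\<close>; its counterpart for
        \<open>j2' j1'\<close> follows below. Both leave the number
        \<open>inner p (j2' (D (j1' q)))\<close>, which cancels.\<close>
      also have "D (a p) = comm j1 (X2 x) + j1 (D (j2 p))"
        by (simp add: comm_def F_def[of "X2 x"] X2(2) F_S a_def p_def)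
      also have "inner (comm j1 (X2 x) + j1 (D (j2 p))) q = inner (S (badj F (comm j1 (X2 x)))) y + inner p (j2' (D (j1' q)))"
      proof -
        have "inner (j1 (D (j2 p))) q = inner p (j2' (D (j1' q)))"
          by (simp add: adj1 D_sym[OF p_dom q_dom] adj2)
        then show ?thesis
          by (simp add: inner_add_left S_sym inner_badj_left[OF Fbl] F_S q_def)
      qed
      also have "inner (a (x - R x)) q = inner p (D (j2' (j1' q)))"
        using inner_D_R[OF j2'in[OF q_dom], of x] by (simp add: adj_a p_def)
      also have "D (j2' (j1' q)) = L y + j2' (D (j1' q))"
        by (simp add: L_def comm_def F_def[of "X1 y"] X1(2) F_S q_def)
      also have "inner p (L y + j2' (D (j1' q))) = inner (badj L (F (S x))) y + inner p (j2' (D (j1' q)))"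
        by (simp add: inner_add_right inner_badj_left[OF L(1)] F_S p_def)
      finally show "inner (S (Z x) + Z (S x)) y = inner (G x) y"
        by (simp add: G_def inner_add_left inner_diff_left)
    qed
    have Rbl: "bounded_linear (\<lambda>x. x - R x)"
      using bounded_linear_sub[OF bounded_linear_ident bounded_linear_compose[OF S_bounded_linear S_bounded_linear]]
      by (simp add: S_S)
    show "compact_op G" unfolding G_def
      by (intro compact_op_diff compact_op_add
        compact_op_compose_left[OF compact_op_compose_right[OF K(1) S_bounded_linear] Rbl]
        compact_op_compose_left[OF _ S_bounded_linear] compact_op_compose_left[OF _ F'bl]
        compact_op_compose_right[OF K1(1) X2(1)]
        compact_op_compose_right[OF compact_op_badj[OF L(2)] FSbl])
    have SFLbl: "bounded_linear (\<lambda>x. S (badj F (L x)))"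
      by (rule bounded_linear_compose[OF S_bounded_linear bounded_linear_compose[OF F'bl L(1)]])
    have "badj (\<lambda>x. S (badj F (L x))) = (\<lambda>x. badj L (F (S x)))"
      by (rule badj_eqI[OF SFLbl])
        (simp add: S_sym inner_badj_left[OF Fbl] inner_badj[OF L(1)])
    then have "cayley_decay (\<lambda>x. badj L (F (S x)))"
      using cayley_decay_badj[OF SFLbl] decay2 by (simp add: L_def)
    then show "cayley_decay G" unfolding G_def
      by (intro cayley_decay_diff cayley_decay_add cayley_decay_mult_S_right[OF K(2) Rbl] decay1)
  qed
  then have "compact_op (\<lambda>x. comm a x - Z x)" by (intro compact_op_diff K)
  moreover have "comm a x - Z x = badj F (j1 (j2 x)) - j1 (j2 (F x))" for x
    by (simp add: comm_def Z_def a_def)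
  ultimately show ?thesis by simp
qed

end

section \<open>Estimates for fractional powers and the higher-order condition\<close>

context pos_contraction
begin

lemma norm_R_le: "norm (R x) \<le> norm x"
proof -
  have "norm (fc (\<lambda>r. r) x) \<le> 1 * norm x" by (rule norm_fc_le[OF continuous_on_id]) simp
  then show ?thesis by (simp add: fc_ident)
qed

lemma norm_R_funpow_le: "norm ((R ^^ n) x) \<le> norm x"
  by (induction n) (auto intro: order_trans[OF norm_R_le])

lemma cont_powr: "0 < s \<Longrightarrow> continuous_on {0..1} (\<lambda>r::real. r powr s)"
  by (intro continuous_on_powr' continuous_intros) auto

lemma fpow01_bounded:
  assumes "0 < s" "s < 1"
  shows "\<exists>c>0. \<forall>x. norm (fpow01 R s x) \<le> c * norm x"
proof -
  obtain c where c: "c > 0" "\<And>x. fpow01 R s x = c *\<^sub>R fc (\<lambda>r. r powr s) x"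
    using fpow01_eq[OF assms] by blast
  have "norm (fc (\<lambda>r. r powr s) x) \<le> 1 * norm x" for x
    by (rule norm_fc_le[OF cont_powr[OF assms(1)]]) (use assms in \<open>simp add: powr_le1\<close>)
  then show ?thesis using c by (intro exI[of _ c]) simp
qed

lemma fpow_bounded:
  assumes "0 \<le> s"
  shows "\<exists>c>0. \<forall>x. norm (fpow R s x) \<le> c * norm x"
proof (cases "frac s = 0")
  case True
  then show ?thesis by (intro exI[of _ 1]) (simp add: fpow_def norm_R_funpow_le)
next
  case False
  then have "0 < frac s" "frac s < 1" using frac_ge_0[of s] frac_lt_1[of s] by linarith+
  then obtain c where "c > 0" "\<And>x. norm (fpow01 R (frac s) x) \<le> c * norm x"
    using fpow01_bounded by blast
  then show ?thesis using False
    by (intro exI[of _ c]) (auto simp: fpow_def intro: order_trans[OF norm_R_funpow_le])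
qed

end

text \<open>The right-hand side is the tangent at \<open>t\<close> to a concave power; the
  inequality is Young's, multiplied by \<open>t powr (d - 1)\<close>.\<close>

lemma powr_le_tangent:
  fixes r t d :: real
  assumes "r \<ge> 0" "t > 0" "0 < d" "d \<le> 1"
  shows "r powr d \<le> (1 - d) * t powr d + d * t powr (d - 1) * r"
proof (cases "r = 0")
  case False
  then have r: "r > 0" using assms by simp
  have "r powr d * t powr (1 - d) \<le> d * r + (1 - d) * t"
    using assms r by (intro Youngs_inequality_0) simp_all
  then have "r powr d * t powr (1 - d) * t powr (d - 1) \<le> (d * r + (1 - d) * t) * t powr (d - 1)"
    by (rule mult_right_mono) simp
  moreover have "t powr (1 - d) * t powr (d - 1) = 1"
    using assms by (simp add: powr_add[symmetric])
  moreover have "t * t powr (d - 1) = t powr d" using assms by (simp add: powr_mult_base)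
  ultimately show ?thesis by (simp add: algebra_simps)
qed (use assms in simp)

context inj_pos_contraction
begin

lemma fpow_half: "fpow R (1/2) = S"
proof (rule ext)
  fix x
  obtain c where c: "c = 1" "\<And>x. fpow01 R (1/2) x = c *\<^sub>R fc (\<lambda>r. r powr (1/2)) x"
    using fpow01_eq[of "1/2"] by auto
  have "\<lfloor>1/2 :: real\<rfloor> = 0" by (simp add: floor_eq_iff)
  then have "fpow R (1/2) x = fpow01 R (1/2) x" by (simp add: fpow_def frac_def)
  also have "\<dots> = fc (\<lambda>r. r powr (1/2)) x" using c by simp
  also have "\<dots> = S x" unfolding S_def by (rule fc_cong) (simp add: powr_half_sqrt)
  finally show "fpow R (1/2) x = S x" .
qed

text \<open>Jensen's inequality for the concave function \<open>r powr (2 * e)\<close> and the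
  spectral measure of \<open>w\<close>, phrased through a tangent line so that
  \<open>fc_nonneg\<close> suffices.\<close>

lemma norm_fc_powr_le:
  assumes e: "0 < e" "e \<le> 1/2"
  shows "norm (fc (\<lambda>r. r powr e) w) \<le> norm (S w) powr (2 * e) * norm w powr (1 - 2 * e)"
proof (cases "w = 0")
  case False
  define d where "d = 2 * e"
  have d: "0 < d" "d \<le> 1" using e by (simp_all add: d_def)
  have Sw: "norm (S w) > 0" using False S_inj by auto
  have nw: "norm w > 0" using False by simp
  \<comment> \<open>\<open>t\<close> is the mean value \<open>inner (R w) w / inner w w\<close>.
    With this point of tangency the two terms of the tangent line add up to \<open>t powr d\<close>
    times the squared norm of \<open>w\<close>.\<close>
  define t where "t = (norm (S w) / norm w)\<^sup>2"
  have t: "t > 0" using Sw nw by (simp add: t_def)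
  have ce: "continuous_on {0..1} (\<lambda>r::real. r powr e)" "continuous_on {0..1} (\<lambda>r::real. r powr d)"
    using cont_powr e d by simp_all
  define f where "f r = (1 - d) * t powr d + d * t powr (d - 1) * r" for r
  have cf: "continuous_on {0..1} f" unfolding f_def by (intro continuous_intros)
  have "0 \<le> inner (fc (\<lambda>r. f r - r powr d) w) w"
    by (rule fc_nonneg)
      (use powr_le_tangent[OF _ t d] in \<open>auto simp: f_def intro!: continuous_intros ce\<close>)
  then have "inner (fc (\<lambda>r. r powr d) w) w \<le> inner (fc f w) w"
    by (simp add: fc_diff[OF cf ce(2)] inner_diff_left)
  also have "fc f w = ((1 - d) * t powr d) *\<^sub>R w + (d * t powr (d - 1)) *\<^sub>R R w"
    unfolding f_def by (simp add: fc_add fc_scale continuous_intros fc_const fc_ident)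
  also have "inner \<dots> w = (1 - d) * t powr d * (norm w)\<^sup>2 + d * t powr (d - 1) * (norm (S w))\<^sup>2"
    using S_sym[of "S w" w] by (simp add: inner_add_left S_S power2_norm_eq_inner)
  also have "(norm (S w))\<^sup>2 = t * (norm w)\<^sup>2" using nw by (simp add: t_def power_divide)
  also have "(1 - d) * t powr d * (norm w)\<^sup>2 + d * t powr (d - 1) * (t * (norm w)\<^sup>2) = t powr d * (norm w)\<^sup>2"
  proof -
    have "t powr (d - 1) * t = t powr d" using powr_mult_base[of t "d - 1"] t by (simp add: mult.commute)
    then have "d * t powr (d - 1) * (t * (norm w)\<^sup>2) = d * (t powr d * (norm w)\<^sup>2)" by (simp add: mult.assoc[symmetric])
    then show ?thesis by (simp add: algebra_simps)
  qed
  also have "t powr d * (norm w)\<^sup>2 = (norm (S w) powr d * norm w powr (1 - d))\<^sup>2"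
  proof -
    have "t powr d = (norm (S w) powr d)\<^sup>2 / (norm w powr d)\<^sup>2"
      using Sw nw by (simp add: t_def powr_divide powr_power power_divide mult.commute powr_powr flip: powr_numeral)
    moreover have "norm w powr (1 - d) = norm w / norm w powr d" using nw by (simp add: powr_diff)
    ultimately show ?thesis by (simp add: power_mult_distrib power_divide)
  qed
  finally have "inner (fc (\<lambda>r. r powr d) w) w \<le> (norm (S w) powr d * norm w powr (1 - d))\<^sup>2" .
  moreover have "fc (\<lambda>r. r powr d) w = fc (\<lambda>r. r powr e) (fc (\<lambda>r. r powr e) w)"
    by (simp add: fc_mult[OF ce(1) ce(1), symmetric] d_def powr_add[symmetric])
  ultimately have "(norm (fc (\<lambda>r. r powr e) w))\<^sup>2 \<le> (norm (S w) powr d * norm w powr (1 - d))\<^sup>2"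
    by (simp add: fc_sym[OF ce(1)] power2_norm_eq_inner)
  then show ?thesis unfolding d_def by (rule power2_le_imp_le) simp
qed (use fc_linear[OF cont_powr[OF e(1)]] in \<open>simp add: linear_0\<close>)

lemma sub_order_if_S_bounded:
  assumes "\<And>w. norm (K w) \<le> A * norm (S w)"
  shows "sub_order K"
proof -
  have "norm (K w) \<le> \<bar>A\<bar> * (norm (S w) powr 1 * norm w powr (1 - 1))" for w
  proof -
    have "norm (K w) \<le> \<bar>A\<bar> * norm (S w)"
      by (rule order_trans[OF assms]) (simp add: mult_right_mono)
    then show ?thesis by (cases "w = 0") (simp_all add: S.zero)
  qed
  then show ?thesis unfolding sub_order_def
    by (intro exI[of _ "\<bar>A\<bar>"] conjI exI[of _ 1]) auto
qed

text \<open>The exponent has the sign of \<open>m - 1\<close>. For \<open>m \<le> 1\<close> the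
  hypothesis bounds \<open>K\<close> by \<open>S\<close> itself, that is d = 1; for
  \<open>m > 1\<close> interpolation gives d = 1/m.\<close>

lemma sub_order_if_pow_rel_bounded:
  assumes m: "m > 0"
    and bound: "\<And>y w. pow_rel R (1/2 - 1/(2*m)) y (S w) \<Longrightarrow> norm (K w) \<le> C * norm y"
  shows "sub_order K"
proof -
  define g where "g = 1/2 - 1/(2*m)"
  define e where "e = 1/(2*m)"
  have e: "e > 0" "g = 1/2 - e" using m by (simp_all add: g_def e_def)
  have bound': "norm (K w) \<le> \<bar>C\<bar> * norm y" if "pow_rel R g y (S w)" for y w
    by (rule order_trans[OF bound[OF that[unfolded g_def]]]) (simp add: mult_right_mono)
  consider "g < 0" | "g = 0" | "g > 0" by linarith
  then show ?thesis
  proof cases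
    case 1
    obtain c where c: "\<And>x. norm (fpow R (- g) x) \<le> c * norm x" using fpow_bounded[of "- g"] 1 by auto
    have "norm (K w) \<le> (\<bar>C\<bar> * c) * norm (S w)" for w
    proof -
      have "norm (K w) \<le> \<bar>C\<bar> * norm (fpow R (- g) (S w))" by (rule bound') (simp add: pow_rel_def 1)
      also have "\<dots> \<le> \<bar>C\<bar> * (c * norm (S w))" by (intro mult_left_mono c) simp
      finally show ?thesis by (simp add: mult.assoc)
    qed
    then show ?thesis by (rule sub_order_if_S_bounded)
  next
    case 2
    have "norm (K w) \<le> \<bar>C\<bar> * norm (S w)" for w
      by (rule bound') (simp add: pow_rel_def 2 fpow_def)
    then show ?thesis by (rule sub_order_if_S_bounded)
  next
    case 3
    have g: "0 < g" "g < 1" "e \<le> 1/2" using 3 e by simp_all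
    obtain k where k: "k > 0" "\<And>x. fpow01 R g x = k *\<^sub>R fc (\<lambda>r. r powr g) x"
      using fpow01_eq[OF g(1,2)] by blast
    have "norm (K w) \<le> (\<bar>C\<bar> / k) * (norm (S w) powr (2 * e) * norm w powr (1 - 2 * e))" for w
    proof -
      \<comment> \<open>Because \<open>g + e = 1/2\<close>, the power of exponent \<open>g\<close>
        maps this vector to \<open>S w\<close>; the factor \<open>1 / k\<close> compensates the
        normalisation of \<open>fpow01\<close>.\<close>
      define y where "y = (1 / k) *\<^sub>R fc (\<lambda>r. r powr e) w"
      have "\<lfloor>g\<rfloor> = 0" using g by (simp add: floor_eq_iff)
      then have "fpow R g y = k *\<^sub>R fc (\<lambda>r. r powr g) y"
        using g(1) by (simp add: fpow_def frac_def k(2))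
      also have "\<dots> = fc (\<lambda>r. r powr g) (fc (\<lambda>r. r powr e) w)"
        using k(1) fc_linear[OF cont_powr[OF g(1)]] by (simp add: y_def linear_scale)
      also have "\<dots> = fc (\<lambda>r. r powr g * r powr e) w"
        by (rule fc_mult[OF cont_powr[OF g(1)] cont_powr[OF e(1)], symmetric])
      also have "\<dots> = S w" unfolding S_def
        by (rule fc_cong) (simp add: powr_add[symmetric] e(2) powr_half_sqrt)
      finally have "norm (K w) \<le> \<bar>C\<bar> * norm y" using g(1) by (intro bound') (simp add: pow_rel_def)
      also have "\<dots> = \<bar>C\<bar> / k * norm (fc (\<lambda>r. r powr e) w)" using k(1) by (simp add: y_def)
      also have "\<dots> \<le> \<bar>C\<bar> / k * (norm (S w) powr (2 * e) * norm w powr (1 - 2 * e))"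
        using k(1) g(3) e(1) by (intro mult_left_mono norm_fc_powr_le) simp_all
      finally show ?thesis .
    qed
    then show ?thesis unfolding sub_order_def using k(1) e(1) g(3)
      by (intro exI[of _ "\<bar>C\<bar> / k"] conjI exI[of _ "2 * e"]) auto
  qed
qed

end

section \<open>Identification of the bounded transform and its symmetries\<close>

context closed_symmetric_op
begin

lemma inv_sqrt_op_eq: "inv_sqrt_op dm D = S"
  by (simp add: inv_sqrt_op_def fpow_half)

lemma bounded_transform_eq: "bounded_transform dm D = F"
  by (rule ext) (simp add: bounded_transform_def inv_sqrt_op_eq F_def)

text \<open>Applied to the complex structure and to the grading operator.\<close>
lemma F_intertwines:
  assumes T: "bounded_linear T" and dm: "\<And>x. x \<in> dm \<Longrightarrow> T x \<in> dm"
    and DT: "\<And>x. x \<in> dm \<Longrightarrow> D (T x) = c *\<^sub>R T (D x)" and c: "c * c = 1"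
    and adj: "\<And>x y. inner (T x) y = d * inner x (T y)"
  shows "F (T x) = c *\<^sub>R T (F x)"
proof -
  interpret T: bounded_linear T by (rule T)
  \<comment> \<open>The factor \<open>c\<close> enters twice and squares to 1; \<open>d\<close>
    appears when \<open>T\<close> is moved to the right and is undone when \<open>T\<close> is moved
    back.\<close>
  have "T (R y) = R (T y)" for y
  proof (rule res_op_eqI[symmetric])
    show "T (R y) \<in> dm" by (rule dm[OF R_in_dm])
    fix w assume w: "w \<in> dm"
    have "T (D w) = c *\<^sub>R D (T w)" using DT[OF w] c by simp
    then have "inner (D (T (R y))) (D w) = d * inner (D (R y)) (D (T w))"
      using c by (simp add: DT[OF R_in_dm] adj)
    also have "\<dots> = inner (T (y - R y)) w" by (simp add: inner_D_R[OF dm[OF w]] adj)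
    finally show "inner (D (T (R y))) (D w) = inner (T y - T (R y)) w" by (simp add: T.diff)
  qed
  then have "S (T x) = T (S x)" unfolding S_def by (rule fc_commute[OF cont_sqrt T, symmetric])
  then show ?thesis by (simp add: F_def DT[OF S_in_dm])
qed

end

subsection \<open>Representations of C*-algebras\<close>

lemma cstar_norm_st:
  fixes st :: "'a::{real_normed_algebra,banach} \<Rightarrow> 'a"
  assumes "cstar_algebra ciA st"
  shows "norm (st a) = norm a"
proof -
  have le: "norm a \<le> norm (st a)" for a
  proof (cases "a = 0")
    case False
    have "norm a * norm a = norm (st a * a)"
      using assms by (simp add: cstar_algebra_def power2_eq_square)
    also have "\<dots> \<le> norm (st a) * norm a" by (rule norm_mult_ineq)
    finally show ?thesis using False by simp
  qed simp
  have "st (st a) = a" using assms by (simp add: cstar_algebra_def)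
  then show ?thesis using le[of a] le[of "st a"] by simp
qed

text \<open>A selfadjoint solution of \<open>(1 - b)\<^sup>2 = 1 - h\<close>, which makes sense without a unit.\<close>
lemma cstar_quasi_sqrt:
  fixes st :: "'a::{real_normed_algebra,banach} \<Rightarrow> 'a"
  assumes cs: "cstar_algebra ciA st" and h: "st h = h" "norm h \<le> 1/2"
  shows "\<exists>b. st b = b \<and> b + b - b * b = h"
proof -
  have st: "\<And>x y. st (x + y) = st x + st y" "\<And>r x. st (r *\<^sub>R x) = r *\<^sub>R st x" "\<And>x y. st (x * y) = st y * st x"
    using cs by (simp_all add: cstar_algebra_def)
  have st_diff: "st (x - y) = st x - st y" for x y
    using st(1)[of x "(-1) *\<^sub>R y"] st(2)[of "-1" y] by simp
  have st_bl: "bounded_linear st"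
    by (rule bounded_linear_intro[of _ 1]) (simp_all add: st cstar_norm_st[OF cs])
  define V where "V = {b. st b = b} \<inter> cball 0 (1/2)"
  \<comment> \<open>A fixed point satisfies \<open>h + b * b = 2 *\<^sub>R b\<close>. On the ball of
    radius 1/2 the map is a contraction with factor 1/2, and it preserves selfadjointness.\<close>
  define f where "f b = (1/2) *\<^sub>R (h + b * b)" for b
  have "closed {b. st b = b}"
    by (intro closed_Collect_eq linear_continuous_on[OF st_bl] continuous_intros)
  then have "complete V" unfolding V_def by (simp add: complete_eq_closed closed_Int)
  moreover have "V \<noteq> {}"
  proof -
    have "st 0 = 0" using st(2)[of 0 0] by simp
    then have "0 \<in> V" by (simp add: V_def)
    then show ?thesis by blast
  qed
  moreover have "f ` V \<subseteq> V"
  proof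
    fix z assume "z \<in> f ` V"
    then obtain b where b: "st b = b" "norm b \<le> 1/2" "z = f b" by (auto simp: V_def)
    have "norm (b * b) \<le> norm b * norm b" by (rule norm_mult_ineq)
    also have "\<dots> \<le> 1/2 * 1" using b(2) by (intro mult_mono) simp_all
    finally have "norm (h + b * b) \<le> 1/2 + 1/2" using h(2) by (intro norm_triangle_mono) simp_all
    then have "norm (f b) \<le> 1/2" by (simp add: f_def)
    moreover have "st (f b) = f b" by (simp add: f_def st h b)
    ultimately show "z \<in> V" using b by (simp add: V_def)
  qed
  moreover have "dist (f b) (f c) \<le> 1/2 * dist b c" if "b \<in> V" "c \<in> V" for b c
  proof -
    have n: "norm b \<le> 1/2" "norm c \<le> 1/2" using that by (simp_all add: V_def)
    have "f b - f c = (1/2) *\<^sub>R (b * (b - c) + (b - c) * c)"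
      by (simp add: f_def algebra_simps)
    then have "norm (f b - f c) = 1/2 * norm (b * (b - c) + (b - c) * c)" by simp
    also have "norm (b * (b - c) + (b - c) * c) \<le> 1/2 * norm (b - c) + norm (b - c) * (1/2)"
      by (intro norm_triangle_mono order_trans[OF norm_mult_ineq] mult_left_mono mult_right_mono n) simp_all
    finally show ?thesis by (simp add: dist_norm)
  qed
  ultimately obtain b where "b \<in> V" "f b = b"
    using Banach_fix[of V "1/2" f] by auto
  then have "h + b * b = 2 *\<^sub>R b" unfolding f_def by (metis (no_types, lifting) scaleR_scaleR scaleR_one
        nonzero_mult_div_cancel_left zero_neq_numeral times_divide_eq_right mult_1_right)
  then have "b + b - b * b = h" by (simp add: scaleR_2 algebra_simps)
  then show ?thesis using \<open>b \<in> V\<close> by (auto simp: V_def)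
qed

text \<open>Continuity in \<open>a\<close> is not part of \<open>star_rep\<close> and comes from the
  C*-identity: if \<open>norm a \<le> 1/2\<close> and \<open>b\<close> is the quasi square root for
  \<open>st a * a\<close>, the squared norm of \<open>\<rho> a x\<close> is that of \<open>x\<close>
  minus that of \<open>x - \<rho> b x\<close>. The factor 2 results from rescaling \<open>a\<close>
  to norm 1/2 and is harmless in density arguments.\<close>

lemma star_rep_bounded:
  fixes st :: "'a::{real_normed_algebra,banach} \<Rightarrow> 'a"
    and \<rho> :: "'a \<Rightarrow> 'h::{real_inner,complete_space} \<Rightarrow> 'h"
  assumes cs: "cstar_algebra ciA st" and rep: "star_rep ciA st ci \<rho>"
  shows "norm (\<rho> a x) \<le> 2 * norm a * norm x"
proof -
  have bl: "bounded_linear (\<rho> a)" for a using rep by (simp add: star_rep_def bounded_op_def)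
  have \<rho>_add: "\<rho> (a + b) x = \<rho> a x + \<rho> b x" for a b x using rep by (simp add: star_rep_def)
  have \<rho>_scale: "\<rho> (r *\<^sub>R a) x = r *\<^sub>R \<rho> a x" for r a x using rep by (simp add: star_rep_def)
  have \<rho>_mult: "\<rho> (a * b) x = \<rho> a (\<rho> b x)" for a b x using rep by (simp add: star_rep_def)
  have \<rho>_diff: "\<rho> (a - b) x = \<rho> a x - \<rho> b x" for a b x
    using \<rho>_add[of a "(-1) *\<^sub>R b" x] \<rho>_scale[of "-1" b x] by simp
  have adj: "inner (\<rho> a x) y = inner x (\<rho> (st a) y)" for a x y
    using rep inner_badj[OF bl] by (simp add: star_rep_def)
  have small: "norm (\<rho> a x) \<le> norm x" if a: "norm a \<le> 1/2" for a x
  proof -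
    have "norm (st a * a) \<le> norm (st a) * norm a" by (rule norm_mult_ineq)
    also have "\<dots> \<le> 1 * (1/2)" unfolding cstar_norm_st[OF cs] using a by (intro mult_mono) simp_all
    finally have "norm (st a * a) \<le> 1/2" by simp
    moreover have "st (st a * a) = st a * a" using cs by (simp add: cstar_algebra_def)
    ultimately obtain b where b: "st b = b" "b + b - b * b = st a * a"
      using cstar_quasi_sqrt[OF cs] by blast
    have "inner (\<rho> a x) (\<rho> a x) = inner x (\<rho> (b + b - b * b) x)"
      by (simp add: adj b(2) \<rho>_mult)
    also have "\<dots> = inner x (\<rho> b x) + inner x (\<rho> b x) - inner (\<rho> b x) (\<rho> b x)"
      by (simp add: \<rho>_diff \<rho>_add \<rho>_mult inner_diff_right inner_add_right adj b(1))
    also have "\<dots> = inner x x - inner (x - \<rho> b x) (x - \<rho> b x)"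
      by (simp add: inner_diff inner_commute)
    also have "\<dots> \<le> inner x x" by simp
    finally show ?thesis by (simp add: norm_le)
  qed
  show ?thesis
  proof (cases "a = 0")
    case True
    then show ?thesis using \<rho>_scale[of 0 0 x] by simp
  next
    case False
    define r where "r = 1 / (2 * norm a)"
    have "norm (\<rho> (r *\<^sub>R a) x) \<le> norm x" by (rule small) (use False in \<open>simp add: r_def\<close>)
    then show ?thesis using False by (simp add: \<rho>_scale r_def divide_simps mult.commute)
  qed
qed

text \<open>Lipschitz dependence on the parameter makes \<open>\<Phi> a\<close> a norm limit of
  compact operators. The sign of \<open>C\<close> is arbitrary, hence
  \<open>\<bar>C\<bar> + 1\<close> in the proof.\<close>

lemma compact_op_closure:
  fixes \<Phi> :: "'a::real_normed_vector \<Rightarrow> 'h::{real_normed_vector,complete_space} \<Rightarrow> 'h"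
  assumes lin: "\<And>a. linear (\<Phi> a)" and C: "\<And>a b x. norm (\<Phi> a x - \<Phi> b x) \<le> C * norm (a - b) * norm x"
    and cpt: "\<And>b. b \<in> B \<Longrightarrow> compact_op (\<Phi> b)" and a: "a \<in> closure B"
  shows "compact_op (\<Phi> a)"
proof (rule compact_op_limit)
  fix e :: real assume e: "e > 0"
  have pos: "\<bar>C\<bar> + 1 > 0" by simp
  obtain b where b: "b \<in> B" "dist b a < e / (\<bar>C\<bar> + 1)"
    using a e pos unfolding closure_approachable by (metis divide_pos_pos)
  have "norm (\<Phi> a x - \<Phi> b x) \<le> e * norm x" for x
  proof (rule order_trans[OF C], rule mult_right_mono)
    have "C * norm (a - b) \<le> (\<bar>C\<bar> + 1) * (e / (\<bar>C\<bar> + 1))"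
      using b(2) by (intro mult_mono) (simp_all add: dist_norm norm_minus_commute)
    then show "C * norm (a - b) \<le> e" using pos by simp
  qed simp
  then show "\<exists>B. compact_op B \<and> (\<forall>x. norm (\<Phi> a x - B x) \<le> e * norm x)"
    using cpt[OF b(1)] by blast
qed (rule lin)

theorem theorem1p1:
  fixes ciA st :: "'a::{real_normed_algebra,banach} \<Rightarrow> 'a"
    and J A0 J0 :: "'a set"
    and ci :: "'h::{real_inner,complete_space} \<Rightarrow> 'h"
    and \<rho> :: "'a \<Rightarrow> 'h \<Rightarrow> 'h"
    and dm :: "'h set" and D :: "'h \<Rightarrow> 'h" and m :: real
  assumes "hrst_odd ciA st J ci \<rho> A0 J0 dm D m"
  defines "F \<equiv> bounded_transform dm D"
  shows "(\<forall>j\<in>J. compact_op (\<lambda>x. \<rho> j (F x - badj F x))) \<and>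
         (\<forall>j\<in>J. compact_op (\<lambda>x. \<rho> j (x - F (F x)))) \<and>
         (\<forall>a. compact_op (\<lambda>x. F (\<rho> a x) - \<rho> a (F x))) \<and>
         kcycle_odd ciA st J ci \<rho> F \<and>
         (\<forall>g. hrst_even ciA st J ci g \<rho> A0 J0 dm D m \<longrightarrow> kcycle_even ciA st J ci g \<rho> F)"
proof -
  note hrst = assms(1)[unfolded hrst_odd_def]
  interpret op: closed_symmetric_op ci dm D
    using hrst by unfold_locales blast
  have m: "m > 0" and cs: "cstar_algebra ciA st" and sep: "separable_hilbert ci"
    and rep: "star_rep ciA st ci \<rho>" and A0: "star_subalgebra ciA st A0" and A0_dense: "closure A0 = UNIV"
    and J0: "star_subalgebra ciA st J0" and J0_A0: "J0 \<subseteq> A0" and J0_dense: "closure J0 = J"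
    using hrst by blast+
  have F_eq: "F = op.F" unfolding F_def by (rule op.bounded_transform_eq)
  have Fbl: "bounded_linear F" unfolding F_eq by (rule op.F_bounded_linear)
  have F'bl: "bounded_linear (badj F)" by (rule bounded_linear_badj[OF Fbl])
  interpret F: bounded_linear F by (rule Fbl)
  have \<rho>_bl: "bounded_linear (\<rho> a)" for a using rep by (simp add: star_rep_def bounded_op_def)
  interpret \<rho>: bounded_linear "\<rho> a" for a by (rule \<rho>_bl)
  have \<rho>_mult: "\<rho> (a * b) x = \<rho> a (\<rho> b x)" for a b x using rep by (simp add: star_rep_def)
  have \<rho>_add: "\<rho> (a + b) x = \<rho> a x + \<rho> b x" for a b x using rep by (simp add: star_rep_def)
  have \<rho>_scale: "\<rho> (r *\<^sub>R a) x = r *\<^sub>R \<rho> a x" for r a x using rep by (simp add: star_rep_def)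
  have \<rho>_diff: "\<rho> (a - b) x = \<rho> a x - \<rho> b x" for a b x
    using \<rho>_add[of a "(-1) *\<^sub>R b" x] \<rho>_scale[of "-1" b x] by simp
  have st_st: "st (st a) = a" for a using cs by (simp add: cstar_algebra_def)
  have adj: "inner (\<rho> a x) y = inner x (\<rho> (st a) y)" for a x y
    using rep inner_badj[OF \<rho>_bl] by (simp add: star_rep_def)
  have adj': "inner (\<rho> (st a) x) y = inner x (\<rho> a y)" for a x y
    using adj[of "st a" x y] by (simp add: st_st)
  have A0_st: "st a \<in> A0" if "a \<in> A0" for a using A0 that by (auto simp: star_subalgebra_def)
  have J0_st: "st j \<in> J0" if "j \<in> J0" for j using J0 that by (auto simp: star_subalgebra_def)
  have J0_mult: "i * j \<in> J0" if "i \<in> J0" "j \<in> J0" for i j using J0 that by (auto simp: star_subalgebra_def)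

  \<comment> \<open>Reduces compactness statements from \<open>J\<close> to its dense subalgebra
    \<open>J0\<close>; applied with \<open>B\<close> equal to \<open>F - badj F\<close> and to
    \<open>op.S\<close>.\<close>
  have ideal_closure: "compact_op (\<lambda>x. \<rho> j (B x))"
    if B: "bounded_linear B" and cpt: "\<And>i. i \<in> J0 \<Longrightarrow> compact_op (\<lambda>x. \<rho> i (B x))" and j: "j \<in> J" for B j
  proof -
    obtain C where C: "C > 0" "\<And>x. norm (B x) \<le> C * norm x" using bounded_linear_bound[OF B] by blast
    show ?thesis
    proof (rule compact_op_closure[where \<Phi> = "\<lambda>j x. \<rho> j (B x)" and C = "2 * C"])
      show "linear (\<lambda>x. \<rho> a (B x))" for a
        by (rule bounded_linear.linear[OF bounded_linear_compose[OF \<rho>_bl B]])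
      show "norm (\<rho> a (B x) - \<rho> b (B x)) \<le> 2 * C * norm (a - b) * norm x" for a b x
      proof -
        have "norm (\<rho> (a - b) (B x)) \<le> 2 * norm (a - b) * norm (B x)" by (rule star_rep_bounded[OF cs rep])
        also have "\<dots> \<le> 2 * norm (a - b) * (C * norm x)" by (intro mult_left_mono C) simp
        finally show ?thesis by (simp add: \<rho>_diff ac_simps)
      qed
      show "j \<in> closure J0" using j J0_dense by simp
    qed (rule cpt)
  qed

  have adm: "op.admissible (\<rho> a)" if a: "a \<in> A0" for a
  proof -
    have in_dm: "\<rho> a ` dm \<subseteq> dm" and cpt: "compact_op (commD D (\<rho> a) \<circ> inv_sqrt_op dm D)"
      and bound: "\<exists>C. \<forall>y x. pow_rel (res_op dm D) (1/2 - 1/(2*m)) y x \<and> x \<in> dm \<longrightarrow>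
              norm (commD D (\<rho> a) x) \<le> C * norm y"
      using hrst a by blast+
    have comm: "op.comm (\<rho> a) x = commD D (\<rho> a) (op.S x)" for x
      by (simp add: op.comm_def commD_def op.F_def)
    have "op.comm (\<rho> a) = commD D (\<rho> a) \<circ> inv_sqrt_op dm D"
      by (rule ext) (simp add: comm op.inv_sqrt_op_eq)
    then have "compact_op (op.comm (\<rho> a))" using cpt by simp
    moreover have "op.sub_order (op.comm (\<rho> a))"
    proof -
      obtain C where "\<And>y x. pow_rel (res_op dm D) (1/2 - 1/(2*m)) y x \<Longrightarrow> x \<in> dm \<Longrightarrow>
          norm (commD D (\<rho> a) x) \<le> C * norm y" using bound by blast
      then show ?thesis
        by (intro op.sub_order_if_pow_rel_bounded[OF m, where C = C]) (simp add: comm op.S_in_dm)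
    qed
    ultimately show ?thesis using \<rho>_bl in_dm by (simp add: op.admissible_def)
  qed

  have comm_A0: "compact_op (\<lambda>x. F (\<rho> a x) - \<rho> a (F x))" if a: "a \<in> A0" for a
    unfolding F_eq by (rule op.compact_commutator[OF adm[OF a] adm[OF A0_st[OF a]] adj])
  have comm_A: "compact_op (\<lambda>x. F (\<rho> a x) - \<rho> a (F x))" for a
  proof -
    obtain C where C: "C > 0" "\<And>x. norm (F x) \<le> C * norm x" using bounded_linear_bound[OF Fbl] by blast
    show ?thesis
    proof (rule compact_op_closure[where \<Phi> = "\<lambda>a x. F (\<rho> a x) - \<rho> a (F x)" and C = "4 * C"])
      show "linear (\<lambda>x. F (\<rho> a x) - \<rho> a (F x))" for a
        by (intro bounded_linear.linear bounded_linear_sub bounded_linear_compose[OF Fbl \<rho>_bl]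
            bounded_linear_compose[OF \<rho>_bl Fbl])
      show "norm ((F (\<rho> a x) - \<rho> a (F x)) - (F (\<rho> b x) - \<rho> b (F x))) \<le> 4 * C * norm (a - b) * norm x" for a b x
      proof -
        have "(F (\<rho> a x) - \<rho> a (F x)) - (F (\<rho> b x) - \<rho> b (F x)) = F (\<rho> (a - b) x) - \<rho> (a - b) (F x)"
          by (simp add: \<rho>_diff F.diff)
        also have "norm \<dots> \<le> norm (F (\<rho> (a - b) x)) + norm (\<rho> (a - b) (F x))" by (rule norm_triangle_ineq4)
        also have "\<dots> \<le> C * (2 * norm (a - b) * norm x) + 2 * norm (a - b) * (C * norm x)"
        proof (rule add_mono)
          show "norm (F (\<rho> (a - b) x)) \<le> C * (2 * norm (a - b) * norm x)"
            by (rule order_trans[OF C(2)], rule mult_left_mono[OF star_rep_bounded[OF cs rep]]) (use C in simp)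
          show "norm (\<rho> (a - b) (F x)) \<le> 2 * norm (a - b) * (C * norm x)"
            by (rule order_trans[OF star_rep_bounded[OF cs rep]], rule mult_left_mono[OF C(2)]) simp
        qed
        finally show ?thesis by (simp add: ac_simps)
      qed
      show "a \<in> closure A0" by (simp add: A0_dense)
    qed (rule comm_A0)
  qed

  have diff_bl: "bounded_linear (\<lambda>x. F x - badj F x)" by (rule bounded_linear_sub[OF Fbl F'bl])
  have adjoint_J0: "compact_op (\<lambda>x. \<rho> j (F x - badj F x))" if j: "j \<in> J0" for j
  proof -
    \<comment> \<open>\<open>b\<close> is treated as the product of \<open>st j\<close> and
      \<open>j\<close>, so that the domain condition for \<open>\<rho> j\<close> serves both for
      \<open>j2\<close> and for the adjoint of \<open>j1\<close>.\<close>
    define b where "b = st j * j"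
    \<comment> \<open>\<open>T\<close> is the adjoint of \<open>F - badj F\<close> followed by
      \<open>\<rho> b\<close>. It is the difference of \<open>badj F \<rho> b - \<rho> b F\<close>
      and \<open>F \<rho> b - \<rho> b F\<close>, both of which are compact.\<close>
    define T where "T x = badj F (\<rho> b x) - F (\<rho> b x)" for x
    have b: "b \<in> J0" unfolding b_def by (rule J0_mult[OF J0_st[OF j] j])
    have j_dom: "\<rho> j ` adj_dom dm D \<subseteq> dm" using hrst j by blast
    have mem: "b \<in> A0" "j \<in> A0" "st j \<in> A0" using b j J0_A0 J0_st by blast+
    have b_eq: "\<rho> b = (\<lambda>x. \<rho> (st j) (\<rho> j x))" by (rule ext) (simp add: b_def \<rho>_mult)
    have "compact_op (\<lambda>x. badj F (\<rho> (st j) (\<rho> j x)) - \<rho> (st j) (\<rho> j (F x)))"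
      unfolding F_eq
      by (rule op.compact_adjoint_commutator[where j1' = "\<rho> j" and j2' = "\<rho> (st j)"])
        (use adm mem j_dom \<rho>_bl adj adj' in \<open>simp_all add: b_eq[symmetric]\<close>)
    then have "compact_op (\<lambda>x. badj F (\<rho> b x) - \<rho> b (F x))" by (simp add: b_eq)
    from compact_op_diff[OF this comm_A[of b]] have "compact_op T" by (simp add: T_def[abs_def])
    then have "compact_op (badj T)" by (rule compact_op_badj)
    moreover have "badj T = (\<lambda>x. \<rho> b (F x - badj F x))"
    proof (rule badj_eqI)
      show "bounded_linear T" using \<open>compact_op T\<close> by (rule compact_op_bounded_linear)
      show "inner (T x) y = inner x (\<rho> b (F y - badj F y))" for x y
        by (simp add: T_def inner_diff_left inner_badj_left[OF Fbl] inner_badj[OF Fbl]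
            b_def \<rho>_mult adj st_st \<rho>.diff inner_diff_right)
    qed
    ultimately have cb: "compact_op (\<lambda>x. \<rho> b (F x - badj F x))" by simp
    show ?thesis
    proof (rule compact_op_square_root)
      show Wbl: "bounded_linear (\<lambda>x. \<rho> j (F x - badj F x))" by (rule bounded_linear_compose[OF \<rho>_bl diff_bl])
      \<comment> \<open>With W for the operator on the left, the product of its adjoint with W is
        \<open>badj F - F\<close> after \<open>\<rho> b (F - badj F)\<close>, and the latter is
        compact by \<open>cb\<close>.\<close>
      have "badj (\<lambda>x. \<rho> j (F x - badj F x)) = (\<lambda>y. badj F (\<rho> (st j) y) - F (\<rho> (st j) y))"
        by (rule badj_eqI[OF Wbl])
          (simp add: adj inner_diff_left inner_badj_left[OF Fbl] inner_badj[OF Fbl] inner_diff_right)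
      then show "compact_op (\<lambda>x. badj (\<lambda>x. \<rho> j (F x - badj F x)) (\<rho> j (F x - badj F x)))"
        using compact_op_diff[OF compact_op_compose_left[OF cb F'bl] compact_op_compose_left[OF cb Fbl]]
        by (simp add: b_eq)
    qed
  qed
  have adjoint_J: "compact_op (\<lambda>x. \<rho> j (F x - badj F x))" if "j \<in> J" for j
    using diff_bl adjoint_J0 that by (rule ideal_closure)

  have square_J: "compact_op (\<lambda>x. \<rho> j (x - F (F x)))" if j: "j \<in> J" for j
  proof -
    have "compact_op (\<lambda>x. \<rho> i (op.S x))" if "i \<in> J0" for i
    proof -
      have "compact_op (\<rho> i \<circ> inv_sqrt_op dm D)" using hrst that by blast
      then show ?thesis by (simp add: op.inv_sqrt_op_eq o_def)
    qed
    then have "compact_op (\<lambda>x. \<rho> j (op.S x))"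
      using j by (rule ideal_closure[OF op.S_bounded_linear])
    then have "compact_op (\<lambda>x. \<rho> j (op.S (op.S x)))"
      by (rule compact_op_compose_right[OF _ op.S_bounded_linear])
    from compact_op_diff[OF this compact_op_compose_right[OF adjoint_J[OF j] Fbl]]
    have "compact_op (\<lambda>x. \<rho> j (op.R x) - \<rho> j (F (F x) - badj F (F x)))" by (simp only: op.S_S)
    moreover have "\<rho> j (op.R x) - \<rho> j (F (F x) - badj F (F x)) = \<rho> j (x - F (F x))" for x
      by (simp add: F_eq op.badj_F_F \<rho>.diff)
    ultimately show ?thesis by simp
  qed

  have ci: "linear ci" "\<And>x. ci (ci x) = - x" "\<And>x y. inner (ci x) (ci y) = inner x y"
    using sep by (simp_all add: separable_hilbert_def complex_structure_def)
  have "norm (ci x) = norm x" for x by (simp add: norm_eq_sqrt_inner ci(3))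
  then have ci_bl: "bounded_linear ci"
    using ci(1) by (intro bounded_linear_intro[of ci 1]) (simp_all add: linear_add linear_scale)
  have "F (ci x) = 1 *\<^sub>R ci (F x)" for x
    unfolding F_eq
  proof (rule op.F_intertwines[OF ci_bl])
    \<comment> \<open>\<open>ci\<close> is skew-adjoint, being isometric with square -1; this is the
      sign \<open>d\<close>.\<close>
    show "inner (ci x) y = - 1 * inner x (ci y)" for x y
      using ci(3)[of "ci x" y] by (simp add: ci(2))
  qed (simp_all add: op.dm_ci op.D_ci)
  then have F_op: "bounded_op ci F" using Fbl by (simp add: bounded_op_def)
  have odd: "kcycle_odd ciA st J ci \<rho> F"
    unfolding kcycle_odd_def using sep rep F_op adjoint_J square_J comm_A by blast

  have even: "kcycle_even ciA st J ci g \<rho> F" if g: "hrst_even ciA st J ci g \<rho> A0 J0 dm D m" for g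
  proof -
    note even = g[unfolded hrst_even_def]
    have g_bl: "bounded_linear g" and g_sym: "\<And>x y. inner (g x) y = inner x (g y)"
      using even by (simp_all add: grading_def bounded_op_def)
    have "F (g x) = (- 1) *\<^sub>R g (F x)" for x
      unfolding F_eq
    proof (rule op.F_intertwines[OF g_bl])
      show "inner (g x) y = 1 * inner x (g y)" for x y by (simp add: g_sym)
    qed (use even in auto)
    then show ?thesis unfolding kcycle_even_def using even odd by simp
  qed
  show ?thesis using adjoint_J square_J comm_A odd even by blast
qed

end
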